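(* Let $\zeta,f>0$ be fixed and suppose that $\theta_0\in\mathbb{R}$ is a simple zero of the function $\theta\mapsto \pi f\cos\theta-2\sqrt{2\zeta}$. Then there exist $\varepsilon^*>0$ and a branch $(-\varepsilon^*,\varepsilon^* )\ni\varepsilon\mapsto u(\varepsilon)\in\mathbb{C}+H^2(\mathbb{R})$ such that for each $\varepsilon\in(-\varepsilon^*,\varepsilon^* )$ the function $u=u(\varepsilon)$ solves $$-u''+\zeta u-|u|^2u+\mathrm{i}\varepsilon(-u+f)=0\quad\text{on }\mathbb{R},$$ and which bifurcates from the rotated soliton $\phi_{\theta_0}(x)=\sqrt{2\zeta}\,\operatorname{sech}(\sqrt{\zeta}x)\,\mathrm{e}^{\mathrm{i}\theta_0}$. More precisely, the branch is of the form $$u(\varepsilon)=\phi_{\theta(\varepsilon)}+u_\infty(\varepsilon)+\varphi(\varepsilon),\qquad u(0)=\phi_{\theta_0},$$ where - the map $(-\varepsilon^*,\varepsilon^* )\ni\varepsilon\mapsto\theta(\varepsilon)\in\mathbb{R}$ is real-analytic (the rotational angle of the soliton); - the map $(-\varepsilon^*,\varepsilon^* )\ni\varepsilon\mapsto u_\infty(\varepsilon)\in\mathbb{C}$ is real-analytic, and $u_\infty(\varepsilon)$ is the constant background of the solution at $\pm\infty$; - the map $(-\varepsilon^*,\varepsilon^* )\ni\varepsilon\mapsto\varphi(\varepsilon)\in H^2(\mathbb{R})$ is real-analytic and is a small correction term with $\|\varphi(\varepsilon)\|_{H^2}=\mathcal{O}(|\varepsilon|)$.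
   Context: $H^2(\mathbb{R})=H^2(\mathbb{R},\mathbb{C})$ is the Sobolev space of complex-valued functions, regarded here as a real Banach space (real-analyticity is with respect to this structure). $\mathbb{C}+H^2(\mathbb{R})$ is the set of functions that are the sum of a complex constant and an element of $H^2(\mathbb{R})$. For $\theta\in\mathbb{R}$, $\phi_\theta(x)=\sqrt{2\zeta}\,\operatorname{sech}(\sqrt{\zeta}x)\,\mathrm{e}^{\mathrm{i}\theta}$. A simple zero is a zero at which the derivative does not vanish. *)

theory Defs
  imports "HOL-Analysis.Analysis" "HOL-Library.Landau_Symbols"
begin

definition simple_zero :: "(real \<Rightarrow> real) \<Rightarrow> real \<Rightarrow> bool" where
  "simple_zero g t \<longleftrightarrow> g t = 0 \<and> (\<exists>d. (g has_real_derivative d) (at t) \<and> d \<noteq> 0)"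

definition test_function :: "(real \<Rightarrow> real) \<Rightarrow> bool" where
  "test_function \<eta> \<longleftrightarrow>
     (\<forall>k. ((deriv ^^ k) \<eta>) differentiable_on UNIV) \<and> compact (closure {x. \<eta> x \<noteq> 0})"

definition locally_integrable :: "(real \<Rightarrow> complex) \<Rightarrow> bool" where
  "locally_integrable v \<longleftrightarrow> (\<forall>a b. set_integrable lborel {a..b} v)"

text \<open>The local integrability conditions cannot be dropped: the integral of a non-integrable
  function is 0 by convention.\<close>

definition has_weak_deriv :: "nat \<Rightarrow> (real \<Rightarrow> complex) \<Rightarrow> (real \<Rightarrow> complex) \<Rightarrow> bool" where
  "has_weak_deriv k v w \<longleftrightarrow> locally_integrable v \<and> locally_integrable w \<and>
     (\<forall>\<eta>. test_function \<eta> \<longrightarrow>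
        (LINT x|lborel. (deriv ^^ k) \<eta> x *\<^sub>R v x) = (-1) ^ k * (LINT x|lborel. \<eta> x *\<^sub>R w x))"

text \<open>Weak derivatives are unique up to null sets; \<open>weak_deriv k v\<close> is a representative.\<close>

definition weak_deriv :: "nat \<Rightarrow> (real \<Rightarrow> complex) \<Rightarrow> real \<Rightarrow> complex" where
  "weak_deriv k v = (SOME w. has_weak_deriv k v w)"

definition square_integrable :: "(real \<Rightarrow> complex) \<Rightarrow> bool" where
  "square_integrable v \<longleftrightarrow>
     v \<in> borel_measurable lborel \<and> integrable lborel (\<lambda>x. (cmod (v x))\<^sup>2)"

text \<open>In one dimension every class of functions in the Sobolev space of order 2 contains exactly
  one continuous function; the space is modelled as the set of these representatives.\<close>

definition H2 :: "(real \<Rightarrow> complex) set" where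
  "H2 = {v. continuous_on UNIV v \<and> (\<forall>k\<le>2. \<exists>w. has_weak_deriv k v w \<and> square_integrable w)}"

definition H2_norm :: "(real \<Rightarrow> complex) \<Rightarrow> real" where
  "H2_norm v = sqrt (\<Sum>k\<le>2. LINT x|lborel. (cmod (weak_deriv k v x))\<^sup>2)"

definition const_plus_H2 :: "(real \<Rightarrow> complex) set" where
  "const_plus_H2 = {\<lambda>x. c + v x | c v. v \<in> H2}"

text \<open>Real-analyticity on an open set \<open>S\<close>: local expansion into a power series converging in norm.
  Functions \<open>real \<Rightarrow> complex\<close> carry no normed-space instance, hence the separate version for maps
  into \<open>H2\<close>.\<close>

definition real_analytic_on :: "(real \<Rightarrow> 'a::real_normed_vector) \<Rightarrow> real set \<Rightarrow> bool" where
  "real_analytic_on F S \<longleftrightarrow>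
     (\<forall>s\<in>S. \<exists>r>0. \<exists>a. \<forall>t. \<bar>t - s\<bar> < r \<longrightarrow> (\<lambda>n. (t - s) ^ n *\<^sub>R a n) sums F t)"

definition H2_real_analytic_on :: "(real \<Rightarrow> real \<Rightarrow> complex) \<Rightarrow> real set \<Rightarrow> bool" where
  "H2_real_analytic_on F S \<longleftrightarrow>
     (\<forall>s\<in>S. \<exists>r>0. \<exists>a. (\<forall>n. a n \<in> H2) \<and>
        (\<forall>t. \<bar>t - s\<bar> < r \<longrightarrow> F t \<in> H2 \<and>
           (\<lambda>N. H2_norm (\<lambda>x. F t x - (\<Sum>n<N. (t - s) ^ n *\<^sub>R a n x))) \<longlonglongrightarrow> 0))"

definition soliton :: "real \<Rightarrow> real \<Rightarrow> real \<Rightarrow> complex" where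
  "soliton \<zeta> \<theta> x =
     complex_of_real (sqrt (2 * \<zeta>) * (1 / cosh (sqrt \<zeta> * x))) * exp (\<i> * complex_of_real \<theta>)"

text \<open>The equation is an identity in \<open>L\<^sup>2\<^sub>l\<^sub>o\<^sub>c\<close>, with \<open>w\<close> the weak second derivative of \<open>u\<close>.\<close>

definition solves_LLE :: "real \<Rightarrow> real \<Rightarrow> real \<Rightarrow> (real \<Rightarrow> complex) \<Rightarrow> bool" where
  "solves_LLE \<zeta> f \<epsilon> u \<longleftrightarrow> (\<exists>w. has_weak_deriv 2 u w \<and>
     (AE x in lborel.
        - w x + complex_of_real \<zeta> * u x - complex_of_real ((cmod (u x))\<^sup>2) * u x
          + \<i> * complex_of_real \<epsilon> * (- u x + complex_of_real f) = 0))"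

end

theory Submission
  imports Defs
begin

text \<open>
  The angle can be kept constant, \<open>\<theta>(\<epsilon>) = \<theta>\<^sub>0\<close>: a rotation of the soliton by \<open>O(\<epsilon>)\<close> can be absorbed
  in the correction. With \<open>\<kappa>\<^sup>2 = \<zeta>\<close>, \<open>\<phi> = sqrt 2 \<kappa> sech (\<kappa> x)\<close>, \<open>e\<^sup>-\<^sup>i\<^sup>\<theta> = p + \<i> q\<close> and
  \<open>u = e\<^sup>i\<^sup>\<theta> (\<phi> + \<epsilon> \<alpha> + \<i> \<epsilon> \<beta>)\<close> for even real functions \<open>\<alpha>, \<beta>\<close> the equation becomes
  \<open>L\<^sub>+ \<alpha> = f q - \<epsilon> \<beta> + \<epsilon> (3 \<phi> \<alpha>\<^sup>2 + \<phi> \<beta>\<^sup>2) + \<epsilon>\<^sup>2 (\<alpha>\<^sup>2 + \<beta>\<^sup>2) \<alpha>\<close> and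
  \<open>L\<^sub>- \<beta> = \<phi> - f p + \<epsilon> (2 \<phi> \<alpha> \<beta> + \<alpha>) + \<epsilon>\<^sup>2 (\<alpha>\<^sup>2 + \<beta>\<^sup>2) \<beta>\<close>, where \<open>L\<^sub>+ = - \<partial>\<^sup>2 + \<kappa>\<^sup>2 - 3 \<phi>\<^sup>2\<close> and
  \<open>L\<^sub>- = - \<partial>\<^sup>2 + \<kappa>\<^sup>2 - \<phi>\<^sup>2\<close>. On even functions of the form constant plus exponentially decaying,
  \<open>L\<^sub>+\<close> is invertible and \<open>L\<^sub>-\<close> has kernel and cokernel \<open>\<phi>\<close>; both have explicit Green's functions.
  At \<open>\<epsilon> = 0\<close> solvability means \<open>\<pi> f cos \<theta>\<^sub>0 = 2 sqrt (2 \<zeta>)\<close>. At the next order it is an affine equation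
  for the component of \<open>\<beta>\<close> along \<open>\<phi>\<close> whose leading coefficient is a multiple of
  \<open>q \<integral> \<phi>\<^sup>3 (L\<^sub>+\<^sup>-\<^sup>1 1)\<close>, which is nonzero since \<open>sin \<theta>\<^sub>0 \<noteq> 0\<close>. With auxiliary unknowns the system
  takes the form \<open>Z = \<epsilon> y + N Z + B(Z, Z)\<close> in a Banach space, with \<open>N\<close> nilpotent and \<open>B\<close> bilinear, and is
  solved by a power series in \<open>\<epsilon>\<close>.
\<close>

section \<open>Quadratic equations in Banach spaces\<close>

text \<open>Dividing by \<epsilon> leaves a problem that is still degenerate at \<epsilon> = 0: the
  component of \<beta> along the kernel is free there and is fixed only by solvability one order
  later. That condition is therefore made an equation of the system, while \<open>Lm\<close>
  projects its argument first and so is defined on every source; true solvability is recovered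
  afterwards, on solutions only.

  In (\<epsilon>, \<alpha>, \<beta>) the equations have degree five. Treating \<epsilon> \<alpha>,
  \<epsilon> \<beta> and \<epsilon> (\<alpha>^2 + \<beta>^2) as unknowns of their own makes every
  nonlinearity bilinear. Measuring the other unknowns from their values at \<epsilon> = 0 moves the
  base point to zero; the coupling to those values is linear but not small, and it is harmless
  because it is triangular. A quadratic equation has a power series with a simple majorant, which
  gives existence and analyticity at once.

  All analysis takes place in a weighted Banach space of profiles; a linear map with a uniform bound
  carries the result to \<open>H2\<close>.\<close>

instance bcontfun :: (metric_space, banach) banach ..

text \<open>The scalar theorem for the norms does the work. Square minus triangle of the partial
  sums is a sum over the complement of the triangle; it is bounded by \<open>K\<close> times the
  same difference for the norm series, which tends to 0.\<close>

lemma (in bounded_bilinear) Cauchy_product_sums: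
  fixes a :: "nat \<Rightarrow> 'a" and b :: "nat \<Rightarrow> 'b"
  assumes a: "summable (\<lambda>n. norm (a n))" and b: "summable (\<lambda>n. norm (b n))"
    and A: "a sums x" and B: "b sums y"
  shows "(\<lambda>n. \<Sum>i\<le>n. prod (a i) (b (n - i))) sums prod x y"
proof -
  obtain K where K: "K > 0" "\<And>u v. norm (prod u v) \<le> norm u * norm v * K"
    using pos_bounded by blast
  have KK: "norm (prod u v) \<le> K * (norm u * norm v)" for u v
    using K(2)[of u v] by (simp only: mult.commute)
  define Q where "Q n = {(i, j). i + j < n}" for n :: nat
  have finQ: "finite (Q n)" and subQ: "Q n \<subseteq> {..<n} \<times> {..<n}" for n
  proof -
    show "Q n \<subseteq> {..<n} \<times> {..<n}" by (auto simp: Q_def)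
    then show "finite (Q n)" by (rule finite_subset) simp
  qed
  have square: "(\<Sum>(i, j)\<in>{..<n} \<times> {..<n}. prod (a i) (b j)) = prod (\<Sum>i<n. a i) (\<Sum>j<n. b j)" for n
    by (simp only: sum_left) (simp add: sum_right sum.cartesian_product)
  have "(\<lambda>n. (\<Sum>k<n. norm (a k)) * (\<Sum>k<n. norm (b k)) -
          (\<Sum>k<n. \<Sum>i\<le>k. norm (a i) * norm (b (k - i)))) \<longlonglongrightarrow>
        (\<Sum>k. norm (a k)) * (\<Sum>k. norm (b k)) - (\<Sum>k. norm (a k)) * (\<Sum>k. norm (b k))"
    using Series.Cauchy_product_sums[of "\<lambda>n. norm (a n)" "\<lambda>n. norm (b n)"] a b
    by (intro tendsto_diff tendsto_mult summable_LIMSEQ) (auto simp: sums_def)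
  then have lim: "(\<lambda>n. K * ((\<Sum>k<n. norm (a k)) * (\<Sum>k<n. norm (b k)) -
          (\<Sum>k<n. \<Sum>i\<le>k. norm (a i) * norm (b (k - i))))) \<longlonglongrightarrow> 0"
    by (auto intro: tendsto_mult_right_zero)
  have "norm (prod (\<Sum>i<n. a i) (\<Sum>j<n. b j) - (\<Sum>k<n. \<Sum>i\<le>k. prod (a i) (b (k - i)))) \<le>
        K * ((\<Sum>k<n. norm (a k)) * (\<Sum>k<n. norm (b k)) -
          (\<Sum>k<n. \<Sum>i\<le>k. norm (a i) * norm (b (k - i))))" for n
  proof -
    define D where "D = {..<n} \<times> {..<n} - Q n"
    define F where "F = (\<lambda>(i, j). prod (a i) (b j))"
    define G where "G = (\<lambda>(i, j). norm (a i) * norm (b j))"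
    have 1: "prod (\<Sum>i<n. a i) (\<Sum>j<n. b j) - (\<Sum>k<n. \<Sum>i\<le>k. prod (a i) (b (k - i))) = sum F D"
      using sum_diff[OF _ subQ[of n], of F]
      by (simp add: F_def D_def square[symmetric] Q_def sum.triangle_reindex)
    have 2: "norm (sum F D) \<le> (\<Sum>p\<in>D. norm (F p))"
      by (rule norm_sum)
    have 3: "(\<Sum>p\<in>D. norm (F p)) \<le> (\<Sum>p\<in>D. K * G p)"
      by (rule sum_mono) (simp add: F_def G_def case_prod_unfold KK)
    have 4: "(\<Sum>p\<in>D. K * G p) = K * (sum G ({..<n} \<times> {..<n}) - sum G (Q n))"
      unfolding D_def sum_distrib_left[symmetric] using sum_diff[OF _ subQ[of n], of G] by simp
    have 5: "sum G ({..<n} \<times> {..<n}) = (\<Sum>k<n. norm (a k)) * (\<Sum>k<n. norm (b k))"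
      by (simp add: G_def sum.cartesian_product[symmetric] sum_product)
    have 6: "sum G (Q n) = (\<Sum>k<n. \<Sum>i\<le>k. norm (a i) * norm (b (k - i)))"
      unfolding G_def Q_def by (rule sum.triangle_reindex)
    show ?thesis unfolding 1 using order_trans[OF 2 3] unfolding 4 5 6 .
  qed
  then have "(\<lambda>n. (\<Sum>k<n. \<Sum>i\<le>k. prod (a i) (b (k - i))) - prod (\<Sum>i<n. a i) (\<Sum>j<n. b j))
      \<longlonglongrightarrow> 0"
    unfolding norm_minus_commute[of "prod _ _"]
    by (intro Lim_null_comparison[OF always_eventually lim] allI)
  moreover have "(\<lambda>n. prod (\<Sum>i<n. a i) (\<Sum>j<n. b j)) \<longlonglongrightarrow> prod x y"
    using A B by (intro tendsto) (auto simp: sums_def)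
  ultimately show ?thesis
    unfolding sums_def by (rule Lim_transform[rotated])
qed

text \<open>Power series coefficients of the solution of Z = t y + B(Z, Z), found by comparing
  powers of t. The range omits both end points so that only smaller indices are called; at n = 0 it
  is empty, which makes that coefficient 0.\<close>

function quadratic_coeffs :: "('a \<Rightarrow> 'a \<Rightarrow> 'a) \<Rightarrow> 'a \<Rightarrow> nat \<Rightarrow> 'a::real_vector" where
  "quadratic_coeffs B y n =
     (if n = 1 then y
      else \<Sum>i\<in>{1..<n}. B (quadratic_coeffs B y i) (quadratic_coeffs B y (n - i)))"
  by pat_completeness auto
termination by (relation "Wellfounded.measure (\<lambda>(B, y, n). n)") auto

declare quadratic_coeffs.simps [simp del]

lemma quadratic_coeffs_0: "quadratic_coeffs B y 0 = 0"
  and quadratic_coeffs_1: "quadratic_coeffs B y (Suc 0) = y"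
  by (subst quadratic_coeffs.simps; simp)+

lemma quadratic_coeffs_convolution:
  assumes "bounded_bilinear B" and "n \<noteq> 1"
  shows "quadratic_coeffs B y n =
    (\<Sum>i\<le>n. B (quadratic_coeffs B y i) (quadratic_coeffs B y (n - i)))"
proof -
  interpret bounded_bilinear B by fact
  have "(\<Sum>i\<le>n. B (quadratic_coeffs B y i) (quadratic_coeffs B y (n - i))) =
        (\<Sum>i\<in>{1..<n}. B (quadratic_coeffs B y i) (quadratic_coeffs B y (n - i)))"
  proof (rule sum.mono_neutral_right)
    show "\<forall>i\<in>{..n} - {1..<n}. B (quadratic_coeffs B y i) (quadratic_coeffs B y (n - i)) = 0"
    proof
      fix i assume "i \<in> {..n} - {1..<n}"
      then have "i = 0 \<or> n - i = 0" by auto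
      then show "B (quadratic_coeffs B y i) (quadratic_coeffs B y (n - i)) = 0"
        by (auto simp: quadratic_coeffs_0 zero_left zero_right)
    qed
  qed auto
  then show ?thesis using assms(2) by (subst quadratic_coeffs.simps) simp
qed

text \<open>With \<open>S\<^sub>n\<close> the partial sums of the majorant series, the recursion gives
  \<open>S\<^sub>n\<^sub>+\<^sub>1 \<le> r \<parallel>y\<parallel> + K S\<^sub>n\<^sup>2\<close>, so \<open>S\<^sub>n \<le> 2 r \<parallel>y\<parallel>\<close> persists when \<open>4 K r \<parallel>y\<parallel> \<le> 1\<close>.\<close>

lemma summable_quadratic_coeffs:
  fixes y :: "'a::banach"
  assumes "bounded_bilinear B"
  shows "\<exists>r>0. summable (\<lambda>n. norm (quadratic_coeffs B y n) * r ^ n)"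
proof -
  interpret bounded_bilinear B by fact
  obtain K where K: "K > 0" "\<And>u v. norm (B u v) \<le> norm u * norm v * K"
    using pos_bounded by blast
  define r where "r = 1 / (4 * K * (norm y + 1))"
  define c where "c n = norm (quadratic_coeffs B y n) * r ^ n" for n
  have "K * (norm y + 1) > 0" using K by (simp add: add_nonneg_pos)
  then have r: "r > 0" "4 * K * (r * norm y) \<le> 1"
    using K(1) by (auto simp: r_def field_simps mult_nonneg_nonneg add_pos_nonneg)
  have c_nonneg: "c n \<ge> 0" for n using r by (simp add: c_def)
  have c01: "c 0 = 0" "c (Suc 0) = r * norm y"
    by (simp_all add: c_def quadratic_coeffs_0 quadratic_coeffs_1)
  have c_rec: "c n \<le> K * (\<Sum>i\<le>n. c i * c (n - i))" if "n \<noteq> 1" for n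
  proof -
    have "c n \<le> (\<Sum>i\<le>n. norm (quadratic_coeffs B y i) * norm (quadratic_coeffs B y (n - i)) * K) * r ^ n"
      unfolding c_def quadratic_coeffs_convolution[OF assms that, of y]
      using r by (intro mult_right_mono order_trans[OF norm_sum] sum_mono K(2)) auto
    also have "\<dots> = (\<Sum>i\<le>n. K * (c i * c (n - i)))"
      unfolding sum_distrib_right
      by (rule sum.cong) (auto simp: c_def power_add[symmetric] mult_ac)
    finally show ?thesis by (simp add: sum_distrib_left)
  qed
  have bound: "sum c {..<n} \<le> 2 * r * norm y" for n
  proof (induction n)
    case (Suc n)
    have "sum c {..<Suc n} \<le> c 1 + K * (\<Sum>k<Suc n. \<Sum>i\<in>{1..<k}. c i * c (k - i))"
    proof -
      have "c k \<le> (if k = 1 then c 1 else 0) + K * (\<Sum>i\<in>{1..<k}. c i * c (k - i))" for k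
      proof (cases "k = 1")
        case False
        have "(\<Sum>i\<le>k. c i * c (k - i)) = (\<Sum>i\<in>{1..<k}. c i * c (k - i))"
        proof (rule sum.mono_neutral_right)
          show "\<forall>i\<in>{..k} - {1..<k}. c i * c (k - i) = 0"
          proof
            fix i assume "i \<in> {..k} - {1..<k}"
            then have "i = 0 \<or> k - i = 0" by auto
            then show "c i * c (k - i) = 0" using c01(1) by auto
          qed
        qed auto
        then show ?thesis using c_rec[OF False] False by simp
      qed auto
      then have "sum c {..<Suc n} \<le>
          (\<Sum>k<Suc n. (if k = 1 then c 1 else 0) + K * (\<Sum>i\<in>{1..<k}. c i * c (k - i)))"
        by (intro sum_mono)
      also have "\<dots> = (\<Sum>k<Suc n. if k = 1 then c 1 else 0) +
          K * (\<Sum>k<Suc n. \<Sum>i\<in>{1..<k}. c i * c (k - i))"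
        by (simp only: sum.distrib sum_distrib_left)
      also have "(\<Sum>k<Suc n. if k = 1 then c 1 else 0) \<le> c 1"
        using c_nonneg[of 1] by (simp add: sum.delta del: sum.lessThan_Suc)
      finally show ?thesis by simp
    qed
    also have "(\<Sum>k<Suc n. \<Sum>i\<in>{1..<k}. c i * c (k - i)) =
        (\<Sum>(k, i)\<in>Sigma {..<Suc n} (\<lambda>k. {1..<k}). c i * c (k - i))"
      by (rule sum.Sigma) auto
    also have "\<dots> = (\<Sum>(i, j)\<in>(\<lambda>(k, i). (i, k - i)) ` Sigma {..<Suc n} (\<lambda>k. {1..<k}). c i * c j)"
      by (subst sum.reindex) (auto simp: inj_on_def case_prod_unfold)
    \<comment> \<open>Both indices are at least 1 and add up to at most n, so each is below n: the
      triangle lies in the square of side n, and the bound for \<open>Suc n\<close> rests on the one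
      for n.\<close>
    also have "\<dots> \<le> (\<Sum>(i, j)\<in>{..<n} \<times> {..<n}. c i * c j)"
      by (rule sum_mono2) (auto intro!: mult_nonneg_nonneg c_nonneg)
    also have "\<dots> = sum c {..<n} * sum c {..<n}"
      by (simp add: sum.cartesian_product[symmetric] sum_product)
    also have "\<dots> \<le> (2 * r * norm y) * (2 * r * norm y)"
      using Suc by (intro mult_mono sum_nonneg c_nonneg) (use r in auto)
    finally have "sum c {..<Suc n} \<le> r * norm y + (4 * K * (r * norm y)) * (r * norm y)"
      using K(1) by (simp add: c01 algebra_simps)
    also have "\<dots> \<le> r * norm y + 1 * (r * norm y)"
      using r by (intro add_left_mono mult_right_mono) auto
    finally show ?case by simp
  qed (use r in auto)
  have "summable c"
    by (rule bounded_imp_summable[of _ "2 * r * norm y"])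
       (use bound[of "Suc _"] c_nonneg in \<open>auto simp: lessThan_Suc_atMost\<close>)
  with r show ?thesis unfolding c_def by blast
qed

lemma summable_norm_scaleR_power:
  fixes z :: "nat \<Rightarrow> 'a::real_normed_vector"
  assumes "summable (\<lambda>n. norm (z n) * r ^ n)" and "\<bar>t\<bar> \<le> r"
  shows "summable (\<lambda>n. norm (t ^ n *\<^sub>R z n))"
  by (rule summable_comparison_test'[OF assms(1), of 0])
     (use assms(2) in \<open>auto simp: power_abs mult.commute[of _ "norm _"] intro!: mult_left_mono power_mono\<close>)

text \<open>The Cauchy product turns the recursion into the equation. At n = 1 the convolution
  vanishes because coefficient 0 is 0, and exactly there the forcing t y enters.\<close>

lemma quadratic_fixed_point_power_series:
  fixes y :: "'a::banach"
  assumes "bounded_bilinear B"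
  obtains z r where "r > 0" "summable (\<lambda>n. norm (z n) * r ^ n)" "z 0 = 0"
    "\<And>t. \<bar>t\<bar> \<le> r \<Longrightarrow> (\<Sum>n. t ^ n *\<^sub>R z n) = t *\<^sub>R y + B (\<Sum>n. t ^ n *\<^sub>R z n) (\<Sum>n. t ^ n *\<^sub>R z n)"
proof -
  interpret bounded_bilinear B by fact
  define z where "z = quadratic_coeffs B y"
  obtain r where r: "r > 0" "summable (\<lambda>n. norm (z n) * r ^ n)"
    using summable_quadratic_coeffs[OF assms] z_def by metis
  have "(\<Sum>n. t ^ n *\<^sub>R z n) = t *\<^sub>R y + B (\<Sum>n. t ^ n *\<^sub>R z n) (\<Sum>n. t ^ n *\<^sub>R z n)"
    if t: "\<bar>t\<bar> \<le> r" for t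
  proof -
    note s = summable_norm_scaleR_power[OF r(2) t]
    have "(\<lambda>n. \<Sum>i\<le>n. B (t ^ i *\<^sub>R z i) (t ^ (n - i) *\<^sub>R z (n - i))) sums
        B (\<Sum>n. t ^ n *\<^sub>R z n) (\<Sum>n. t ^ n *\<^sub>R z n)"
      using s by (intro Cauchy_product_sums summable_sums[OF summable_norm_cancel]) auto
    moreover have "(\<lambda>n. if n = 1 then t *\<^sub>R y else 0) sums (t *\<^sub>R y)"
      using sums_single[of 1 "\<lambda>_. t *\<^sub>R y"] by (simp add: eq_commute)
    ultimately have "(\<lambda>n. (if n = 1 then t *\<^sub>R y else 0) +
          (\<Sum>i\<le>n. B (t ^ i *\<^sub>R z i) (t ^ (n - i) *\<^sub>R z (n - i)))) sums
        (t *\<^sub>R y + B (\<Sum>n. t ^ n *\<^sub>R z n) (\<Sum>n. t ^ n *\<^sub>R z n))"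
      by (intro sums_add)
    moreover have "(if n = 1 then t *\<^sub>R y else 0) +
          (\<Sum>i\<le>n. B (t ^ i *\<^sub>R z i) (t ^ (n - i) *\<^sub>R z (n - i))) = t ^ n *\<^sub>R z n" for n
    proof (cases "n = 1")
      case True
      then show ?thesis
        by (simp add: z_def quadratic_coeffs_0 quadratic_coeffs_1 zero_left zero_right)
    next
      case False
      have "(\<Sum>i\<le>n. B (t ^ i *\<^sub>R z i) (t ^ (n - i) *\<^sub>R z (n - i))) =
          t ^ n *\<^sub>R (\<Sum>i\<le>n. B (z i) (z (n - i)))"
        unfolding scaleR_sum_right
        by (rule sum.cong) (auto simp: scaleR_left scaleR_right power_add[symmetric])
      then show ?thesis
        using False quadratic_coeffs_convolution[OF assms False, of y] by (simp add: z_def)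
    qed
    ultimately show ?thesis by (simp add: sums_iff)
  qed
  moreover have "z 0 = 0" by (simp add: z_def quadratic_coeffs_0)
  ultimately show ?thesis using r that by blast
qed

lemma bounded_linear_bilinear_compose:
  assumes "bounded_linear f" and "bounded_bilinear g"
  shows "bounded_bilinear (\<lambda>x y. f (g x y))"
proof -
  interpret f: bounded_linear f by fact
  interpret g: bounded_bilinear g by fact
  show ?thesis
  proof
    obtain K L where K: "\<And>a. norm (f a) \<le> norm a * K" "K > 0"
      and L: "\<And>a b. norm (g a b) \<le> norm a * norm b * L"
      using f.pos_bounded g.bounded by blast
    have "norm (f (g a b)) \<le> norm a * norm b * (L * K)" for a b
      using order_trans[OF K(1) mult_right_mono[OF L]] K(2) by (simp add: mult.assoc)
    then show "\<exists>K. \<forall>a b. norm (f (g a b)) \<le> norm a * norm b * K" by blast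
  qed (simp_all add: g.add_left g.add_right g.scaleR_left g.scaleR_right f.add f.scaleR)
qed

lemma bounded_bilinear_Pair:
  assumes "bounded_bilinear f" and "bounded_bilinear g"
  shows "bounded_bilinear (\<lambda>x y. (f x y, g x y))"
proof -
  interpret f: bounded_bilinear f by fact
  interpret g: bounded_bilinear g by fact
  show ?thesis
  proof
    obtain K L where K: "\<And>a b. norm (f a b) \<le> norm a * norm b * K"
      and L: "\<And>a b. norm (g a b) \<le> norm a * norm b * L"
      using f.bounded g.bounded by blast
    have "norm (f a b, g a b) \<le> norm a * norm b * (K + L)" for a b
      by (rule order_trans[OF norm_Pair_le]) (use K[of a b] L[of a b] in \<open>simp add: distrib_left\<close>)
    then show "\<exists>K. \<forall>a b. norm (f a b, g a b) \<le> norm a * norm b * K" by blast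
  qed (simp_all add: f.add_left f.add_right g.add_left g.add_right
        f.scaleR_left f.scaleR_right g.scaleR_left g.scaleR_right)
qed

lemma bounded_bilinear_add:
  assumes "bounded_bilinear f" and "bounded_bilinear g"
  shows "bounded_bilinear (\<lambda>x y. f x y + g x y)"
  using bounded_linear_bilinear_compose[OF _ bounded_bilinear_Pair[OF assms],
      of "\<lambda>p. fst p + snd p"]
  by (simp add: bounded_linear_add bounded_linear_fst bounded_linear_snd)

text \<open>Nilpotency makes the Neumann series of I - N finite, and \<open>M\<close> is its sum, so
  (I - N) M = I. A fixed point Z = M (t y + B(Z, Z)) of the purely quadratic equation therefore
  satisfies Z - N Z = t y + B(Z, Z).\<close>

lemma quadratic_equation_power_series:
  fixes y :: "'a::banach"
  assumes N: "bounded_linear N" and nil: "\<And>z. N (N (N (N z))) = 0" and B: "bounded_bilinear B"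
  shows "\<exists>r>0. \<exists>z. summable (\<lambda>n. norm (z n) * r ^ n) \<and> z 0 = 0 \<and>
    (\<forall>t. \<bar>t\<bar> \<le> r \<longrightarrow> (let Z = \<Sum>n. t ^ n *\<^sub>R z n in Z = t *\<^sub>R y + N Z + B Z Z))"
proof -
  interpret N: bounded_linear N by fact
  define M where "M z = z + N z + N (N z) + N (N (N z))" for z
  have M: "bounded_linear M"
    unfolding M_def by (intro bounded_linear_add bounded_linear_compose[OF N] N bounded_linear_ident)
  then interpret M: bounded_linear M .
  have MN: "M z - N (M z) = z" for z
    by (simp add: M_def N.add nil)
  have "bounded_bilinear (\<lambda>x y. M (B x y))"
    by (rule bounded_linear_bilinear_compose[OF M B])
  then show ?thesis
  proof (rule quadratic_fixed_point_power_series[where y = "M y"])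
    fix z r
    assume z: "r > 0" "summable (\<lambda>n. norm (z n) * r ^ n)" "z 0 = 0"
      and eq: "\<And>t. \<bar>t\<bar> \<le> r \<Longrightarrow>
        (\<Sum>n. t ^ n *\<^sub>R z n) = t *\<^sub>R M y + M (B (\<Sum>n. t ^ n *\<^sub>R z n) (\<Sum>n. t ^ n *\<^sub>R z n))"
    show ?thesis
    proof (intro exI[of _ r] exI[of _ z] conjI allI impI z)
      fix t :: real assume t: "\<bar>t\<bar> \<le> r"
      define Z where "Z = (\<Sum>n. t ^ n *\<^sub>R z n)"
      have "Z = M (t *\<^sub>R y + B Z Z)"
        using eq[OF t] by (simp only: Z_def[symmetric] M.add M.scaleR)
      then have "Z - N Z = t *\<^sub>R y + B Z Z"
        using MN[of "t *\<^sub>R y + B Z Z"] by simp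
      then show "let Z = \<Sum>n. t ^ n *\<^sub>R z n in Z = t *\<^sub>R y + N Z + B Z Z"
        unfolding Z_def[symmetric] Let_def by (simp add: algebra_simps)
    qed
  qed
qed

section \<open>Recentring of power series\<close>

text \<open>Expand t^n = ((t - s) + s)^n and interchange the sums. The norms in row n add up to (|t
  - s| + |s|)^n times the norm of x n, which is summable since |t - s| + |s| < r; the columns give
  the new coefficients.\<close>

lemma power_series_recentre:
  fixes x :: "nat \<Rightarrow> 'a::banach"
  assumes sum: "summable (\<lambda>n. norm (x n) * r ^ n)" and s: "\<bar>s\<bar> < r"
  shows "\<exists>a. \<forall>t. \<bar>t - s\<bar> < r - \<bar>s\<bar> \<longrightarrow> (\<lambda>n. (t - s) ^ n *\<^sub>R a n) sums (\<Sum>n. t ^ n *\<^sub>R x n)"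
proof -
  define a where "a k = (\<Sum>\<^sub>\<infinity>n\<in>{k..}. (of_nat (n choose k) * s ^ (n - k)) *\<^sub>R x n)" for k
  have "(\<lambda>n. (t - s) ^ n *\<^sub>R a n) sums (\<Sum>n. t ^ n *\<^sub>R x n)" if t: "\<bar>t - s\<bar> < r - \<bar>s\<bar>" for t
  proof -
    define d where "d = t - s"
    define g where "g = (\<lambda>(n, k). (of_nat (n choose k) * d ^ k * s ^ (n - k)) *\<^sub>R x n)"
    have dsr: "\<bar>d\<bar> + \<bar>s\<bar> \<le> r" using t by (simp add: d_def)
    have binom: "(\<Sum>k\<le>n. of_nat (n choose k) * u ^ k * v ^ (n - k)) = (u + v) ^ n" for u v :: real and n
      by (simp add: binomial_ring)
    have outer: "(\<lambda>n. (\<bar>d\<bar> + \<bar>s\<bar>) ^ n * norm (x n)) summable_on UNIV"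
    proof (rule norm_summable_imp_summable_on)
      show "summable (\<lambda>n. norm ((\<bar>d\<bar> + \<bar>s\<bar>) ^ n * norm (x n)))"
        by (rule summable_comparison_test'[OF sum, of 0])
           (use dsr in \<open>auto simp: abs_mult mult.commute[of _ "norm _"] intro!: mult_left_mono power_mono\<close>)
    qed
    have norm_g: "(\<Sum>\<^sub>\<infinity>k\<in>{..n}. norm (g (n, k))) = (\<bar>d\<bar> + \<bar>s\<bar>) ^ n * norm (x n)" for n
      by (simp add: g_def abs_mult power_abs sum_distrib_right[symmetric] binom)
    have "(\<lambda>p. norm (g p)) summable_on Sigma UNIV (\<lambda>n. {..n})"
    proof (rule summable_on_SigmaI[where g = "\<lambda>n. \<Sum>k\<le>n. norm (g (n, k))"])
      show "((\<lambda>k. norm (g (n, k))) has_sum (\<Sum>k\<le>n. norm (g (n, k)))) {..n}" for n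
        by (rule has_sum_finite) simp
      show "(\<lambda>n. \<Sum>k\<le>n. norm (g (n, k))) summable_on UNIV"
        using outer norm_g by simp
    qed auto
    then have gabs: "g abs_summable_on Sigma UNIV (\<lambda>n. {..n})" .
    then have gsum: "g summable_on Sigma UNIV (\<lambda>n. {..n})" by (rule abs_summable_summable)
    have row: "(\<Sum>\<^sub>\<infinity>k\<in>{..n}. g (n, k)) = t ^ n *\<^sub>R x n" for n
      by (simp add: g_def scaleR_sum_left[symmetric] binom) (simp add: d_def)
    have total: "infsum g (Sigma UNIV (\<lambda>n. {..n})) = (\<Sum>n. t ^ n *\<^sub>R x n)"
    proof -
      have "infsum g (Sigma UNIV (\<lambda>n. {..n})) = (\<Sum>\<^sub>\<infinity>n. t ^ n *\<^sub>R x n)"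
        using infsum_Sigma'_banach[of "\<lambda>n k. g (n, k)" UNIV "\<lambda>n. {..n}"] gsum row
        by (simp add: case_prod_unfold)
      also have "\<dots> = (\<Sum>n. t ^ n *\<^sub>R x n)"
      proof (rule infsumI, rule norm_summable_imp_has_sum)
        show "summable (\<lambda>n. norm (t ^ n *\<^sub>R x n))"
          using t by (intro summable_norm_scaleR_power[OF sum]) linarith
        then show "(\<lambda>n. t ^ n *\<^sub>R x n) sums (\<Sum>n. t ^ n *\<^sub>R x n)"
          by (rule summable_sums[OF summable_norm_cancel])
      qed
      finally show ?thesis .
    qed
    have bij: "bij_betw prod.swap (Sigma UNIV (\<lambda>k. {k..})) (Sigma UNIV (\<lambda>n. {..n}))"
      by (rule bij_betwI[where g = prod.swap]) auto
    have gsum': "(\<lambda>p. g (prod.swap p)) summable_on Sigma UNIV (\<lambda>k. {k..})"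
      using summable_on_reindex_bij_betw[OF bij, of g] gsum by simp
    have total': "infsum (\<lambda>p. g (prod.swap p)) (Sigma UNIV (\<lambda>k. {k..})) = (\<Sum>n. t ^ n *\<^sub>R x n)"
      using infsum_reindex_bij_betw[OF bij, of g] total by simp
    have col: "(\<Sum>\<^sub>\<infinity>n\<in>{k..}. g (n, k)) = d ^ k *\<^sub>R a k" for k
      unfolding a_def g_def infsum_scaleR_right[symmetric] by (simp add: mult_ac)
    have "((\<lambda>k. d ^ k *\<^sub>R a k) has_sum (\<Sum>n. t ^ n *\<^sub>R x n)) UNIV"
    proof -
      have "(\<lambda>k. \<Sum>\<^sub>\<infinity>n\<in>{k..}. g (n, k)) summable_on UNIV"
        using summable_on_Sigma_banach[of "\<lambda>k n. g (n, k)" UNIV "\<lambda>k. {k..}"] gsum'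
        by (simp add: case_prod_unfold prod.swap_def)
      moreover have "(\<Sum>\<^sub>\<infinity>k. \<Sum>\<^sub>\<infinity>n\<in>{k..}. g (n, k)) = (\<Sum>n. t ^ n *\<^sub>R x n)"
        using infsum_Sigma'_banach[of "\<lambda>k n. g (n, k)" UNIV "\<lambda>k. {k..}"] gsum' total'
        by (simp add: case_prod_unfold prod.swap_def)
      ultimately show ?thesis unfolding col by (simp add: has_sum_iff)
    qed
    then show ?thesis unfolding d_def by (rule has_sum_imp_sums)
  qed
  then show ?thesis by blast
qed

section \<open>Weak derivatives of smooth functions\<close>

definition smooth :: "(real \<Rightarrow> real) \<Rightarrow> bool" where
  "smooth f \<longleftrightarrow> (\<forall>k. ((deriv ^^ k) f) differentiable_on UNIV)"

lemma smooth_has_derivative: "smooth f \<Longrightarrow> (f has_real_derivative deriv f x) (at x)"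
  unfolding smooth_def
  by (drule spec[of _ 0])
     (auto simp: differentiable_on_def differentiable_def DERIV_deriv_iff_real_differentiable)

lemma smooth_deriv: "smooth f \<Longrightarrow> smooth (deriv f)"
  unfolding smooth_def
proof
  fix k assume "\<forall>k. ((deriv ^^ k) f) differentiable_on UNIV"
  then have "((deriv ^^ Suc k) f) differentiable_on UNIV" by blast
  then show "((deriv ^^ k) (deriv f)) differentiable_on UNIV" by (simp only: funpow_Suc_right o_apply)
qed

text \<open>An invariant class replaces formulas for higher derivatives: if differentiation, in the
  form of \<open>f'\<close>, maps \<open>S\<close> into itself, every iterated derivative is again a
  differentiable member of \<open>S\<close>.\<close>

lemma smooth_coinduct:
  assumes "f \<in> S" and "\<And>f x. f \<in> S \<Longrightarrow> (f has_real_derivative f' f x) (at x)"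
    and "\<And>f. f \<in> S \<Longrightarrow> f' f \<in> S"
  shows "smooth f"
proof -
  have "deriv f = f' f" if "f \<in> S" for f
    using assms(2)[OF that] by (intro ext DERIV_imp_deriv)
  then have "(deriv ^^ k) f \<in> S" for k
    by (induction k) (auto simp: assms)
  then show ?thesis
    unfolding smooth_def differentiable_on_def
    using assms(2) real_differentiable_def by (metis differentiable_at_withinI)
qed

text \<open>The invariant class for \<open>smooth_mult\<close>: the product rule leaves the pure
  products, so sums have to be included.\<close>

inductive_set smooth_products :: "(real \<Rightarrow> real) set" where
  prod: "smooth f \<Longrightarrow> smooth g \<Longrightarrow> (\<lambda>x. f x * g x) \<in> smooth_products"
| add: "f \<in> smooth_products \<Longrightarrow> g \<in> smooth_products \<Longrightarrow> (\<lambda>x. f x + g x) \<in> smooth_products"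

lemma smooth_mult:
  assumes "smooth f" and "smooth g"
  shows "smooth (\<lambda>x. f x * g x)"
proof (rule smooth_coinduct[where f' = deriv])
  show "(\<lambda>x. f x * g x) \<in> smooth_products"
    using assms by (rule smooth_products.prod)
  have *: "(\<forall>x. (h has_real_derivative deriv h x) (at x)) \<and> deriv h \<in> smooth_products"
    if "h \<in> smooth_products" for h
    using that
  proof induction
    case (prod f g)
    have d: "((\<lambda>x. f x * g x) has_real_derivative (deriv f x * g x + f x * deriv g x)) (at x)" for x
      using DERIV_mult[OF smooth_has_derivative[OF prod(1)] smooth_has_derivative[OF prod(2)], of x]
      by (simp add: mult.commute add.commute)
    have "deriv (\<lambda>x. f x * g x) = (\<lambda>x. deriv f x * g x + f x * deriv g x)"
      using d by (intro ext DERIV_imp_deriv)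
    moreover have "(\<lambda>x. deriv f x * g x + f x * deriv g x) \<in> smooth_products"
      using prod by (intro smooth_products.intros smooth_deriv)
    ultimately show ?case using d by simp
  next
    case (add f g)
    then have d: "((\<lambda>x. f x + g x) has_real_derivative (deriv f x + deriv g x)) (at x)" for x
      by (intro DERIV_add) auto
    have "deriv (\<lambda>x. f x + g x) = (\<lambda>x. deriv f x + deriv g x)"
      using d by (intro ext DERIV_imp_deriv)
    with add d show ?case by (auto intro: smooth_products.add)
  qed
  show "(f has_real_derivative deriv f x) (at x)" if "f \<in> smooth_products" for f x
    using *[OF that] by blast
  show "deriv f \<in> smooth_products" if "f \<in> smooth_products" for f
    using *[OF that] by blast
qed

lemma smooth_affine:
  assumes "smooth f"
  shows "smooth (\<lambda>x. f (m * x + c))"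
proof (rule smooth_coinduct)
  show "(\<lambda>x. f (m * x + c)) \<in> {(\<lambda>x. k * g (m * x + c)) | k g. smooth g}"
    using assms by (auto intro!: exI[of _ 1])
  have d: "((\<lambda>x. k * g (m * x + c)) has_real_derivative (k * m * deriv g (m * x + c))) (at x)"
    if "smooth g" for k g x
    by (rule derivative_eq_intros DERIV_chain'[OF _ smooth_has_derivative[OF that]] refl)+ simp
  show "(h has_real_derivative deriv h x) (at x)" "deriv h \<in> {(\<lambda>x. k * g (m * x + c)) | k g. smooth g}"
    if h: "h \<in> {(\<lambda>x. k * g (m * x + c)) | k g. smooth g}" for h x
  proof -
    obtain k g where kg: "h = (\<lambda>x. k * g (m * x + c))" "smooth g" using h by auto
    have "deriv h = (\<lambda>x. k * m * deriv g (m * x + c))"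
      unfolding kg by (intro ext DERIV_imp_deriv d[OF kg(2)])
    then show "(h has_real_derivative deriv h x) (at x)"
        "deriv h \<in> {(\<lambda>x. k * g (m * x + c)) | k g. smooth g}"
      using d[OF kg(2)] smooth_deriv[OF kg(2)] by (auto simp: kg(1))
  qed
qed

section \<open>Compactly supported bump functions\<close>

text \<open>The polynomial factor closes the family under differentiation: p(1/t) exp(-1/t) has a
  derivative of the same form with polynomial X^2 (p - p').\<close>

definition flat_exp :: "real poly \<Rightarrow> real \<Rightarrow> real" where
  "flat_exp p t = (if t > 0 then poly p (1 / t) * exp (- (1 / t)) else 0)"

lemma poly_over_exp_tendsto_0: "((\<lambda>s. s ^ n * poly p s * exp (- s)) \<longlongrightarrow> (0::real)) at_top"
proof (induction p arbitrary: n)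
  case (pCons c p)
  have "((\<lambda>s. c * (s ^ n / exp s) + s ^ Suc n * poly p s * exp (- s)) \<longlongrightarrow> c * 0 + 0) at_top"
    by (intro tendsto_intros tendsto_power_div_exp_0 pCons.IH)
  then show ?case by (simp add: algebra_simps exp_minus divide_inverse)
qed simp

lemma flat_exp_has_derivative:
  "(flat_exp p has_real_derivative flat_exp (monom 1 2 * (p - pderiv p)) t) (at t)"
proof -
  consider "t > 0" | "t < 0" | "t = 0" by linarith
  then show ?thesis
  proof cases
    case 1
    have "((\<lambda>t. poly p (1 / t) * exp (- (1 / t))) has_real_derivative
        flat_exp (monom 1 2 * (p - pderiv p)) t) (at t)"
      using 1
      by (auto intro!: derivative_eq_intros DERIV_chain'[OF _ poly_DERIV]
          simp: flat_exp_def poly_monom algebra_simps power2_eq_square)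
    moreover have "\<forall>\<^sub>F s in nhds t. s > 0"
      using 1 by (rule order_tendstoD[OF filterlim_ident])
    then have "\<forall>\<^sub>F s in nhds t. flat_exp p s = poly p (1 / s) * exp (- (1 / s))"
      by eventually_elim (simp add: flat_exp_def)
    ultimately show ?thesis by (subst DERIV_cong_ev[OF refl _ refl])
  next
    case 2
    have "\<forall>\<^sub>F s in nhds t. s < 0"
      using 2 by (rule order_tendstoD[OF filterlim_ident])
    then have "\<forall>\<^sub>F s in nhds t. flat_exp p s = 0"
      by eventually_elim (simp add: flat_exp_def)
    then show ?thesis
      by (subst DERIV_cong_ev[OF refl _ refl]) (use 2 in \<open>auto simp: flat_exp_def\<close>)
  next
    case 3
    \<comment> \<open>The delicate quotient at 0 is the one from the right; with s = 1/h it becomes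
      s p(s) exp(-s).\<close>
    have "((\<lambda>h. flat_exp p h / h) \<longlongrightarrow> 0) (at_right 0)"
    proof -
      have "\<forall>\<^sub>F s in at_top. s ^ 1 * poly p s * exp (- s) = flat_exp p (inverse s) / inverse s"
        using eventually_gt_at_top[of 0] by eventually_elim (simp add: flat_exp_def field_simps)
      from Lim_transform_eventually[OF poly_over_exp_tendsto_0 this] show ?thesis
        by (subst filterlim_at_right_to_top)
    qed
    moreover have "((\<lambda>h. flat_exp p h / h) \<longlongrightarrow> 0) (at_left 0)"
    proof (rule Lim_transform_eventually[OF tendsto_const])
      show "\<forall>\<^sub>F h in at_left 0. 0 = flat_exp p h / h"
        using eventually_at_left_real[of "-1" "0::real"] by (auto elim: eventually_mono simp: flat_exp_def)
    qed
    ultimately have "((\<lambda>h. flat_exp p h / h) \<longlongrightarrow> 0) (at 0)"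
      by (rule filterlim_split_at[rotated])
    then show ?thesis
      using 3 by (simp add: DERIV_def flat_exp_def)
  qed
qed

lemma smooth_flat_exp: "smooth (flat_exp p)"
proof (rule smooth_coinduct[where S = "range flat_exp" and f' = deriv])
  have "deriv (flat_exp p) = flat_exp (monom 1 2 * (p - pderiv p))" for p
    by (intro ext DERIV_imp_deriv flat_exp_has_derivative)
  then show "(f has_real_derivative deriv f x) (at x)" "deriv f \<in> range flat_exp"
    if "f \<in> range flat_exp" for f x
    using that flat_exp_has_derivative by auto
qed simp

text \<open>Scaling both arguments by the same growing factor sends the two exponentials to 1 at
  each point of the open interval, so these test functions stay between 0 and 1 and converge
  pointwise to its indicator.\<close>

definition bump :: "real \<Rightarrow> real \<Rightarrow> nat \<Rightarrow> real \<Rightarrow> real" where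
  "bump a b n x = flat_exp 1 (real (Suc n) * (x - a)) * flat_exp 1 (real (Suc n) * (b - x))"

lemma bump_eq_0: "x \<notin> {a<..<b} \<Longrightarrow> bump a b n x = 0"
  by (auto simp: bump_def flat_exp_def zero_less_mult_iff)

lemma test_function_bump: "test_function (bump a b n)"
proof -
  let ?m = "real (Suc n)"
  have "smooth (\<lambda>x. flat_exp 1 (?m * x + (- ?m * a)) * flat_exp 1 ((- ?m) * x + ?m * b))"
    by (intro smooth_mult smooth_affine smooth_flat_exp)
  also have "(\<lambda>x. flat_exp 1 (?m * x + (- ?m * a)) * flat_exp 1 ((- ?m) * x + ?m * b)) = bump a b n"
    unfolding bump_def by (intro ext arg_cong2[where f = "(*)"] arg_cong[where f = "flat_exp 1"])
      (simp_all add: algebra_simps)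
  finally have "smooth (bump a b n)" .
  moreover have "bounded {x. bump a b n x \<noteq> 0}"
  proof (rule bounded_subset[of "{a..b}"])
    show "{x. bump a b n x \<noteq> 0} \<subseteq> {a..b}"
    proof
      fix x assume "x \<in> {x. bump a b n x \<noteq> 0}"
      then have "x \<in> {a<..<b}" using bump_eq_0[of x a b n] by auto
      then show "x \<in> {a..b}" by auto
    qed
  qed simp
  ultimately show ?thesis by (simp add: test_function_def smooth_def)
qed

lemma bump_bounds: "0 \<le> bump a b n x" "bump a b n x \<le> 1"
  by (auto simp: bump_def flat_exp_def intro!: mult_le_one)

lemma bump_tendsto_indicator: "(\<lambda>n. bump a b n x) \<longlonglongrightarrow> indicat_real {a<..<b} x"
proof (cases "x \<in> {a<..<b}")
  case True
  have *: "(\<lambda>n. exp (- (1 / (real (Suc n) * c)))) \<longlonglongrightarrow> 1" if "c > 0" for c :: real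
  proof -
    have "(\<lambda>n. exp (- (inverse (real (Suc n)) * (1 / c)))) \<longlonglongrightarrow> exp (- (0 * (1 / c)))"
      by (intro tendsto_intros LIMSEQ_inverse_real_of_nat)
    then show ?thesis by (simp add: divide_simps)
  qed
  have "(\<lambda>n. exp (- (1 / (real (Suc n) * (x - a)))) * exp (- (1 / (real (Suc n) * (b - x))))) \<longlonglongrightarrow> 1 * 1"
    using True by (intro tendsto_mult *) auto
  moreover have "bump a b n x = exp (- (1 / (real (Suc n) * (x - a)))) * exp (- (1 / (real (Suc n) * (b - x))))" for n
    using True by (simp add: bump_def flat_exp_def zero_less_mult_iff)
  ultimately show ?thesis using True by simp
qed (simp add: bump_eq_0)

section \<open>Uniqueness of weak derivatives\<close>

lemma locally_integrable_measurable:
  assumes "locally_integrable w"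
  shows "w \<in> borel_measurable borel"
proof (rule borel_measurable_LIMSEQ_metric)
  show "(\<lambda>x. indicator {- real n..real n} x *\<^sub>R w x) \<in> borel_measurable borel" for n
    using assms borel_measurable_integrable
    unfolding locally_integrable_def set_integrable_def by force
  show "(\<lambda>n. indicator {- real n..real n} x *\<^sub>R w x) \<longlonglongrightarrow> w x" for x
  proof (rule Lim_transform_eventually[OF tendsto_const])
    show "\<forall>\<^sub>F n in sequentially. w x = indicator {- real n..real n} x *\<^sub>R w x"
      using eventually_ge_at_top[of "nat \<lceil>\<bar>x\<bar>\<rceil>"]
    proof eventually_elim
      case (elim n)
      then have "\<bar>x\<bar> \<le> real n" by linarith
      then show ?case by (auto simp: indicator_def)
    qed
  qed
qed

text \<open>A Dynkin system argument leads from open intervals to all Borel sets. The assumption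
  \<open>total\<close> serves the complement step, where the integral over the whole line
  appears.\<close>

lemma integrals_over_intervals_zero_imp_AE_zero:
  fixes f :: "real \<Rightarrow> complex"
  assumes f: "integrable lborel f" and 0: "\<And>a b. (LINT x:{a<..<b}|lborel. f x) = 0"
    and total: "(LINT x|lborel. f x) = 0"
  shows "AE x in lborel. f x = 0"
proof (rule sigma_finite_measure.density_unique_banach[OF lborel.sigma_finite_measure_axioms f])
  have gen: "borel = sigma UNIV (range (\<lambda>(a, b). {a<..<b::real}))"
    by (simp add: borel_eq_box flip: box_real(1))
  have si: "set_integrable lborel A f" if "A \<in> sets borel" for A
    using f that unfolding set_integrable_def by (intro integrable_mult_indicator) auto
  fix A :: "real set" assume "A \<in> sets lborel"
  then have A: "A \<in> sigma_sets UNIV (range (\<lambda>(a, b). {a<..<b::real}))"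
    by (simp add: gen)
  have "Int_stable (range (\<lambda>(a, b). {a<..<b::real}))"
    by (auto simp: Int_stable_def Int_greaterThanLessThan)
  moreover have "range (\<lambda>(a, b). {a<..<b::real}) \<subseteq> Pow UNIV" by simp
  ultimately have "set_lebesgue_integral lborel A f = 0"
    using A
  proof (induction rule: sigma_sets_induct_disjoint)
    case (compl A)
    then have "A \<in> sets borel" by (simp add: gen)
    then have "(LINT x:A \<union> (UNIV - A)|lborel. f x) =
        (LINT x:A|lborel. f x) + (LINT x:UNIV - A|lborel. f x)"
      by (intro set_integral_Un si) auto
    then show ?case using compl total by (simp add: set_lebesgue_integral_def)
  next
    case (union A)
    have "A i \<in> sets borel" for i
      using union(2) by (auto simp: gen)
    then show ?case
      using union by (subst lebesgue_integral_countable_add) (auto simp: disjoint_family_on_def intro!: si)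
  qed (auto simp: 0, simp add: set_lebesgue_integral_def)
  then show "set_lebesgue_integral lborel A f = set_lebesgue_integral lborel A (\<lambda>_. 0)" by simp
qed simp

text \<open>Bump functions and dominated convergence transfer the hypothesis to integrals over open
  intervals. As \<open>w\<close> is only locally integrable, the conclusion is drawn for its
  truncations to (-n, n).\<close>

lemma weakly_zero_imp_AE_zero:
  assumes w: "locally_integrable w"
    and test: "\<And>\<eta>. test_function \<eta> \<Longrightarrow> (LINT x|lborel. \<eta> x *\<^sub>R w x) = 0"
  shows "AE x in lborel. w x = 0"
proof -
  note [measurable] = locally_integrable_measurable[OF w]
  have int: "(LINT x:{a<..<b}|lborel. w x) = 0" for a b
  proof -
    have "(\<lambda>n. LINT x|lborel. bump a b n x *\<^sub>R w x) \<longlonglongrightarrow> (LINT x|lborel. indicator {a<..<b} x *\<^sub>R w x)"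
    proof (rule integral_dominated_convergence)
      show "integrable lborel (\<lambda>x. norm (indicator {a..b} x *\<^sub>R w x))"
        using w unfolding locally_integrable_def set_integrable_def by (intro integrable_norm) auto
      show "AE x in lborel. (\<lambda>n. bump a b n x *\<^sub>R w x) \<longlonglongrightarrow> indicator {a<..<b} x *\<^sub>R w x"
        by (intro AE_I2 tendsto_intros bump_tendsto_indicator)
      have "norm (bump a b n x *\<^sub>R w x) \<le> norm (indicator {a..b} x *\<^sub>R w x)" for n x
        using bump_bounds[of a b n x] bump_eq_0[of x a b n]
        by (cases "x \<in> {a<..<b}") (auto simp: indicator_def intro!: mult_left_le_one_le)
      then show "AE x in lborel. norm (bump a b n x *\<^sub>R w x) \<le> norm (indicator {a..b} x *\<^sub>R w x)" for n
        by simp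
      have "continuous_on UNIV (bump a b n)" for n
        using test_function_bump[of a b n] unfolding test_function_def
        by (metis differentiable_imp_continuous_on funpow_0)
      then have [measurable]: "bump a b n \<in> borel_measurable borel" for n
        by (rule borel_measurable_continuous_onI)
      show "(\<lambda>x. bump a b n x *\<^sub>R w x) \<in> borel_measurable lborel" for n by measurable
    qed measurable
    moreover have "(LINT x|lborel. bump a b n x *\<^sub>R w x) = 0" for n
      by (intro test test_function_bump)
    ultimately show ?thesis by (simp add: set_lebesgue_integral_def LIMSEQ_const_iff)
  qed
  have "AE x in lborel. indicator {- real n<..<real n} x *\<^sub>R w x = 0" for n
  proof (rule integrals_over_intervals_zero_imp_AE_zero)
    have "set_integrable lborel {- real n<..<real n} w"
      by (rule set_integrable_subset[of _ "{- real n..real n}"])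
         (use w in \<open>auto simp: locally_integrable_def\<close>)
    then show "integrable lborel (\<lambda>x. indicator {- real n<..<real n} x *\<^sub>R w x)"
      by (simp add: set_integrable_def)
    show "(LINT x|lborel. indicator {- real n<..<real n} x *\<^sub>R w x) = 0"
      using int by (simp add: set_lebesgue_integral_def)
    show "(LINT x:{a<..<b}|lborel. indicator {- real n<..<real n} x *\<^sub>R w x) = 0" for a b
    proof -
      have "(\<lambda>x. indicat_real {a<..<b} x *\<^sub>R indicat_real {- real n<..<real n} x *\<^sub>R w x) =
          (\<lambda>x. indicat_real {max a (- real n)<..<min b (real n)} x *\<^sub>R w x)"
        by (auto simp: indicator_def)
      then show ?thesis
        using int[of "max a (- real n)" "min b (real n)"] unfolding set_lebesgue_integral_def by metis
    qed
  qed
  then have "AE x in lborel. \<forall>n. indicator {- real n<..<real n} x *\<^sub>R w x = 0"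
    by (subst AE_all_countable) blast
  then show ?thesis
  proof eventually_elim
    case (elim x)
    obtain n where "\<bar>x\<bar> < real n" using reals_Archimedean2 by blast
    then show ?case using spec[OF elim, of n] by (auto simp: indicator_def)
  qed
qed

lemma test_function_integrable:
  assumes w: "locally_integrable w" and "test_function \<eta>"
  shows "integrable lborel (\<lambda>x. \<eta> x *\<^sub>R w x)"
proof -
  note [measurable] = locally_integrable_measurable[OF w]
  have cont: "continuous_on UNIV \<eta>"
    using assms(2) unfolding test_function_def
    by (metis differentiable_imp_continuous_on funpow_0)
  then have [measurable]: "\<eta> \<in> borel_measurable borel"
    by (rule borel_measurable_continuous_onI)
  have "bounded {x. \<eta> x \<noteq> 0}"
    using assms(2) bounded_subset[OF compact_imp_bounded closure_subset] by (auto simp: test_function_def)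
  then obtain R where R: "\<And>x. \<eta> x \<noteq> 0 \<Longrightarrow> \<bar>x\<bar> \<le> R"
    by (auto simp: bounded_iff)
  have "compact (\<eta> ` {-R..R})"
    by (rule compact_continuous_image[OF continuous_on_subset[OF cont]]) auto
  then obtain M where "\<forall>y\<in>\<eta> ` {-R..R}. \<bar>y\<bar> \<le> M"
    by (auto dest!: compact_imp_bounded simp: bounded_iff)
  then have M: "\<bar>\<eta> x\<bar> \<le> M" if "x \<in> {-R..R}" for x
    using that by blast
  show ?thesis
  proof (rule Bochner_Integration.integrable_bound)
    show "integrable lborel (\<lambda>x. M *\<^sub>R indicator {-R..R} x *\<^sub>R w x)"
      using w unfolding locally_integrable_def set_integrable_def by (intro integrable_scaleR_right) auto
    have "norm (\<eta> x *\<^sub>R w x) \<le> norm (M *\<^sub>R indicator {-R..R} x *\<^sub>R w x)" for x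
    proof (cases "\<eta> x = 0")
      case False
      then have "x \<in> {-R..R}" using R[of x] by auto
      with M[of x] show ?thesis by (auto intro!: mult_right_mono)
    qed simp
    then show "AE x in lborel. norm (\<eta> x *\<^sub>R w x) \<le> norm (M *\<^sub>R indicator {-R..R} x *\<^sub>R w x)"
      by simp
  qed measurable
qed

lemma has_weak_deriv_unique:
  assumes "has_weak_deriv k v w" and "has_weak_deriv k v w'"
  shows "AE x in lborel. w x = w' x"
proof -
  have loc: "locally_integrable w" "locally_integrable w'"
    using assms by (auto simp: has_weak_deriv_def)
  have "AE x in lborel. w x - w' x = 0"
  proof (rule weakly_zero_imp_AE_zero)
    show "locally_integrable (\<lambda>x. w x - w' x)"
      using loc by (auto simp: locally_integrable_def)
    fix \<eta> assume \<eta>: "test_function \<eta>"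
    have "(-1) ^ k * (LINT x|lborel. \<eta> x *\<^sub>R w x) = (-1) ^ k * (LINT x|lborel. \<eta> x *\<^sub>R w' x)"
      using assms \<eta> unfolding has_weak_deriv_def by metis
    then show "(LINT x|lborel. \<eta> x *\<^sub>R (w x - w' x)) = 0"
      using test_function_integrable[OF loc(1) \<eta>] test_function_integrable[OF loc(2) \<eta>]
      by (simp add: scaleR_diff_right)
  qed
  then show ?thesis by simp
qed

section \<open>Classical derivatives as weak derivatives\<close>

lemma test_function_deriv:
  assumes "test_function \<eta>"
  shows "test_function (deriv \<eta>)"
proof -
  have sm: "smooth \<eta>" using assms by (simp add: test_function_def smooth_def)
  have "{x. deriv \<eta> x \<noteq> 0} \<subseteq> closure {x. \<eta> x \<noteq> 0}"
  proof
    fix x assume x: "x \<in> {x. deriv \<eta> x \<noteq> 0}"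
    show "x \<in> closure {x. \<eta> x \<noteq> 0}"
    proof (rule ccontr)
      assume "x \<notin> closure {x. \<eta> x \<noteq> 0}"
      then have "\<forall>\<^sub>F y in nhds x. y \<in> - closure {x. \<eta> x \<noteq> 0}"
        by (intro eventually_nhds_in_open) auto
      then have "\<forall>\<^sub>F y in nhds x. \<eta> y = 0"
        by eventually_elim (use closure_subset[of "{x. \<eta> x \<noteq> 0}"] in auto)
      then have "(\<eta> has_real_derivative 0) (at x)"
        by (subst DERIV_cong_ev[OF refl _ refl]) auto
      then show False using x DERIV_imp_deriv by auto
    qed
  qed
  then have "closure {x. deriv \<eta> x \<noteq> 0} \<subseteq> closure {x. \<eta> x \<noteq> 0}"
    by (intro closure_minimal) auto
  then have "compact (closure {x. deriv \<eta> x \<noteq> 0})"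
    using assms compact_closure bounded_subset compact_imp_bounded unfolding test_function_def
    by (metis closure_closure)
  with smooth_deriv[OF sm] show ?thesis by (simp add: test_function_def smooth_def)
qed

lemma continuous_imp_locally_integrable:
  "continuous_on UNIV v \<Longrightarrow> locally_integrable v"
  unfolding locally_integrable_def
  by (auto intro!: borel_integrable_atLeastAtMost' intro: continuous_on_subset)

lemma integration_by_parts_test_function:
  fixes v v' :: "real \<Rightarrow> complex"
  assumes \<eta>: "test_function \<eta>"
    and v: "\<And>x. (v has_vector_derivative v' x) (at x)" and v': "continuous_on UNIV v'"
  shows "(LINT x|lborel. deriv \<eta> x *\<^sub>R v x) = - (LINT x|lborel. \<eta> x *\<^sub>R v' x)"
proof -
  have sm: "smooth \<eta>" using \<eta> by (simp add: test_function_def smooth_def)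
  have cv: "continuous_on UNIV v"
    using v by (auto intro!: continuous_at_imp_continuous_on has_vector_derivative_continuous)
  have c\<eta>: "continuous_on UNIV \<eta>" "continuous_on UNIV (deriv \<eta>)"
    using smooth_has_derivative[OF sm] smooth_has_derivative[OF smooth_deriv[OF sm]]
    by (auto intro!: continuous_at_imp_continuous_on DERIV_isCont)
  define F where "F x = \<eta> x *\<^sub>R v x" for x
  define F' where "F' x = deriv \<eta> x *\<^sub>R v x + \<eta> x *\<^sub>R v' x" for x
  have F: "(F has_vector_derivative F' x) (at x)" for x
    unfolding F_def F'_def
    using has_vector_derivative_scaleR[OF smooth_has_derivative[OF sm] v, of x]
    by (simp add: add.commute)
  have "bounded (closure {x. \<eta> x \<noteq> 0} \<union> closure {x. deriv \<eta> x \<noteq> 0})"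
    using \<eta> test_function_deriv[OF \<eta>] by (auto simp: test_function_def intro: compact_imp_bounded)
  then obtain R where "\<And>x. x \<in> closure {x. \<eta> x \<noteq> 0} \<union> closure {x. deriv \<eta> x \<noteq> 0} \<Longrightarrow> \<bar>x\<bar> \<le> R"
    unfolding bounded_iff by auto
  then have R: "\<bar>x\<bar> \<le> R" if "\<eta> x \<noteq> 0 \<or> deriv \<eta> x \<noteq> 0" for x
    using that closure_subset[of "{x. \<eta> x \<noteq> 0}"] closure_subset[of "{x. deriv \<eta> x \<noteq> 0}"] by auto
  \<comment> \<open>The added 1 puts both end points strictly beyond the support, so that the
    boundary terms vanish.\<close>
  define S where "S = \<bar>R\<bar> + 1"
  have "F' x = indicator {-S..S} x *\<^sub>R F' x" for x
    using R[of x] by (cases "\<eta> x = 0 \<and> deriv \<eta> x = 0") (auto simp: F'_def indicator_def S_def)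
  then have "(LINT x|lborel. F' x) = (LINT x|lborel. indicator {-S..S} x *\<^sub>R F' x)"
    by metis
  also have "\<dots> = F S - F (- S)"
    by (rule integral_FTC_Icc)
       (auto simp: S_def F'_def[abs_def] intro!: has_vector_derivative_at_within[OF F[unfolded F'_def]] continuous_intros
         continuous_on_subset[OF cv] continuous_on_subset[OF v'] continuous_on_subset[OF c\<eta>(1)]
         continuous_on_subset[OF c\<eta>(2)])
  also have "\<dots> = 0"
  proof -
    have "\<eta> S = 0" "\<eta> (- S) = 0"
      using R[of S] R[of "- S"] by (fastforce simp: S_def)+
    then show ?thesis by (simp add: F_def)
  qed
  finally have "(LINT x|lborel. F' x) = 0" .
  moreover have "integrable lborel (\<lambda>x. deriv \<eta> x *\<^sub>R v x)"
    by (intro test_function_integrable continuous_imp_locally_integrable cv test_function_deriv \<eta>)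
  moreover have "integrable lborel (\<lambda>x. \<eta> x *\<^sub>R v' x)"
    by (intro test_function_integrable continuous_imp_locally_integrable v' \<eta>)
  ultimately show ?thesis by (simp add: F'_def add_eq_0_iff)
qed

lemma has_weak_deriv_classical:
  fixes v v\<^sub>1 v\<^sub>2 :: "real \<Rightarrow> complex"
  assumes v: "\<And>x. (v has_vector_derivative v\<^sub>1 x) (at x)"
    and v\<^sub>1: "\<And>x. (v\<^sub>1 has_vector_derivative v\<^sub>2 x) (at x)" and v\<^sub>2: "continuous_on UNIV v\<^sub>2"
  shows "has_weak_deriv 0 v v" "has_weak_deriv 1 v v\<^sub>1" "has_weak_deriv 2 v v\<^sub>2"
proof -
  have cv: "continuous_on UNIV v" "continuous_on UNIV v\<^sub>1"
    using v v\<^sub>1 by (auto intro!: continuous_at_imp_continuous_on has_vector_derivative_continuous)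
  note loc = continuous_imp_locally_integrable[OF cv(1)] continuous_imp_locally_integrable[OF cv(2)]
    continuous_imp_locally_integrable[OF v\<^sub>2]
  show "has_weak_deriv 0 v v" by (simp add: has_weak_deriv_def loc)
  show "has_weak_deriv 1 v v\<^sub>1"
    using integration_by_parts_test_function[OF _ v cv(2)] by (auto simp: has_weak_deriv_def loc)
  show "has_weak_deriv 2 v v\<^sub>2"
    using integration_by_parts_test_function[OF test_function_deriv v cv(2)]
      integration_by_parts_test_function[OF _ v\<^sub>1 v\<^sub>2]
    by (auto simp: has_weak_deriv_def loc numeral_2_eq_2)
qed

section \<open>From exponential decay to the Sobolev norm\<close>

lemma integrable_exp_minus_abs:
  fixes c :: real
  assumes "c > 0"
  shows "integrable lborel (\<lambda>x. exp (- c * \<bar>x\<bar>))"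
proof -
  define g where "g x = indicator {0..} x *\<^sub>R exp (- c * x)" for x :: real
  have "set_integrable lebesgue {0..} (\<lambda>x. exp (- c * x))"
    using integrable_on_exp_minus_to_infinity[OF assms, of 0] by (intro nonnegative_absolutely_integrable_1) auto
  then have "integrable lebesgue g" by (simp add: set_integrable_def g_def [abs_def])
  moreover have [measurable]: "g \<in> borel_measurable borel" unfolding g_def by measurable
  ultimately have g: "integrable lborel g" by (simp add: integrable_completion)
  have g': "integrable lborel (\<lambda>x. g (- x))"
    using lborel_integrable_real_affine[OF g, of "-1" 0] by simp
  show ?thesis
    by (rule Bochner_Integration.integrable_bound[OF Bochner_Integration.integrable_add[OF g g']])
       (auto simp: g_def indicator_def abs_if)
qed

text \<open>The constant is chosen before \<open>v\<close> and \<open>M\<close>, so a linear map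
  whose values obey such bounds is bounded into \<open>H2\<close>. Its value is sqrt (3 J) with J
  the integral of exp (-2 a |x|): one J for each of the orders 0, 1, 2.\<close>

lemma H2_exponential_decay:
  fixes a :: real
  assumes "a > 0"
  obtains C where "C \<ge> 0"
    "\<And>v v\<^sub>1 v\<^sub>2 M. \<lbrakk>\<And>x. (v has_vector_derivative v\<^sub>1 x) (at x); \<And>x. (v\<^sub>1 has_vector_derivative v\<^sub>2 x) (at x);
       continuous_on UNIV v\<^sub>2; \<And>x. cmod (v x) \<le> M * exp (- a * \<bar>x\<bar>);
       \<And>x. cmod (v\<^sub>1 x) \<le> M * exp (- a * \<bar>x\<bar>); \<And>x. cmod (v\<^sub>2 x) \<le> M * exp (- a * \<bar>x\<bar>)\<rbrakk> \<Longrightarrow>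
      v \<in> H2 \<and> H2_norm v \<le> C * M"
proof
  define J where "J = (LINT x|lborel. exp (- (2 * a) * \<bar>x\<bar>))"
  have J_int: "integrable lborel (\<lambda>x. exp (- (2 * a) * \<bar>x\<bar>))"
    using assms by (intro integrable_exp_minus_abs) auto
  have J: "J \<ge> 0" by (simp add: J_def)
  show "sqrt (3 * J) \<ge> 0" using J by simp
  fix v v\<^sub>1 v\<^sub>2 :: "real \<Rightarrow> complex" and M
  assume v: "\<And>x. (v has_vector_derivative v\<^sub>1 x) (at x)" "\<And>x. (v\<^sub>1 has_vector_derivative v\<^sub>2 x) (at x)"
    "continuous_on UNIV v\<^sub>2"
    and bnd: "\<And>x. cmod (v x) \<le> M * exp (- a * \<bar>x\<bar>)" "\<And>x. cmod (v\<^sub>1 x) \<le> M * exp (- a * \<bar>x\<bar>)"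
      "\<And>x. cmod (v\<^sub>2 x) \<le> M * exp (- a * \<bar>x\<bar>)"
  have M: "M \<ge> 0" using order_trans[OF norm_ge_zero bnd(1)[of 0]] by simp
  note weak = has_weak_deriv_classical[OF v]
  have cv: "continuous_on UNIV v" "continuous_on UNIV v\<^sub>1"
    using v by (auto intro!: continuous_at_imp_continuous_on has_vector_derivative_continuous)
  have sq: "(cmod (w x))\<^sup>2 \<le> M\<^sup>2 * exp (- (2 * a) * \<bar>x\<bar>)"
    if "\<And>x. cmod (w x) \<le> M * exp (- a * \<bar>x\<bar>)" for w :: "real \<Rightarrow> complex" and x
  proof -
    have "(cmod (w x))\<^sup>2 \<le> (M * exp (- a * \<bar>x\<bar>))\<^sup>2"
      using that by (intro power_mono) auto
    also have "\<dots> = M\<^sup>2 * exp (- (2 * a) * \<bar>x\<bar>)"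
      by (simp add: power_mult_distrib power2_eq_square[of "exp _"] exp_add[symmetric] algebra_simps)
    finally show ?thesis .
  qed
  have sqint: "square_integrable w" "(LINT x|lborel. (cmod (w x))\<^sup>2) \<le> M\<^sup>2 * J"
    if w: "continuous_on UNIV w" "\<And>x. cmod (w x) \<le> M * exp (- a * \<bar>x\<bar>)" for w :: "real \<Rightarrow> complex"
  proof -
    have [measurable]: "w \<in> borel_measurable borel"
      using w(1) by (rule borel_measurable_continuous_onI)
    have int: "integrable lborel (\<lambda>x. (cmod (w x))\<^sup>2)"
      by (rule Bochner_Integration.integrable_bound[OF integrable_mult_right[OF J_int, of "M\<^sup>2"]])
         (use sq[OF w(2)] in auto)
    then show "square_integrable w" by (simp add: square_integrable_def)
    show "(LINT x|lborel. (cmod (w x))\<^sup>2) \<le> M\<^sup>2 * J"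
      unfolding J_def integral_mult_right_zero[symmetric]
      by (rule integral_mono[OF int integrable_mult_right[OF J_int]]) (rule sq[OF w(2)])
  qed
  have "v \<in> H2"
    unfolding H2_def
  proof safe
    fix k :: nat assume "k \<le> 2"
    then consider "k = 0" | "k = 1" | "k = 2" by linarith
    then show "\<exists>w. has_weak_deriv k v w \<and> square_integrable w"
      by cases (use weak sqint(1)[OF cv(1) bnd(1)] sqint(1)[OF cv(2) bnd(2)] sqint(1)[OF v(3) bnd(3)] in blast)+
  qed (rule cv)
  moreover have "H2_norm v \<le> sqrt (3 * J) * M"
  proof -
    \<comment> \<open>\<open>weak_deriv\<close> is an arbitrary choice among representatives;
      uniqueness almost everywhere makes its square integral that of the classical
      derivative.\<close>
    have eq: "(LINT x|lborel. (cmod (weak_deriv k v x))\<^sup>2) = (LINT x|lborel. (cmod (w x))\<^sup>2)"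
      if w: "has_weak_deriv k v w" for k w
    proof -
      have *: "has_weak_deriv k v (weak_deriv k v)"
        unfolding weak_deriv_def by (rule someI[where P = "has_weak_deriv k v", OF w])
      have "AE x in lborel. weak_deriv k v x = w x"
        by (rule has_weak_deriv_unique[OF * w])
      then have "AE x in lborel. (cmod (weak_deriv k v x))\<^sup>2 = (cmod (w x))\<^sup>2" by auto
      moreover have [measurable]: "weak_deriv k v \<in> borel_measurable borel" "w \<in> borel_measurable borel"
        using * w locally_integrable_measurable by (auto simp: has_weak_deriv_def)
      ultimately show ?thesis by (intro integral_cong_AE) auto
    qed
    have "{..2::nat} = {0, 1, 2}" by auto
    then have "H2_norm v = sqrt ((LINT x|lborel. (cmod (v x))\<^sup>2) + (LINT x|lborel. (cmod (v\<^sub>1 x))\<^sup>2) +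
        (LINT x|lborel. (cmod (v\<^sub>2 x))\<^sup>2))"
      unfolding H2_norm_def using eq[OF weak(1)] eq[OF weak(2)] eq[OF weak(3)] by (simp add: add_ac)
    also have "\<dots> \<le> sqrt (3 * J * M\<^sup>2)"
      using sqint(2)[OF cv(1) bnd(1)] sqint(2)[OF cv(2) bnd(2)] sqint(2)[OF v(3) bnd(3)]
      by (intro real_sqrt_le_mono) (simp add: algebra_simps)
    also have "\<dots> = sqrt (3 * J) * M"
      using M by (simp add: real_sqrt_mult)
    finally show ?thesis .
  qed
  ultimately show "v \<in> H2 \<and> H2_norm v \<le> sqrt (3 * J) * M" by blast
qed

section \<open>Antiderivatives and exponentially decaying profiles\<close>

definition antiderivative :: "(real \<Rightarrow> real) \<Rightarrow> real \<Rightarrow> real" where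
  "antiderivative f x = (LBINT t=ereal 0..ereal x. f t)"

lemma antiderivative_0 [simp]: "antiderivative f 0 = 0"
  by (simp add: antiderivative_def)

lemma antiderivative_has_derivative:
  assumes "continuous_on UNIV f"
  shows "(antiderivative f has_real_derivative f x) (at x)"
proof -
  have "((\<lambda>u. LBINT y=ereal 0..ereal u. f y) has_vector_derivative f x)
      (at x within {- \<bar>x\<bar> - 1..\<bar>x\<bar> + 1})"
    by (rule interval_integral_FTC2) (auto intro: continuous_on_subset[OF assms])
  moreover have "x \<in> interior {- \<bar>x\<bar> - 1..\<bar>x\<bar> + 1}" by auto
  ultimately have "((\<lambda>u. LBINT y=ereal 0..ereal u. f y) has_vector_derivative f x) (at x)"
    by (simp only: at_within_interior)
  then show ?thesis
    by (simp add: has_real_derivative_iff_has_vector_derivative antiderivative_def [abs_def])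
qed

lemma antiderivative_unique:
  assumes "\<And>x. (F has_real_derivative f x) (at x)" and "F 0 = 0" and "continuous_on UNIV f"
  shows "antiderivative f x = F x"
proof -
  have "\<forall>x. ((\<lambda>x. antiderivative f x - F x) has_real_derivative 0) (at x)"
    using DERIV_diff[OF antiderivative_has_derivative[OF assms(3)] assms(1)] by simp
  then have "antiderivative f x - F x = antiderivative f 0 - F 0"
    by (rule DERIV_isconst_all)
  then show ?thesis using assms(2) by simp
qed

lemma antiderivative_add:
  assumes "continuous_on UNIV f" and "continuous_on UNIV g"
  shows "antiderivative (\<lambda>x. f x + g x) x = antiderivative f x + antiderivative g x"
proof (rule antiderivative_unique)
  show "((\<lambda>x. antiderivative f x + antiderivative g x) has_real_derivative f x + g x) (at x)" for x
    using antiderivative_has_derivative[OF assms(1)] antiderivative_has_derivative[OF assms(2)]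
    by (rule DERIV_add)
qed (use assms in \<open>auto intro: continuous_on_add\<close>)

lemma antiderivative_cmult:
  assumes "continuous_on UNIV f"
  shows "antiderivative (\<lambda>x. c * f x) x = c * antiderivative f x"
proof (rule antiderivative_unique)
  show "((\<lambda>x. c * antiderivative f x) has_real_derivative c * f x) (at x)" for x
    by (rule DERIV_cmult[OF antiderivative_has_derivative[OF assms]])
qed (use assms in \<open>auto intro: continuous_on_mult_left\<close>)

lemma antiderivative_parity:
  fixes s :: real
  assumes "continuous_on UNIV f" and "\<And>x. f (- x) = s * f x"
  shows "antiderivative f (- x) = - s * antiderivative f x"
proof -
  have "- s * antiderivative f x = - antiderivative (\<lambda>x. f (- x)) x"
    by (simp add: assms(2) antiderivative_cmult[OF assms(1)])
  also have "antiderivative (\<lambda>x. f (- x)) x = - antiderivative f (- x)"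
  proof (rule antiderivative_unique)
    show "((\<lambda>x. - antiderivative f (- x)) has_real_derivative f (- x)) (at x)" for x
      by (rule derivative_eq_intros DERIV_chain'[OF _ antiderivative_has_derivative[OF assms(1)]] refl)+ simp
    show "continuous_on UNIV (\<lambda>x. f (- x))"
      using assms(1) by (auto intro!: continuous_on_compose2[OF assms(1)] continuous_intros)
  qed simp
  finally show ?thesis by simp
qed

text \<open>Estimates of integrals are replaced by monotonicity of G - F and G + F.\<close>

lemma DERIV_abs_le_imp_abs_diff_le:
  fixes F G :: "real \<Rightarrow> real"
  assumes "\<And>x. x \<ge> a \<Longrightarrow> (F has_real_derivative f x) (at x)"
    and "\<And>x. x \<ge> a \<Longrightarrow> (G has_real_derivative g x) (at x)"
    and "\<And>x. x \<ge> a \<Longrightarrow> \<bar>f x\<bar> \<le> g x" and "a \<le> x" "x \<le> y"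
  shows "\<bar>F y - F x\<bar> \<le> G y - G x"
proof -
  have "G x - F x \<le> G y - F y"
  proof (rule DERIV_nonneg_imp_nondecreasing[OF assms(5)])
    fix t assume "x \<le> t"
    then have "t \<ge> a" using assms(4) by simp
    then show "\<exists>d. ((\<lambda>t. G t - F t) has_real_derivative d) (at t) \<and> d \<ge> 0"
      using DERIV_diff[OF assms(2,1)] assms(3)[of t] by (intro exI[of _ "g t - f t"]) auto
  qed
  moreover have "G x + F x \<le> G y + F y"
  proof (rule DERIV_nonneg_imp_nondecreasing[OF assms(5)])
    fix t assume "x \<le> t"
    then have "t \<ge> a" using assms(4) by simp
    then show "\<exists>d. ((\<lambda>t. G t + F t) has_real_derivative d) (at t) \<and> d \<ge> 0"
      using DERIV_add[OF assms(2,1)] assms(3)[of t] by (intro exI[of _ "g t + f t"]) auto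
  qed
  ultimately show ?thesis by linarith
qed

section \<open>Integrals of decaying functions over the half line\<close>

definition half_line_integral :: "(real \<Rightarrow> real) \<Rightarrow> real" where
  "half_line_integral f = lim (\<lambda>n. antiderivative f (real n))"

definition exp_decaying :: "real \<Rightarrow> real \<Rightarrow> (real \<Rightarrow> real) \<Rightarrow> bool" where
  "exp_decaying l M f \<longleftrightarrow> continuous_on UNIV f \<and> (\<forall>x\<ge>0. \<bar>f x\<bar> \<le> M * exp (- l * x))"

lemma exp_decaying_mono:
  assumes "exp_decaying l M f" and "M \<le> M'"
  shows "exp_decaying l M' f"
proof -
  have "\<bar>f x\<bar> \<le> M' * exp (- l * x)" if "x \<ge> 0" for x
  proof -
    have "\<bar>f x\<bar> \<le> M * exp (- l * x)" using assms(1) that by (simp add: exp_decaying_def)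
    also have "\<dots> \<le> M' * exp (- l * x)" using assms(2) by (intro mult_right_mono) auto
    finally show ?thesis .
  qed
  then show ?thesis using assms(1) by (simp add: exp_decaying_def)
qed

lemma exp_decaying_add:
  "exp_decaying l M f \<Longrightarrow> exp_decaying l M' g \<Longrightarrow> exp_decaying l (M + M') (\<lambda>x. f x + g x)"
  unfolding exp_decaying_def
  by (auto intro!: continuous_intros order_trans[OF abs_triangle_ineq] add_mono simp: distrib_right)

lemma exp_decaying_cmult:
  "exp_decaying l M f \<Longrightarrow> exp_decaying l (\<bar>c\<bar> * M) (\<lambda>x. c * f x)"
  unfolding exp_decaying_def
  by (auto intro!: continuous_intros mult_left_mono simp: abs_mult mult.assoc)

lemma exp_decaying_mult:
  assumes "exp_decaying l M f" and "continuous_on UNIV g" and "\<And>x. x \<ge> 0 \<Longrightarrow> \<bar>g x\<bar> \<le> B * exp (- k * x)"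
  shows "exp_decaying (l + k) (B * M) (\<lambda>x. g x * f x)"
proof -
  have "\<bar>g x * f x\<bar> \<le> B * M * exp (- (l + k) * x)" if "x \<ge> 0" for x
  proof -
    have "\<bar>g x * f x\<bar> \<le> (B * exp (- k * x)) * (M * exp (- l * x))"
      unfolding abs_mult using assms that
      by (intro mult_mono) (auto simp: exp_decaying_def intro: order_trans[OF abs_ge_zero])
    also have "\<dots> = B * M * (exp (- k * x) * exp (- l * x))" by simp
    also have "exp (- k * x) * exp (- l * x) = exp (- (l + k) * x)"
      by (simp add: exp_add[symmetric] algebra_simps)
    finally show ?thesis .
  qed
  then show ?thesis
    using assms by (auto simp: exp_decaying_def intro!: continuous_intros)
qed

text \<open>Existence of the limit and the tail estimate come from one comparison: the
  antiderivative minus (M / l) exp (- l x) is nondecreasing and bounded along the integers, and the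
  subtracted exponential tends to 0.\<close>

lemma half_line_integral_bound:
  assumes "exp_decaying l M f" and "l > 0" and "x \<ge> 0"
  shows "\<bar>half_line_integral f - antiderivative f x\<bar> \<le> M / l * exp (- l * x)"
proof -
  let ?F = "antiderivative f" and ?G = "\<lambda>x. - (M / l) * exp (- l * x)"
  have cont: "continuous_on UNIV f" using assms(1) by (simp add: exp_decaying_def)
  have d: "\<bar>?F y - ?F x\<bar> \<le> ?G y - ?G x" if "0 \<le> x" "x \<le> y" for x y
  proof (rule DERIV_abs_le_imp_abs_diff_le[OF _ _ _ that])
    show "(?G has_real_derivative M * exp (- l * x)) (at x)" for x
      using assms(2) by (auto intro!: derivative_eq_intros)
  qed (use assms antiderivative_has_derivative[OF cont] in \<open>auto simp: exp_decaying_def\<close>)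
  have M: "M \<ge> 0" 
    using assms(1) unfolding exp_decaying_def by (metis abs_ge_zero exp_zero mult.right_neutral mult_zero_right order_refl order_trans)
  have "incseq (\<lambda>n. ?F (real n) + ?G (real n))"
  proof (rule incseq_SucI)
    fix n show "?F (real n) + ?G (real n) \<le> ?F (real (Suc n)) + ?G (real (Suc n))"
      using d[of "real n" "real (Suc n)"] by simp
  qed
  moreover have "?F (real n) + ?G (real n) \<le> 2 * (M / l)" for n
  proof -
    have "M / l * exp (- l * real n) \<ge> 0" "M / l \<ge> 0" using assms(2) M by auto
    then show ?thesis using d[of 0 "real n"] by simp
  qed
  ultimately obtain L where "(\<lambda>n. ?F (real n) + ?G (real n)) \<longlonglongrightarrow> L"
    using incseq_convergent[of "\<lambda>n. ?F (real n) + ?G (real n)" "2 * (M / l)"] by blast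
  moreover have "(\<lambda>n. exp (- l * real n)) \<longlonglongrightarrow> 0"
  proof -
    have "(\<lambda>n. exp (- l) ^ n) \<longlonglongrightarrow> 0"
      using assms(2) by (intro LIMSEQ_power_zero) auto
    then show ?thesis by (simp add: exp_of_nat_mult[symmetric] mult.commute)
  qed
  then have "(\<lambda>n. ?G (real n)) \<longlonglongrightarrow> - (M / l) * 0" by (intro tendsto_intros)
  ultimately have "(\<lambda>n. ?F (real n) + ?G (real n) - ?G (real n)) \<longlonglongrightarrow> L - - (M / l) * 0"
    by (rule tendsto_diff)
  then have L: "(\<lambda>n. ?F (real n)) \<longlonglongrightarrow> L" by simp
  then have "half_line_integral f = L" unfolding half_line_integral_def by (rule limI)
  moreover have "\<bar>L - ?F x\<bar> \<le> M / l * exp (- l * x)"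
  proof (rule tendsto_upperbound)
    show "(\<lambda>n. \<bar>?F (real n) - ?F x\<bar>) \<longlonglongrightarrow> \<bar>L - ?F x\<bar>" by (intro tendsto_intros L)
    show "\<forall>\<^sub>F n in sequentially. \<bar>?F (real n) - ?F x\<bar> \<le> M / l * exp (- l * x)"
      using eventually_ge_at_top[of "nat \<lceil>x\<rceil>"]
    proof eventually_elim
      case (elim n)
      have "M / l * exp (- l * real n) \<ge> 0" using assms(2) M by auto
      moreover have "x \<le> real n" using elim by linarith
      ultimately show ?case using d[OF assms(3), of "real n"] by simp
    qed
  qed simp
  ultimately show ?thesis by simp
qed

lemma antiderivative_tendsto_half_line_integral:
  assumes "exp_decaying l M f" and "l > 0"
  shows "(antiderivative f \<longlongrightarrow> half_line_integral f) at_top"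
proof -
  have "filterlim (\<lambda>x. l * x) at_top at_top"
    by (rule filterlim_tendsto_pos_mult_at_top[OF tendsto_const assms(2) filterlim_ident])
  then have "((\<lambda>x. exp (- (l * x))) \<longlongrightarrow> 0) at_top"
    by (rule filterlim_compose[OF exp_at_bot filterlim_compose[OF filterlim_uminus_at_bot_at_top]])
  then have lim: "((\<lambda>x. M / l * exp (- (l * x))) \<longlongrightarrow> 0) at_top"
    by (rule tendsto_mult_right_zero)
  have "((\<lambda>x. antiderivative f x - half_line_integral f) \<longlongrightarrow> 0) at_top"
  proof (rule Lim_null_comparison[OF _ lim])
    show "\<forall>\<^sub>F x in at_top. norm (antiderivative f x - half_line_integral f) \<le> M / l * exp (- (l * x))"
      using eventually_ge_at_top[of 0]
    proof eventually_elim
      case (elim x)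
      then show ?case
        using half_line_integral_bound[OF assms, of x]
        by (simp only: real_norm_def abs_minus_commute[of "antiderivative f x"] mult_minus_left)
    qed
  qed
  then show ?thesis by (rule LIM_zero_cancel)
qed

text \<open>Evaluates pairings from an explicit primitive; the limit along the integers in the
  definition is also the limit along the reals.\<close>

lemma half_line_integral_eqI:
  assumes "exp_decaying l M f" and "l > 0" and "\<And>x. (F has_real_derivative f x) (at x)"
    and "F 0 = 0" and "(F \<longlongrightarrow> L) at_top"
  shows "half_line_integral f = L"
proof -
  have "antiderivative f = F"
    using assms(1) by (intro ext antiderivative_unique assms) (simp add: exp_decaying_def)
  then show ?thesis
    using antiderivative_tendsto_half_line_integral[OF assms(1,2)] assms(5)
    by (intro tendsto_unique[of at_top F]) auto
qed

lemma half_line_integral_add: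
  assumes "exp_decaying l M f" and "exp_decaying l M' g" and "l > 0"
  shows "half_line_integral (\<lambda>x. f x + g x) = half_line_integral f + half_line_integral g"
proof -
  have "continuous_on UNIV f" "continuous_on UNIV g" using assms by (auto simp: exp_decaying_def)
  then show ?thesis
    using assms
    by (intro half_line_integral_eqI[where F = "\<lambda>x. antiderivative f x + antiderivative g x",
          OF exp_decaying_add] DERIV_add tendsto_add
        antiderivative_has_derivative antiderivative_tendsto_half_line_integral) auto
qed

lemma half_line_integral_cmult:
  assumes "exp_decaying l M f" and "l > 0"
  shows "half_line_integral (\<lambda>x. c * f x) = c * half_line_integral f"
proof -
  have "continuous_on UNIV f" using assms by (auto simp: exp_decaying_def)
  then show ?thesis
    using assms
    by (intro half_line_integral_eqI[where F = "\<lambda>x. c * antiderivative f x", OF exp_decaying_cmult] DERIV_cmult tendsto_mult tendsto_const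
        antiderivative_has_derivative antiderivative_tendsto_half_line_integral) auto
qed

lemma half_line_integral_abs_le:
  assumes "exp_decaying l M f" and "l > 0"
  shows "\<bar>half_line_integral f\<bar> \<le> M / l"
  using half_line_integral_bound[OF assms, of 0] by simp

text \<open>A pair \<open>(c, g)\<close> represents the even function \<open>x \<mapsto> c + exp (- \<kappa> \<bar>x\<bar> / 2) * g \<bar>x\<bar>\<close>; the values of \<open>g\<close>
  at negative arguments are irrelevant.\<close>

type_synonym profile = "real \<times> (real \<Rightarrow>\<^sub>C real)"

section \<open>The Banach algebra of even profiles\<close>

locale decay_rate =
  fixes \<kappa> :: real
  assumes \<kappa>_pos: "\<kappa> > 0"
begin

text \<open>Half the decay rate of the kernel functions of the linearised operators. At the full
  rate \<kappa> the solution operators would be resonant and lose a factor x; a strictly slower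
  weight is reproduced by them.\<close>

definition weight :: "real \<Rightarrow> real" where
  "weight x = exp (- (\<kappa> / 2) * \<bar>x\<bar>)"

definition decaying_part :: "profile \<Rightarrow> real \<Rightarrow> real" where
  "decaying_part g x = weight x * apply_bcontfun (snd g) \<bar>x\<bar>"

definition profile_fun :: "profile \<Rightarrow> real \<Rightarrow> real" where
  "profile_fun g x = fst g + decaying_part g x"

text \<open>Division by the weight turns decay into boundedness. \<open>Bcontfun\<close> returns the
  intended function only for bounded continuous quotients, hence the assumption
  \<open>decaying\<close> in the lemmas about it.\<close>

definition mk_profile :: "real \<Rightarrow> (real \<Rightarrow> real) \<Rightarrow> profile" where
  "mk_profile c r = (c, Bcontfun (\<lambda>x. r \<bar>x\<bar> / weight x))"

lemma weight_pos [simp]: "weight x > 0" "weight x \<ge> 0" "weight x \<noteq> 0" "\<bar>weight x\<bar> = weight x"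
  by (simp_all add: weight_def)

lemma weight_minus [simp]: "weight (- x) = weight x" and weight_abs [simp]: "weight \<bar>x\<bar> = weight x"
  by (simp_all add: weight_def)

lemma weight_le_1: "weight x \<le> 1"
  using \<kappa>_pos by (simp add: weight_def)

lemma continuous_on_weight [continuous_intros]: "continuous_on S weight"
  unfolding weight_def by (intro continuous_intros)

lemma abs_fst_le: "\<bar>fst g\<bar> \<le> norm g" and norm_snd_le': "norm (snd g) \<le> norm g" for g :: profile
  using norm_fst_le[of "fst g" "snd g"] norm_snd_le[of "snd g" "fst g"] by simp_all

abbreviation decaying :: "real \<Rightarrow> (real \<Rightarrow> real) \<Rightarrow> bool" where
  "decaying \<equiv> exp_decaying (\<kappa> / 2)"

lemma decaying_part_simps [simp]:
  "decaying_part (g + h) x = decaying_part g x + decaying_part h x"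
  "decaying_part (g - h) x = decaying_part g x - decaying_part h x"
  "decaying_part (c *\<^sub>R g) x = c * decaying_part g x"
  by (simp_all add: decaying_part_def algebra_simps)

lemma profile_fun_simps [simp]:
  "profile_fun (g + h) x = profile_fun g x + profile_fun h x"
  "profile_fun (g - h) x = profile_fun g x - profile_fun h x"
  "profile_fun (c *\<^sub>R g) x = c * profile_fun g x"
  by (simp_all add: profile_fun_def algebra_simps)

lemma decaying_part_minus [simp]: "decaying_part g (- x) = decaying_part g x"
  by (simp add: decaying_part_def)

lemma decaying_part_abs [simp]: "decaying_part g \<bar>x\<bar> = decaying_part g x"
  by (simp add: decaying_part_def)

lemma decaying_iff: "decaying M r \<longleftrightarrow> continuous_on UNIV r \<and> (\<forall>x\<ge>0. \<bar>r x\<bar> \<le> M * weight x)"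
  by (auto simp: exp_decaying_def weight_def)

lemma abs_decaying_part_le: "\<bar>decaying_part g x\<bar> \<le> norm g * weight x"
proof -
  have "\<bar>apply_bcontfun (snd g) \<bar>x\<bar>\<bar> \<le> norm g"
    using norm_bounded[of "snd g" "\<bar>x\<bar>"] norm_snd_le'[of g] by simp
  then show ?thesis
    by (simp add: decaying_part_def abs_mult mult.commute[of "norm g"] mult_left_mono)
qed

lemma continuous_on_decaying_part: "continuous_on S (decaying_part g)"
  unfolding decaying_part_def
  by (intro continuous_intros continuous_on_compose2[OF continuous_on_apply_bcontfun[of UNIV "snd g"]]) auto

lemma decaying_decaying_part: "decaying (norm g) (decaying_part g)"
  unfolding decaying_iff using abs_decaying_part_le continuous_on_decaying_part by blast

lemma mk_profile_bcontfun:
  assumes "decaying M r"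
  shows "(\<lambda>x. r \<bar>x\<bar> / weight x) \<in> bcontfun" and "\<bar>r \<bar>x\<bar> / weight x\<bar> \<le> M"
proof -
  have r: "continuous_on UNIV r" "\<And>x. \<bar>r \<bar>x\<bar>\<bar> \<le> M * weight x"
    using assms by (auto simp: decaying_iff dest: spec[of _ "\<bar>_\<bar>"])
  show le: "\<bar>r \<bar>x\<bar> / weight x\<bar> \<le> M" for x
    using r(2)[of x] by (simp add: pos_divide_le_eq)
  have "continuous_on UNIV (\<lambda>x. r \<bar>x\<bar> / weight x)"
    by (intro continuous_intros continuous_on_compose2[OF r(1)]) auto
  then show "(\<lambda>x. r \<bar>x\<bar> / weight x) \<in> bcontfun"
    by (rule bcontfun_normI[where b = M]) (use le in auto)
qed

lemma fst_mk_profile [simp]: "fst (mk_profile c r) = c"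
  by (simp add: mk_profile_def)

lemma apply_mk_profile:
  assumes "decaying M r"
  shows "apply_bcontfun (snd (mk_profile c r)) x = r \<bar>x\<bar> / weight x"
  unfolding mk_profile_def snd_conv Bcontfun_inverse[OF mk_profile_bcontfun(1)[OF assms]] ..

lemma decaying_part_mk_profile: "decaying M r \<Longrightarrow> decaying_part (mk_profile c r) x = r \<bar>x\<bar>"
  by (simp add: decaying_part_def apply_mk_profile)

lemma profile_fun_mk_profile: "decaying M r \<Longrightarrow> profile_fun (mk_profile c r) x = c + r \<bar>x\<bar>"
  by (simp add: profile_fun_def decaying_part_mk_profile)

lemma mk_profile_add:
  assumes "decaying M r" and "decaying M' r'"
  shows "mk_profile (c + c') (\<lambda>x. r x + r' x) = mk_profile c r + mk_profile c' r'"
  by (auto intro!: prod_eqI bcontfun_eqI simp: apply_mk_profile[OF assms(1)]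
      apply_mk_profile[OF assms(2)] apply_mk_profile[OF exp_decaying_add[OF assms]] add_divide_distrib)

lemma mk_profile_scaleR:
  assumes "decaying M r"
  shows "mk_profile (k * c) (\<lambda>x. k * r x) = k *\<^sub>R mk_profile c r"
  by (auto intro!: prod_eqI bcontfun_eqI simp: apply_mk_profile[OF assms]
      apply_mk_profile[OF exp_decaying_cmult[OF assms]])

lemma norm_mk_profile_le:
  assumes "decaying M r"
  shows "norm (mk_profile c r) \<le> \<bar>c\<bar> + M"
proof -
  have "norm (snd (mk_profile c r)) \<le> M"
    by (rule norm_bound) (use mk_profile_bcontfun(2)[OF assms] in \<open>simp add: apply_mk_profile[OF assms]\<close>)
  moreover have "norm (mk_profile c r) \<le> norm (fst (mk_profile c r)) + norm (snd (mk_profile c r))"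
    using norm_Pair_le[of "fst (mk_profile c r)" "snd (mk_profile c r)"] by (simp only: prod.collapse)
  ultimately show ?thesis by simp
qed

lemma mk_profile_bounded_linear:
  assumes "bounded_linear c"
    and "\<And>g. decaying (C * norm g) (R g)"
    and add: "\<And>g h. R (g + h) = (\<lambda>x. R g x + R h x)" and scale: "\<And>k g. R (k *\<^sub>R g) = (\<lambda>x. k * R g x)"
  shows "bounded_linear (\<lambda>g. mk_profile (c g) (R g))"
proof -
  interpret c: bounded_linear c by fact
  obtain K where K: "\<And>g. norm (c g) \<le> norm g * K" using c.bounded by blast
  show ?thesis
  proof (rule bounded_linear_intro)
    show "mk_profile (c (g + h)) (R (g + h)) = mk_profile (c g) (R g) + mk_profile (c h) (R h)" for g h
      using mk_profile_add[OF assms(2,2), of "c g" "c h" g h]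
      by (simp add: c.add add)
    show "mk_profile (c (k *\<^sub>R g)) (R (k *\<^sub>R g)) = k *\<^sub>R mk_profile (c g) (R g)" for k g
      using mk_profile_scaleR[OF assms(2), of k "c g" g] by (simp add: c.scaleR flip: assms(4))
    show "norm (mk_profile (c g) (R g)) \<le> norm g * (K + C)" for g
      using norm_mk_profile_le[OF assms(2), of "c g" g] K[of g] by (simp add: algebra_simps)
  qed
qed

definition profile_mult :: "profile \<Rightarrow> profile \<Rightarrow> profile" (infixl \<open>\<odot>\<close> 70) where
  "g \<odot> h = mk_profile (fst g * fst h)
     (\<lambda>x. fst g * decaying_part h x + fst h * decaying_part g x + decaying_part g x * decaying_part h x)"

lemma decaying_profile_mult:
  "decaying (3 * (norm g * norm h))
     (\<lambda>x. fst g * decaying_part h x + fst h * decaying_part g x + decaying_part g x * decaying_part h x)"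
proof -
  have "decaying (\<bar>fst g\<bar> * norm h + \<bar>fst h\<bar> * norm g + norm g * norm h)
      (\<lambda>x. fst g * decaying_part h x + fst h * decaying_part g x + decaying_part g x * decaying_part h x)"
  proof (intro exp_decaying_add exp_decaying_cmult decaying_decaying_part)
    \<comment> \<open>One factor is counted as decaying at rate 0, so that the product has exactly
      the rate \<kappa> / 2 of a profile.\<close>
    have "\<bar>decaying_part g x\<bar> \<le> norm g * exp (- 0 * x)" if "x \<ge> 0" for x
    proof -
      have "\<bar>decaying_part g x\<bar> \<le> norm g * weight x" by (rule abs_decaying_part_le)
      also have "\<dots> \<le> norm g * 1" by (intro mult_left_mono weight_le_1) auto
      finally show ?thesis by simp
    qed
    then show "decaying (norm g * norm h) (\<lambda>x. decaying_part g x * decaying_part h x)"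
      using exp_decaying_mult[OF decaying_decaying_part[of h], of "decaying_part g" "norm g" 0]
        decaying_decaying_part[of g] by (simp add: exp_decaying_def)
  qed
  moreover have "\<bar>fst g\<bar> * norm h + \<bar>fst h\<bar> * norm g + norm g * norm h \<le> 3 * (norm g * norm h)"
    using mult_right_mono[OF abs_fst_le[of g] norm_ge_zero[of h]]
      mult_right_mono[OF abs_fst_le[of h] norm_ge_zero[of g]]
      mult.commute[of "norm h" "norm g"] by linarith
  ultimately show ?thesis by (rule exp_decaying_mono)
qed

lemma profile_fun_mult [simp]: "profile_fun (g \<odot> h) x = profile_fun g x * profile_fun h x"
  unfolding profile_mult_def profile_fun_mk_profile[OF decaying_profile_mult]
  by (simp add: profile_fun_def decaying_part_def algebra_simps)

lemma fst_profile_mult [simp]: "fst (g \<odot> h) = fst g * fst h"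
  by (simp add: profile_mult_def)

text \<open>Up to the factor 4 the profiles form a Banach algebra, so polynomial nonlinearities act
  on them without loss of decay.\<close>

lemma bounded_bilinear_profile_mult: "bounded_bilinear (\<odot>)"
proof
  show "(g + g') \<odot> h = g \<odot> h + g' \<odot> h" for g g' h
    unfolding profile_mult_def
      mk_profile_add[OF decaying_profile_mult[of g h] decaying_profile_mult[of g' h], symmetric]
    by (rule arg_cong2[where f = mk_profile]) (auto simp: distrib_left distrib_right)
  show "g \<odot> (h + h') = g \<odot> h + g \<odot> h'" for g h h'
    unfolding profile_mult_def
      mk_profile_add[OF decaying_profile_mult[of g h] decaying_profile_mult[of g h'], symmetric]
    by (rule arg_cong2[where f = mk_profile]) (auto simp: distrib_left distrib_right)
  show "(k *\<^sub>R g) \<odot> h = k *\<^sub>R (g \<odot> h)" for k g h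
    unfolding profile_mult_def mk_profile_scaleR[OF decaying_profile_mult[of g h], symmetric]
    by (rule arg_cong2[where f = mk_profile]) (auto simp: distrib_left mult.left_commute)
  show "g \<odot> (k *\<^sub>R h) = k *\<^sub>R (g \<odot> h)" for k g h
    unfolding profile_mult_def mk_profile_scaleR[OF decaying_profile_mult[of g h], symmetric]
    by (rule arg_cong2[where f = mk_profile]) (auto simp: distrib_left mult.left_commute)
  have "norm (g \<odot> h) \<le> norm g * norm h * 4" for g h
  proof -
    have "norm (g \<odot> h) \<le> \<bar>fst g * fst h\<bar> + 3 * (norm g * norm h)"
      unfolding profile_mult_def by (rule norm_mk_profile_le[OF decaying_profile_mult])
    also have "\<bar>fst g * fst h\<bar> \<le> norm g * norm h"
      unfolding abs_mult by (intro mult_mono abs_fst_le) auto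
    finally show ?thesis by simp
  qed
  then show "\<exists>K. \<forall>g h. norm (g \<odot> h) \<le> norm g * norm h * K" by blast
qed

end

section \<open>Green's functions\<close>

text \<open>A fundamental system \<open>\<xi>, \<eta>\<close> of \<open>y'' = (\<kappa>\<^sup>2 - U) y\<close> of opposite parities (\<open>s\<close> is the parity of the
  decaying solution \<open>\<xi>\<close>) with Wronskian 1; bounds are only needed on the half line.\<close>

locale green_function = decay_rate +
  fixes \<xi> \<xi>' \<eta> \<eta>' U :: "real \<Rightarrow> real" and s C :: real
  assumes \<xi>: "\<And>x. (\<xi> has_real_derivative \<xi>' x) (at x)"
      "\<And>x. (\<xi>' has_real_derivative (\<kappa>\<^sup>2 - U x) * \<xi> x) (at x)"
    and \<eta>: "\<And>x. (\<eta> has_real_derivative \<eta>' x) (at x)"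
      "\<And>x. (\<eta>' has_real_derivative (\<kappa>\<^sup>2 - U x) * \<eta> x) (at x)"
    and wronskian: "\<And>x. \<xi> x * \<eta>' x - \<xi>' x * \<eta> x = 1"
    and \<xi>_bound: "\<And>x. x \<ge> 0 \<Longrightarrow> \<bar>\<xi> x\<bar> \<le> C * exp (- \<kappa> * x)" "\<And>x. x \<ge> 0 \<Longrightarrow> \<bar>\<xi>' x\<bar> \<le> C * exp (- \<kappa> * x)"
    and \<eta>_bound: "\<And>x. x \<ge> 0 \<Longrightarrow> \<bar>\<eta> x\<bar> \<le> C * exp (\<kappa> * x)" "\<And>x. x \<ge> 0 \<Longrightarrow> \<bar>\<eta>' x\<bar> \<le> C * exp (\<kappa> * x)"
    and U: "decaying C U" "\<And>x. U (- x) = U x"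
    and parity: "s * s = 1" "\<And>x. \<xi> (- x) = s * \<xi> x" "\<And>x. \<eta> (- x) = - s * \<eta> x"
begin

lemma C_nonneg: "C \<ge> 0"
  using \<xi>_bound(1)[of 0] by simp

lemma continuous_on_fundamental [continuous_intros]:
  "continuous_on S \<xi>" "continuous_on S \<xi>'" "continuous_on S \<eta>" "continuous_on S \<eta>'" "continuous_on S U"
  by (rule continuous_at_imp_continuous_on, use \<xi> \<eta> DERIV_isCont in blast)+
     (use U(1) in \<open>auto simp: exp_decaying_def intro: continuous_on_subset\<close>)

text \<open>Variation of constants for -y'' + (\<kappa>^2 - U) y = r. The growing solution is
  multiplied by a tail integral, which compensates its growth; the lower limit 0 in the other
  integral fixes the free multiple of \<xi>.\<close>

definition green :: "(real \<Rightarrow> real) \<Rightarrow> real \<Rightarrow> real" where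
  "green r x = \<eta> x * (half_line_integral (\<lambda>x. \<xi> x * r x) - antiderivative (\<lambda>x. \<xi> x * r x) x)
     + \<xi> x * antiderivative (\<lambda>x. \<eta> x * r x) x"

definition green' :: "(real \<Rightarrow> real) \<Rightarrow> real \<Rightarrow> real" where
  "green' r x = \<eta>' x * (half_line_integral (\<lambda>x. \<xi> x * r x) - antiderivative (\<lambda>x. \<xi> x * r x) x)
     + \<xi>' x * antiderivative (\<lambda>x. \<eta> x * r x) x"

lemma green_has_derivative:
  assumes "continuous_on UNIV r"
  shows "(green r has_real_derivative green' r x) (at x)"
    and "(green' r has_real_derivative (\<kappa>\<^sup>2 - U x) * green r x - r x) (at x)"
proof -
  have c: "continuous_on UNIV (\<lambda>x. \<xi> x * r x)" "continuous_on UNIV (\<lambda>x. \<eta> x * r x)"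
    by (intro continuous_intros assms)+
  note [derivative_intros] = antiderivative_has_derivative[OF c(1)] antiderivative_has_derivative[OF c(2)] \<xi> \<eta>
  show "(green r has_real_derivative green' r x) (at x)"
    unfolding green_def [abs_def] green'_def
    by (rule derivative_eq_intros refl)+ (simp add: algebra_simps)
  have "(green' r has_real_derivative (\<kappa>\<^sup>2 - U x) * green r x
      - (\<xi> x * \<eta>' x - \<xi>' x * \<eta> x) * r x) (at x)"
    unfolding green_def green'_def [abs_def]
    by (rule derivative_eq_intros refl)+ (simp add: algebra_simps)
  then show "(green' r has_real_derivative (\<kappa>\<^sup>2 - U x) * green r x - r x) (at x)"
    by (simp only: wronskian mult_1)
qed

lemma \<xi>_decaying:
  assumes "decaying M r"
  shows "exp_decaying (3 / 2 * \<kappa>) (C * M) (\<lambda>x. \<xi> x * r x)"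
  using exp_decaying_mult[OF assms, of \<xi> C \<kappa>] \<xi>_bound by (simp add: continuous_on_fundamental)

text \<open>The tail integral decays at rate 3/2 \<kappa> against growth at rate \<kappa>; the
  integral multiplying \<xi> grows at rate \<kappa>/2 against decay at rate \<kappa>. Both products
  have the size of the weight.\<close>

lemma green_abs_le:
  assumes r: "decaying M r" and x: "x \<ge> 0"
  shows "\<bar>green r x\<bar> \<le> 3 * C * C / \<kappa> * M * weight x" "\<bar>green' r x\<bar> \<le> 3 * C * C / \<kappa> * M * weight x"
proof -
  define p where "p = half_line_integral (\<lambda>x. \<xi> x * r x) - antiderivative (\<lambda>x. \<xi> x * r x) x"
  define q where "q = antiderivative (\<lambda>x. \<eta> x * r x) x"
  have cont: "continuous_on UNIV r" using r by (simp add: exp_decaying_def)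
  have M: "M \<ge> 0" using r unfolding exp_decaying_def by (auto dest!: spec[of _ 0])
  have p: "\<bar>p\<bar> \<le> C * M / (3 / 2 * \<kappa>) * exp (- (3 / 2 * \<kappa>) * x)"
    unfolding p_def using \<kappa>_pos by (intro half_line_integral_bound[OF \<xi>_decaying[OF r]] x) auto
  have q: "\<bar>q\<bar> \<le> 2 * C * M / \<kappa> * exp (\<kappa> / 2 * x)"
  proof -
    have "\<bar>antiderivative (\<lambda>x. \<eta> x * r x) x - antiderivative (\<lambda>x. \<eta> x * r x) 0\<bar> \<le>
        2 * C * M / \<kappa> * exp (\<kappa> / 2 * x) - 2 * C * M / \<kappa> * exp (\<kappa> / 2 * 0)"
    proof (rule DERIV_abs_le_imp_abs_diff_le[OF _ _ _ order_refl x])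
      show "(antiderivative (\<lambda>x. \<eta> x * r x) has_real_derivative \<eta> t * r t) (at t)" for t
        by (rule antiderivative_has_derivative) (intro continuous_intros cont)
      show "((\<lambda>x. 2 * C * M / \<kappa> * exp (\<kappa> / 2 * x)) has_real_derivative C * M * exp (\<kappa> / 2 * t)) (at t)" for t
        using \<kappa>_pos by (auto intro!: derivative_eq_intros)
      fix t :: real assume t: "t \<ge> 0"
      have "\<bar>\<eta> t * r t\<bar> \<le> (C * exp (\<kappa> * t)) * (M * exp (- (\<kappa> / 2) * t))"
        unfolding abs_mult using \<eta>_bound(1)[OF t] r t C_nonneg
        by (intro mult_mono) (auto simp: exp_decaying_def)
      also have "\<dots> = C * M * (exp (\<kappa> * t) * exp (- (\<kappa> / 2) * t))" by simp
      also have "exp (\<kappa> * t) * exp (- (\<kappa> / 2) * t) = exp (\<kappa> / 2 * t)"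
        by (simp add: exp_add[symmetric] algebra_simps)
      finally show "\<bar>\<eta> t * r t\<bar> \<le> C * M * exp (\<kappa> / 2 * t)" .
    qed
    moreover have "2 * C * M / \<kappa> \<ge> 0" using C_nonneg M \<kappa>_pos by simp
    ultimately show ?thesis unfolding q_def by simp
  qed
  have e: "exp (\<kappa> * x) * exp (- (3 / 2 * \<kappa>) * x) = weight x" "exp (- \<kappa> * x) * exp (\<kappa> / 2 * x) = weight x"
    using x by (simp_all add: weight_def exp_add[symmetric] algebra_simps)
  have "\<bar>u * p + v * q\<bar> \<le> 3 * C * C / \<kappa> * M * weight x"
    if u: "\<bar>u\<bar> \<le> C * exp (\<kappa> * x)" and v: "\<bar>v\<bar> \<le> C * exp (- \<kappa> * x)" for u v
  proof -
    have "\<bar>u * p + v * q\<bar> \<le> \<bar>u\<bar> * \<bar>p\<bar> + \<bar>v\<bar> * \<bar>q\<bar>"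
      using abs_triangle_ineq[of "u * p" "v * q"] by (simp add: abs_mult)
    also have "\<dots> \<le> (C * exp (\<kappa> * x)) * (C * M / (3 / 2 * \<kappa>) * exp (- (3 / 2 * \<kappa>) * x)) +
        (C * exp (- \<kappa> * x)) * (2 * C * M / \<kappa> * exp (\<kappa> / 2 * x))"
      using C_nonneg by (intro add_mono mult_mono u v p q) auto
    also have "\<dots> = C * C * M / (3 / 2 * \<kappa>) * (exp (\<kappa> * x) * exp (- (3 / 2 * \<kappa>) * x)) +
        2 * C * C * M / \<kappa> * (exp (- \<kappa> * x) * exp (\<kappa> / 2 * x))"
      by (simp add: ac_simps)
    \<comment> \<open>The two contributions are 2 / 3 and 2; their sum is then rounded up to
      3.\<close>
    also have "\<dots> = 8 / 3 * (C * C / \<kappa> * M * weight x)"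
      unfolding e using \<kappa>_pos by (simp add: field_simps)
    also have "\<dots> \<le> 3 * (C * C / \<kappa> * M * weight x)"
      using C_nonneg M \<kappa>_pos by (intro mult_right_mono) auto
    finally show ?thesis by simp
  qed
  from this[OF \<eta>_bound(1) \<xi>_bound(1)] this[OF \<eta>_bound(2) \<xi>_bound(2)] x
  show "\<bar>green r x\<bar> \<le> 3 * C * C / \<kappa> * M * weight x" "\<bar>green' r x\<bar> \<le> 3 * C * C / \<kappa> * M * weight x"
    unfolding green_def green'_def p_def[symmetric] q_def[symmetric] by auto
qed

lemma decaying_green:
  assumes "decaying M r"
  shows "decaying (3 * C * C / \<kappa> * M) (green r)"
proof -
  have "continuous_on UNIV r" using assms by (simp add: exp_decaying_def)
  then show ?thesis
    using green_abs_le[OF assms] green_has_derivative(1)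
    by (auto simp: decaying_iff intro!: continuous_at_imp_continuous_on DERIV_isCont)
qed

lemma green_add:
  assumes "decaying M r" and "decaying M' r'"
  shows "green (\<lambda>x. r x + r' x) x = green r x + green r' x"
proof -
  have c: "continuous_on UNIV r" "continuous_on UNIV r'" using assms by (auto simp: exp_decaying_def)
  show ?thesis
    using half_line_integral_add[OF \<xi>_decaying \<xi>_decaying, OF assms] \<kappa>_pos
      antiderivative_add[of "\<lambda>x. \<xi> x * r x" "\<lambda>x. \<xi> x * r' x"]
      antiderivative_add[of "\<lambda>x. \<eta> x * r x" "\<lambda>x. \<eta> x * r' x"]
    by (simp add: green_def distrib_left c continuous_intros) (simp add: algebra_simps)
qed

lemma green_cmult:
  assumes "decaying M r"
  shows "green (\<lambda>x. k * r x) x = k * green r x"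
proof -
  have c: "continuous_on UNIV r" using assms by (auto simp: exp_decaying_def)
  show ?thesis
    using half_line_integral_cmult[OF \<xi>_decaying, OF assms, of k] \<kappa>_pos
      antiderivative_cmult[of "\<lambda>x. \<xi> x * r x" k] antiderivative_cmult[of "\<lambda>x. \<eta> x * r x" k]
    by (simp add: green_def mult.left_commute[of _ k] c continuous_intros) (simp add: algebra_simps)
qed

text \<open>For odd \<xi> each term is even by itself. For even \<xi> the half-line integral
  contributes an odd multiple of the growing solution \<eta>, so evenness requires it to vanish: the
  Fredholm condition.\<close>

lemma green_even:
  assumes r: "continuous_on UNIV r" "\<And>x. r (- x) = r x"
    and orth: "s = - 1 \<or> half_line_integral (\<lambda>x. \<xi> x * r x) = 0"
  shows "green r (- x) = green r x"
proof -
  have "antiderivative (\<lambda>x. \<xi> x * r x) (- x) = - s * antiderivative (\<lambda>x. \<xi> x * r x) x"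
    by (rule antiderivative_parity) (auto intro!: continuous_intros simp: r parity)
  moreover have "antiderivative (\<lambda>x. \<eta> x * r x) (- x) = - (- s) * antiderivative (\<lambda>x. \<eta> x * r x) x"
    by (rule antiderivative_parity) (auto intro!: continuous_intros simp: r parity)
  ultimately have "green r (- x) = - s * \<eta> x * half_line_integral (\<lambda>x. \<xi> x * r x)
      - (s * s) * (\<eta> x * antiderivative (\<lambda>x. \<xi> x * r x) x) + (s * s) * (\<xi> x * antiderivative (\<lambda>x. \<eta> x * r x) x)"
    by (simp add: green_def parity(2,3) algebra_simps)
  then show ?thesis using orth by (auto simp: green_def parity(1) algebra_simps)
qed

text \<open>The constant \<open>c\<close> is mapped to \<open>c / \<kappa>\<^sup>2\<close>; the defect \<open>c U / \<kappa>\<^sup>2\<close> decays and goes into the source.\<close>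

definition source :: "profile \<Rightarrow> real \<Rightarrow> real" where
  "source g x = decaying_part g x + fst g / \<kappa>\<^sup>2 * U x"

definition solve :: "profile \<Rightarrow> profile" where
  "solve g = mk_profile (fst g / \<kappa>\<^sup>2) (green (source g))"

text \<open>For even \<xi> the replacement of a constant c by c U / \<kappa>^2 in
  \<open>source\<close> leaves the integral unchanged, since \<xi> (\<kappa>^2 - U) = \<xi>''
  integrates to -\<xi>'(0) = 0. The value is then half the integral of \<xi> times the profile over
  the whole line.\<close>

definition pairing :: "profile \<Rightarrow> real" where
  "pairing g = half_line_integral (\<lambda>x. \<xi> x * source g x)"

lemma decaying_source: "decaying ((1 + C / \<kappa>\<^sup>2) * norm g) (source g)"
proof -
  have "decaying (norm g + \<bar>fst g / \<kappa>\<^sup>2\<bar> * C) (source g)"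
    unfolding source_def [abs_def]
    by (intro exp_decaying_add exp_decaying_cmult decaying_decaying_part U)
  moreover have "norm g + \<bar>fst g / \<kappa>\<^sup>2\<bar> * C \<le> (1 + C / \<kappa>\<^sup>2) * norm g"
    using mult_right_mono[OF abs_fst_le[of g], of "C / \<kappa>\<^sup>2"] C_nonneg by (simp add: algebra_simps)
  ultimately show ?thesis by (rule exp_decaying_mono)
qed

lemma source_linear: "source (g + h) = (\<lambda>x. source g x + source h x)" "source (k *\<^sub>R g) = (\<lambda>x. k * source g x)"
  by (auto simp: source_def algebra_simps add_divide_distrib)

lemma continuous_on_source: "continuous_on UNIV (source g)"
  using decaying_source[of g] by (simp add: exp_decaying_def)

lemma bounded_linear_solve: "bounded_linear solve"
  unfolding solve_def [abs_def]
proof (rule mk_profile_bounded_linear)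
  show "bounded_linear (\<lambda>g::profile. fst g / \<kappa>\<^sup>2)"
    by (intro bounded_linear_divide[THEN bounded_linear_compose] bounded_linear_fst)
  show "decaying (3 * C * C / \<kappa> * (1 + C / \<kappa>\<^sup>2) * norm g) (green (source g))" for g
    using decaying_green[OF decaying_source[of g]] by (simp add: mult.assoc)
  show "green (source (g + h)) = (\<lambda>x. green (source g) x + green (source h) x)" for g h
    by (simp add: source_linear fun_eq_iff green_add[OF decaying_source decaying_source])
  show "green (source (k *\<^sub>R g)) = (\<lambda>x. k * green (source g) x)" for k g
    by (simp add: source_linear fun_eq_iff green_cmult[OF decaying_source])
qed

lemma bounded_linear_pairing: "bounded_linear pairing"
proof (rule bounded_linear_intro)
  note d = \<xi>_decaying[OF decaying_source]
  have pos: "3 / 2 * \<kappa> > 0" using \<kappa>_pos by simp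
  show "pairing (g + h) = pairing g + pairing h" for g h
    using half_line_integral_add[OF d d pos, of g h] by (simp add: pairing_def source_linear distrib_left)
  show "pairing (k *\<^sub>R g) = k *\<^sub>R pairing g" for k g
    using half_line_integral_cmult[OF d pos, of k g]
    by (simp add: pairing_def source_linear mult.left_commute)
  show "norm (pairing g) \<le> norm g * (C * (1 + C / \<kappa>\<^sup>2) / (3 / 2 * \<kappa>))" for g
    using half_line_integral_abs_le[OF d pos, of g] by (simp add: pairing_def field_simps)
qed

definition solve' :: "profile \<Rightarrow> real \<Rightarrow> real" where
  "solve' g = green' (source g)"

lemma fst_solve [simp]: "fst (solve g) = fst g / \<kappa>\<^sup>2"
  by (simp add: solve_def)

lemma decaying_part_solve:
  assumes "s = - 1 \<or> pairing g = 0"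
  shows "decaying_part (solve g) x = green (source g) x"
proof -
  have "decaying_part (solve g) x = green (source g) \<bar>x\<bar>"
    unfolding solve_def by (rule decaying_part_mk_profile[OF decaying_green[OF decaying_source]])
  also have "\<dots> = green (source g) x"
    using green_even[OF continuous_on_source, of g x] assms
    by (auto simp: abs_if pairing_def source_def U(2))
  finally show ?thesis .
qed

lemma solve_has_derivative:
  assumes "s = - 1 \<or> pairing g = 0"
  shows "(decaying_part (solve g) has_real_derivative solve' g x) (at x)"
    and "(solve' g has_real_derivative (\<kappa>\<^sup>2 - U x) * profile_fun (solve g) x - profile_fun g x) (at x)"
proof -
  have eq: "decaying_part (solve g) = green (source g)"
    using decaying_part_solve[OF assms] by blast
  show "(decaying_part (solve g) has_real_derivative solve' g x) (at x)"
    unfolding eq solve'_def by (rule green_has_derivative(1)[OF continuous_on_source])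
  have "(\<kappa>\<^sup>2 - U x) * green (source g) x - source g x =
      (\<kappa>\<^sup>2 - U x) * profile_fun (solve g) x - profile_fun g x"
    using \<kappa>_pos by (simp add: profile_fun_def eq source_def field_simps)
  then show "(solve' g has_real_derivative (\<kappa>\<^sup>2 - U x) * profile_fun (solve g) x - profile_fun g x) (at x)"
    unfolding solve'_def using green_has_derivative(2)[OF continuous_on_source, of g x] by simp
qed

lemma solve'_minus:
  assumes "s = - 1 \<or> pairing g = 0"
  shows "solve' g (- x) = - solve' g x"
proof -
  have "((\<lambda>x. decaying_part (solve g) (- x)) has_real_derivative - solve' g (- x)) (at x)"
    using DERIV_chain2[OF solve_has_derivative(1)[OF assms, of "- x"] DERIV_minus[OF DERIV_ident]] by simp
  then have "- solve' g (- x) = solve' g x"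
    using solve_has_derivative(1)[OF assms, of x] by (auto dest: DERIV_unique)
  then show ?thesis by simp
qed

text \<open>The second derivative is read off from the equation; its decay becomes visible once the
  constants cancel and \<open>source\<close> appears. Parity extends the half-line bounds to the
  whole line. Uniformity in g later makes the passage to \<open>H2\<close> bounded.\<close>

lemma solve_decay:
  "\<exists>B\<ge>0. \<forall>g. s = - 1 \<or> pairing g = 0 \<longrightarrow> (\<forall>x.
     \<bar>decaying_part (solve g) x\<bar> \<le> B * norm g * weight x \<and> \<bar>solve' g x\<bar> \<le> B * norm g * weight x \<and>
     \<bar>(\<kappa>\<^sup>2 - U x) * profile_fun (solve g) x - profile_fun g x\<bar> \<le> B * norm g * weight x)"
proof -
  define D where "D = 1 + C / \<kappa>\<^sup>2"
  define A where "A = 3 * C * C / \<kappa> * D"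
  define B where "B = A + (\<kappa>\<^sup>2 + C) * A + D"
  have pos: "A \<ge> 0" "D \<ge> 0" "(\<kappa>\<^sup>2 + C) * A \<ge> 0" using C_nonneg \<kappa>_pos by (auto simp: A_def D_def)
  then have "B \<ge> 0" by (simp add: B_def)
  moreover have "\<bar>decaying_part (solve g) x\<bar> \<le> B * norm g * weight x \<and> \<bar>solve' g x\<bar> \<le> B * norm g * weight x \<and>
     \<bar>(\<kappa>\<^sup>2 - U x) * profile_fun (solve g) x - profile_fun g x\<bar> \<le> B * norm g * weight x"
    if g: "s = - 1 \<or> pairing g = 0" for g x
  proof -
  have le: "a * norm g * weight x \<le> B * norm g * weight x" if "a \<le> B" for a
    using that by (intro mult_right_mono) auto
  have half: "\<bar>decaying_part (solve g) x\<bar> \<le> A * norm g * weight x" "\<bar>solve' g x\<bar> \<le> A * norm g * weight x"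
    if "x \<ge> 0" for x
    using green_abs_le[OF decaying_source[of g] that]
    by (simp_all add: decaying_part_solve[OF g] solve'_def A_def D_def mult.assoc)
  have 0: "\<bar>decaying_part (solve g) x\<bar> \<le> A * norm g * weight x"
    using half(1)[of "\<bar>x\<bar>"] by simp
  have 1: "\<bar>solve' g x\<bar> \<le> A * norm g * weight x"
    using half(2)[of x] half(2)[of "- x"] solve'_minus[OF g, of x] by (cases "x \<ge> 0") auto
  have U': "\<bar>U x\<bar> \<le> C"
  proof -
    have "\<bar>U \<bar>x\<bar>\<bar> \<le> C * weight x" using U(1) by (auto simp: decaying_iff dest: spec[of _ "\<bar>x\<bar>"])
    also have "\<dots> \<le> C * 1" by (intro mult_left_mono weight_le_1 C_nonneg)
    finally show ?thesis using U(2)[of x] by (simp add: abs_if split: if_splits)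
  qed
  have src: "\<bar>source g x\<bar> \<le> D * norm g * weight x"
  proof -
    have "\<bar>source g \<bar>x\<bar>\<bar> \<le> D * norm g * weight x"
      using decaying_source[of g] by (auto simp: decaying_iff D_def dest: spec[of _ "\<bar>x\<bar>"])
    then show ?thesis by (auto simp: source_def U(2) abs_if split: if_splits)
  qed
  have "\<bar>(\<kappa>\<^sup>2 - U x) * decaying_part (solve g) x - source g x\<bar> \<le>
      (\<kappa>\<^sup>2 + C) * (A * norm g * weight x) + D * norm g * weight x"
  proof -
    have "\<bar>\<kappa>\<^sup>2 - U x\<bar> \<le> \<kappa>\<^sup>2 + C"
      using U' abs_triangle_ineq4[of "\<kappa>\<^sup>2" "U x"] by simp
    then have "\<bar>(\<kappa>\<^sup>2 - U x) * decaying_part (solve g) x\<bar> \<le> (\<kappa>\<^sup>2 + C) * (A * norm g * weight x)"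
      unfolding abs_mult using 0 C_nonneg by (intro mult_mono) auto
    then show ?thesis using src abs_triangle_ineq4[of "(\<kappa>\<^sup>2 - U x) * decaying_part (solve g) x" "source g x"]
      by linarith
  qed
  also have "\<dots> = ((\<kappa>\<^sup>2 + C) * A + D) * norm g * weight x" by (simp add: algebra_simps)
  also have "(\<kappa>\<^sup>2 - U x) * decaying_part (solve g) x - source g x =
      (\<kappa>\<^sup>2 - U x) * profile_fun (solve g) x - profile_fun g x"
    using \<kappa>_pos by (simp add: profile_fun_def source_def field_simps)
  finally have 2: "\<bar>(\<kappa>\<^sup>2 - U x) * profile_fun (solve g) x - profile_fun g x\<bar> \<le>
    ((\<kappa>\<^sup>2 + C) * A + D) * norm g * weight x" .
  show ?thesis
    using pos by (intro conjI order_trans[OF 0 le] order_trans[OF 1 le] order_trans[OF 2 le]) (simp_all add: B_def)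
  qed
  ultimately show ?thesis by blast
qed

end

section \<open>The linearisation at the soliton\<close>

text \<open>With \<open>S = sech\<close>, \<open>T = tanh\<close>, \<open>K = cosh\<close> all derivatives below are polynomial in \<open>S, T, K\<close>
  modulo \<open>T\<^sup>2 = 1 - S\<^sup>2\<close> and \<open>S K = 1\<close>.\<close>

context decay_rate
begin

definition S :: "real \<Rightarrow> real" where "S x = inverse (cosh (\<kappa> * x))"
definition T :: "real \<Rightarrow> real" where "T x = tanh (\<kappa> * x)"
definition K :: "real \<Rightarrow> real" where "K x = cosh (\<kappa> * x)"

lemma STK: "T x * T x = 1 - S x * S x" "S x * K x = 1"
proof -
  have c: "cosh (\<kappa> * x) > 0" by (rule cosh_real_pos)
  then show "S x * K x = 1" by (simp add: S_def K_def)
  have "sinh (\<kappa> * x) ^ 2 = cosh (\<kappa> * x) ^ 2 - 1" by (rule sinh_square_eq)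
  then show "T x * T x = 1 - S x * S x"
    using c by (simp add: S_def T_def tanh_def field_simps power2_eq_square)
qed

lemma STK_derivatives:
  "(S has_real_derivative - \<kappa> * S x * T x) (at x)"
  "(T has_real_derivative \<kappa> * S x * S x) (at x)"
  "(K has_real_derivative \<kappa> * T x * K x) (at x)"
proof -
  have c: "cosh (\<kappa> * x) \<noteq> 0" by (metis cosh_real_pos less_irrefl)
  show "(S has_real_derivative - \<kappa> * S x * T x) (at x)"
    unfolding S_def [abs_def] T_def tanh_def
    using c by (auto intro!: derivative_eq_intros simp: field_simps)
  have "(T has_real_derivative (1 - T x * T x) * \<kappa>) (at x)"
    unfolding T_def [abs_def] using c
    by (auto intro!: derivative_eq_intros simp: power2_eq_square)
  then show "(T has_real_derivative \<kappa> * S x * S x) (at x)"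
    by (simp add: STK(1) mult_ac)
  show "(K has_real_derivative \<kappa> * T x * K x) (at x)"
    unfolding K_def [abs_def] T_def tanh_def
    using c by (auto intro!: derivative_eq_intros)
qed

lemma STK_minus: "S (- x) = S x" "T (- x) = - T x" "K (- x) = K x"
  by (simp_all add: S_def T_def K_def)

lemma STK_0: "S 0 = 1" "T 0 = 0"
  by (simp_all add: S_def T_def)

lemma S_pos: "S x > 0"
  by (simp add: S_def)

lemma S_le_1: "S x \<le> 1"
  using cosh_real_ge_1[of "\<kappa> * x"] by (simp add: S_def inverse_le_1_iff)

lemma T_bound: "\<bar>T x\<bar> \<le> 1"
  using tanh_real_bounds[of "\<kappa> * x"] by (simp add: T_def abs_le_iff)

lemma S_bound: "x \<ge> 0 \<Longrightarrow> S x \<le> 2 * exp (- \<kappa> * x)"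
proof -
  have "exp (\<kappa> * x) \<le> 2 * cosh (\<kappa> * x)" by (simp add: cosh_def)
  then show ?thesis
    by (simp add: S_def exp_minus field_simps)
qed

lemma K_bound: "x \<ge> 0 \<Longrightarrow> K x \<le> exp (\<kappa> * x)"
  using \<kappa>_pos by (auto simp: K_def cosh_def)

lemma K_pos: "K x > 0"
  by (simp add: K_def)

lemma linear_bound: "x \<ge> 0 \<Longrightarrow> \<bar>\<kappa> * x\<bar> \<le> exp (\<kappa> * x)"
proof -
  assume "x \<ge> 0"
  then have "\<kappa> * x \<ge> 0" using \<kappa>_pos by simp
  then show ?thesis using exp_ge_add_one_self[of "\<kappa> * x"] by linarith
qed

lemma exp_minus_le_weight: "x \<ge> 0 \<Longrightarrow> exp (- \<kappa> * x) \<le> weight x"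
  using \<kappa>_pos by (simp add: weight_def)

lemma continuous_on_S [continuous_intros]: "continuous_on A S"
  by (rule continuous_at_imp_continuous_on) (use STK_derivatives DERIV_isCont in blast)

lemma S_le_weight: "S x \<le> 2 * weight x"
proof -
  have "S \<bar>x\<bar> \<le> 2 * exp (- \<kappa> * \<bar>x\<bar>)" by (rule S_bound) simp
  also have "\<dots> \<le> 2 * weight \<bar>x\<bar>" by (intro mult_left_mono exp_minus_le_weight) auto
  finally show ?thesis by (auto simp: abs_if STK_minus split: if_splits)
qed

lemma decaying_S: "decaying 2 S"
  using S_le_weight S_pos by (auto simp: decaying_iff continuous_on_S abs_of_pos)

lemma decaying_S_power2: "decaying 2 (\<lambda>x. S x * S x)"
proof -
  have "\<bar>S x * S x\<bar> \<le> 2 * weight x" for x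
  proof -
    have "\<bar>S x * S x\<bar> \<le> S x * 1"
      using S_pos[of x] S_le_1[of x] by (simp add: abs_mult mult_left_le)
    then show ?thesis using S_le_weight[of x] by simp
  qed
  then show ?thesis by (auto simp: decaying_iff intro!: continuous_intros)
qed

lemma S_tendsto_0: "(S \<longlongrightarrow> 0) at_top"
proof -
  have "filterlim (\<lambda>x. cosh (\<kappa> * x)) at_top at_top"
    by (rule filterlim_compose[OF cosh_real_at_top
          filterlim_tendsto_pos_mult_at_top[OF tendsto_const \<kappa>_pos filterlim_ident]])
  then show ?thesis unfolding S_def [abs_def] by (rule tendsto_inverse_0_at_top)
qed

lemma T_tendsto_1: "(T \<longlongrightarrow> 1) at_top"
  unfolding T_def [abs_def]
  by (rule filterlim_compose[OF tanh_real_at_top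
        filterlim_tendsto_pos_mult_at_top[OF tendsto_const \<kappa>_pos filterlim_ident]])

text \<open>The Gudermannian function at scale \<kappa>, a primitive of sech (\<kappa> x). Its limit
  is the source of the factor pi in the bifurcation condition.\<close>

definition gd :: "real \<Rightarrow> real" where "gd x = arctan (sinh (\<kappa> * x)) / \<kappa>"

lemma gd: "(gd has_real_derivative S x) (at x)" "gd 0 = 0" "(gd \<longlongrightarrow> pi / (2 * \<kappa>)) at_top"
proof -
  have c: "cosh (\<kappa> * x) \<noteq> 0" by (metis cosh_real_pos less_irrefl)
  have "1 + sinh (\<kappa> * x) ^ 2 = cosh (\<kappa> * x) ^ 2" by (simp add: cosh_square_eq)
  then have "cosh (\<kappa> * x) / (1 + sinh (\<kappa> * x) ^ 2) = S x"
    using c by (simp add: S_def power2_eq_square divide_simps)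
  moreover have "(gd has_real_derivative cosh (\<kappa> * x) / (1 + sinh (\<kappa> * x) ^ 2)) (at x)"
  proof -
    have "1 + sinh (\<kappa> * x) ^ 2 \<noteq> 0" by (metis add_pos_nonneg less_irrefl zero_le_power2 zero_less_one)
    then show ?thesis
      unfolding gd_def [abs_def] using \<kappa>_pos
      by (auto intro!: derivative_eq_intros simp: divide_inverse)
  qed
  ultimately show "(gd has_real_derivative S x) (at x)" by simp
  show "gd 0 = 0" by (simp add: gd_def)
  have "((\<lambda>x. arctan (sinh (\<kappa> * x)) / \<kappa>) \<longlongrightarrow> (pi / 2) / \<kappa>) at_top"
    by (intro tendsto_divide filterlim_compose[OF tendsto_arctan_at_top]
        filterlim_compose[OF sinh_real_at_top]
        filterlim_tendsto_pos_mult_at_top[OF tendsto_const \<kappa>_pos filterlim_ident] tendsto_const)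
       (use \<kappa>_pos in auto)
  then show "(gd \<longlongrightarrow> pi / (2 * \<kappa>)) at_top" by (simp add: gd_def [abs_def])
qed

section \<open>Explicit fundamental systems for the two linearised operators\<close>

definition C\<^sub>0 :: real where "C\<^sub>0 = 10 + 2 * \<kappa> + 4 / \<kappa> + 24 * \<kappa>\<^sup>2"

text \<open>Each summand of \<open>C\<^sub>0\<close> covers one kind of bound: 10 + 2 \<kappa> the
  decaying solutions and the derivatives of the growing ones, 4 / \<kappa> the growing ones
  themselves, 24 \<kappa>^2 the potentials. One constant thus serves both operators.\<close>

lemma C\<^sub>0_ge: "a \<le> 10 \<or> a \<le> 10 + 2 * \<kappa> \<or> a \<le> 4 / \<kappa> \<or> a \<le> 24 * \<kappa>\<^sup>2 \<Longrightarrow> a \<le> C\<^sub>0"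
proof -
  have "4 / \<kappa> > 0" "\<kappa>\<^sup>2 > 0" using \<kappa>_pos by auto
  then show "a \<le> 10 \<or> a \<le> 10 + 2 * \<kappa> \<or> a \<le> 4 / \<kappa> \<or> a \<le> 24 * \<kappa>\<^sup>2 \<Longrightarrow> a \<le> C\<^sub>0"
    using \<kappa>_pos unfolding C\<^sub>0_def by linarith
qed

lemma bound_by_C\<^sub>0_decay: "\<bar>y\<bar> \<le> a * S x \<Longrightarrow> 2 * a \<le> C\<^sub>0 \<Longrightarrow> a \<ge> 0 \<Longrightarrow> x \<ge> 0 \<Longrightarrow> \<bar>y\<bar> \<le> C\<^sub>0 * exp (- \<kappa> * x)"
proof -
  assume y: "\<bar>y\<bar> \<le> a * S x" and a: "2 * a \<le> C\<^sub>0" "a \<ge> 0" and x: "x \<ge> 0"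
  have "\<bar>y\<bar> \<le> a * (2 * exp (- \<kappa> * x))"
    using y mult_left_mono[OF S_bound[OF x] a(2)] by linarith
  also have "\<dots> \<le> C\<^sub>0 * exp (- \<kappa> * x)"
    using mult_right_mono[OF a(1), of "exp (- \<kappa> * x)"] by simp
  finally show ?thesis .
qed

lemma bound_by_C\<^sub>0_growth:
  assumes "\<bar>y\<bar> \<le> a * exp (\<kappa> * x)" and "a \<le> C\<^sub>0"
  shows "\<bar>y\<bar> \<le> C\<^sub>0 * exp (\<kappa> * x)"
  by (rule order_trans[OF assms(1) mult_right_mono[OF assms(2)]]) simp

lemma decaying_potential:
  assumes "\<bar>a\<bar> \<le> 12"
  shows "decaying C\<^sub>0 (\<lambda>x. a * \<kappa>\<^sup>2 * (S x * S x))"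
proof -
  have "decaying (\<bar>a * \<kappa>\<^sup>2\<bar> * 2) (\<lambda>x. a * \<kappa>\<^sup>2 * (S x * S x))"
    by (rule exp_decaying_cmult[OF decaying_S_power2])
  moreover have "\<bar>a * \<kappa>\<^sup>2\<bar> * 2 \<le> C\<^sub>0"
    using mult_right_mono[OF assms, of "2 * \<kappa>\<^sup>2"] by (intro C\<^sub>0_ge) (simp add: abs_mult)
  ultimately show ?thesis by (rule exp_decaying_mono)
qed

text \<open>\<open>\<xi>\<^sub>p\<close> is a multiple of the derivative of the soliton, the
  translation mode; being odd, it does not obstruct \<open>Lp\<close> on even functions.
  \<open>\<eta>\<^sub>p\<close> comes from reduction of order, as \<open>\<xi>\<^sub>p\<close> times
  a primitive of its inverse square, whose pole at 0 cancels.\<close>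

definition "\<xi>\<^sub>p x = S x * T x"
definition "\<xi>\<^sub>p' x = \<kappa> * (S x * S x * S x - S x * T x * T x)"
definition "\<eta>\<^sub>p x = inverse \<kappa> * (- 3 / 2 * S x + 3 / 2 * (\<kappa> * x) * S x * T x + 1 / 2 * K x)"
definition "\<eta>\<^sub>p' x = 3 * S x * T x + 3 / 2 * (\<kappa> * x) * (S x * S x * S x - S x * T x * T x) + 1 / 2 * (T x * K x)"

text \<open>\<open>\<xi>\<^sub>m\<close> is a multiple of the soliton, the mode of phase rotation;
  it is even and therefore does obstruct. Reduction of order gives \<open>\<eta>\<^sub>m\<close> as
  \<open>S\<close> times the integral of the square of \<open>K\<close> from 0.\<close>

definition "\<xi>\<^sub>m x = S x"
definition "\<xi>\<^sub>m' x = - \<kappa> * S x * T x"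
definition "\<eta>\<^sub>m x = inverse (2 * \<kappa>) * (\<kappa> * x * S x + T x * K x)"
definition "\<eta>\<^sub>m' x = 1 / 2 * (S x - \<kappa> * x * S x * T x + K x)"

lemma S_cubed_bound: "\<bar>S x * S x * S x - S x * T x * T x\<bar> \<le> S x"
proof -
  have "S x * S x * S x - S x * T x * T x = S x * (2 * (S x * S x) - 1)"
    using STK(1)[of x] by algebra
  moreover have "\<bar>2 * (S x * S x) - 1\<bar> \<le> 1"
    using mult_mono[OF S_le_1 S_le_1, of x x] S_pos[of x] by (auto simp: abs_le_iff)
  ultimately show ?thesis using mult_left_mono[of "\<bar>2 * (S x * S x) - 1\<bar>" 1 "S x"] S_pos[of x]
    by (simp add: abs_mult)
qed

lemma ST_bound: "\<bar>S x * T x\<bar> \<le> S x"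
  using T_bound[of x] S_pos[of x] by (simp add: abs_mult mult_left_le)

lemma growth_bounds:
  assumes "x \<ge> 0"
  shows "\<And>y. \<bar>y\<bar> \<le> S x \<Longrightarrow> \<bar>\<kappa> * x * y\<bar> \<le> exp (\<kappa> * x)"
    and "\<bar>T x * K x\<bar> \<le> exp (\<kappa> * x)" and "\<bar>K x\<bar> \<le> exp (\<kappa> * x)"
    and "\<And>y. \<bar>y\<bar> \<le> S x \<Longrightarrow> \<bar>y\<bar> \<le> exp (\<kappa> * x)"
proof -
  show "\<bar>\<kappa> * x * y\<bar> \<le> exp (\<kappa> * x)" if "\<bar>y\<bar> \<le> S x" for y
  proof -
    have "\<bar>\<kappa> * x\<bar> * \<bar>y\<bar> \<le> exp (\<kappa> * x) * 1"
      using that S_le_1[of x] by (intro mult_mono linear_bound assms) auto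
    then show ?thesis by (simp add: abs_mult)
  qed
  show K: "\<bar>K x\<bar> \<le> exp (\<kappa> * x)" using K_bound[OF assms] K_pos[of x] by simp
  have "\<bar>T x\<bar> * \<bar>K x\<bar> \<le> 1 * exp (\<kappa> * x)" by (intro mult_mono T_bound K) auto
  then show "\<bar>T x * K x\<bar> \<le> exp (\<kappa> * x)" by (simp add: abs_mult)
  have "1 \<le> exp (\<kappa> * x)" using assms \<kappa>_pos by simp
  then show "\<bar>y\<bar> \<le> exp (\<kappa> * x)" if "\<bar>y\<bar> \<le> S x" for y using that S_le_1[of x] by linarith
qed

sublocale plus: green_function \<kappa> \<xi>\<^sub>p \<xi>\<^sub>p' \<eta>\<^sub>p \<eta>\<^sub>p' "\<lambda>x. 6 * \<kappa>\<^sup>2 * (S x * S x)" "- 1" C\<^sub>0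
proof
  note [derivative_intros] = STK_derivatives
  \<comment> \<open>\<open>algebra\<close> is left with polynomial relations in \<open>S\<close>,
    \<open>T\<close>, \<open>K\<close>; the one quotient is collected as this product and cancelled
    separately.\<close>
  have i: "\<kappa> * inverse \<kappa> = 1" using \<kappa>_pos by simp
  show "(\<xi>\<^sub>p has_real_derivative \<xi>\<^sub>p' x) (at x)" for x
    unfolding \<xi>\<^sub>p_def [abs_def] \<xi>\<^sub>p'_def
    by (rule derivative_eq_intros refl)+ (simp add: algebra_simps)
  show "(\<xi>\<^sub>p' has_real_derivative (\<kappa>\<^sup>2 - 6 * \<kappa>\<^sup>2 * (S x * S x)) * \<xi>\<^sub>p x) (at x)" for x
    unfolding \<xi>\<^sub>p_def \<xi>\<^sub>p'_def [abs_def]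
    by (rule derivative_eq_intros refl)+ (use STK(1)[of x] in algebra)
  show "(\<eta>\<^sub>p has_real_derivative \<eta>\<^sub>p' x) (at x)" for x
  proof -
    have "(\<eta>\<^sub>p has_real_derivative inverse \<kappa> * (\<kappa> * \<eta>\<^sub>p' x)) (at x)"
      unfolding \<eta>\<^sub>p_def [abs_def] \<eta>\<^sub>p'_def
      by (rule derivative_eq_intros refl)+ (simp add: algebra_simps)
    moreover have "inverse \<kappa> * (\<kappa> * \<eta>\<^sub>p' x) = \<eta>\<^sub>p' x" using \<kappa>_pos by simp
    ultimately show ?thesis by (simp only:)
  qed
  show "(\<eta>\<^sub>p' has_real_derivative (\<kappa>\<^sup>2 - 6 * \<kappa>\<^sup>2 * (S x * S x)) * \<eta>\<^sub>p x) (at x)" for x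
  proof -
    have "(\<kappa>\<^sup>2 - 6 * \<kappa>\<^sup>2 * (S x * S x)) * \<eta>\<^sub>p x =
        (\<kappa> * inverse \<kappa>) * ((1 - 6 * (S x * S x)) * (\<kappa> * (- 3 / 2 * S x + 3 / 2 * (\<kappa> * x) * S x * T x + 1 / 2 * K x)))"
      by (simp add: \<eta>\<^sub>p_def power2_eq_square algebra_simps)
    also have "\<dots> = (1 - 6 * (S x * S x)) * (\<kappa> * (- 3 / 2 * S x + 3 / 2 * (\<kappa> * x) * S x * T x + 1 / 2 * K x))"
      using i by simp
    finally show ?thesis
      unfolding \<eta>\<^sub>p'_def [abs_def]
      by - (rule DERIV_cong, (rule derivative_eq_intros refl)+, use STK[of x] in algebra)
  qed
  show "\<xi>\<^sub>p x * \<eta>\<^sub>p' x - \<xi>\<^sub>p' x * \<eta>\<^sub>p x = 1" for x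
  proof -
    have "\<xi>\<^sub>p' x * \<eta>\<^sub>p x = (\<kappa> * inverse \<kappa>) * ((S x * S x * S x - S x * T x * T x) *
        (- 3 / 2 * S x + 3 / 2 * (\<kappa> * x) * S x * T x + 1 / 2 * K x))"
      by (simp add: \<xi>\<^sub>p'_def \<eta>\<^sub>p_def algebra_simps)
    also have "\<dots> = (S x * S x * S x - S x * T x * T x) *
        (- 3 / 2 * S x + 3 / 2 * (\<kappa> * x) * S x * T x + 1 / 2 * K x)"
      using i by simp
    finally show ?thesis
      unfolding \<xi>\<^sub>p_def \<eta>\<^sub>p'_def using STK[of x] by algebra
  qed
  fix x :: real
  show "6 * \<kappa>\<^sup>2 * (S (- x) * S (- x)) = 6 * \<kappa>\<^sup>2 * (S x * S x)" "\<xi>\<^sub>p (- x) = - 1 * \<xi>\<^sub>p x" "\<eta>\<^sub>p (- x) = - (- 1) * \<eta>\<^sub>p x"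
    by (simp_all add: \<xi>\<^sub>p_def \<eta>\<^sub>p_def STK_minus)
  assume x: "x \<ge> 0"
  show "\<bar>\<xi>\<^sub>p x\<bar> \<le> C\<^sub>0 * exp (- \<kappa> * x)"
    by (rule bound_by_C\<^sub>0_decay[where a = 1]) (use ST_bound x in \<open>auto simp: \<xi>\<^sub>p_def intro: C\<^sub>0_ge\<close>)
  show "\<bar>\<xi>\<^sub>p' x\<bar> \<le> C\<^sub>0 * exp (- \<kappa> * x)"
    by (rule bound_by_C\<^sub>0_decay[where a = \<kappa>])
       (use S_cubed_bound x \<kappa>_pos in \<open>auto simp: \<xi>\<^sub>p'_def abs_mult intro: C\<^sub>0_ge\<close>)
  note g = growth_bounds[OF x]
  show "\<bar>\<eta>\<^sub>p x\<bar> \<le> C\<^sub>0 * exp (\<kappa> * x)"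
  proof (rule bound_by_C\<^sub>0_growth)
    have "\<bar>- 3 / 2 * S x + 3 / 2 * (\<kappa> * x) * S x * T x + 1 / 2 * K x\<bar> \<le> 4 * exp (\<kappa> * x)"
      using g(1)[OF ST_bound] g(4)[of "S x"] g(3) S_pos[of x] by (simp add: abs_le_iff mult.assoc)
    then have "inverse \<kappa> * \<bar>- 3 / 2 * S x + 3 / 2 * (\<kappa> * x) * S x * T x + 1 / 2 * K x\<bar> \<le>
        inverse \<kappa> * (4 * exp (\<kappa> * x))"
      using \<kappa>_pos by (intro mult_left_mono) auto
    moreover have "\<bar>inverse \<kappa>\<bar> = inverse \<kappa>" using \<kappa>_pos by simp
    moreover have "inverse \<kappa> * (4 * exp (\<kappa> * x)) = 4 / \<kappa> * exp (\<kappa> * x)" by (simp add: field_simps)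
    ultimately show "\<bar>\<eta>\<^sub>p x\<bar> \<le> 4 / \<kappa> * exp (\<kappa> * x)"
      unfolding \<eta>\<^sub>p_def abs_mult[of "inverse \<kappa>"] by (simp only:)
  qed (auto intro: C\<^sub>0_ge)
  show "\<bar>\<eta>\<^sub>p' x\<bar> \<le> C\<^sub>0 * exp (\<kappa> * x)"
  proof (rule bound_by_C\<^sub>0_growth)
    show "\<bar>\<eta>\<^sub>p' x\<bar> \<le> 5 * exp (\<kappa> * x)"
      using g(1)[OF S_cubed_bound] g(4)[OF ST_bound] g(2)
      by (simp add: \<eta>\<^sub>p'_def abs_le_iff mult.assoc)
  qed (auto intro: C\<^sub>0_ge)
qed (auto intro!: decaying_potential)

sublocale minus: green_function \<kappa> \<xi>\<^sub>m \<xi>\<^sub>m' \<eta>\<^sub>m \<eta>\<^sub>m' "\<lambda>x. 2 * \<kappa>\<^sup>2 * (S x * S x)" 1 C\<^sub>0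
proof
  note [derivative_intros] = STK_derivatives
  have i: "\<kappa> * inverse (2 * \<kappa>) = 1 / 2" using \<kappa>_pos by simp
  show "(\<xi>\<^sub>m has_real_derivative \<xi>\<^sub>m' x) (at x)" for x
    unfolding \<xi>\<^sub>m_def [abs_def] \<xi>\<^sub>m'_def
    by (rule derivative_eq_intros refl)+
  show "(\<xi>\<^sub>m' has_real_derivative (\<kappa>\<^sup>2 - 2 * \<kappa>\<^sup>2 * (S x * S x)) * \<xi>\<^sub>m x) (at x)" for x
    unfolding \<xi>\<^sub>m_def \<xi>\<^sub>m'_def [abs_def]
    by (rule derivative_eq_intros refl)+ (use STK(1)[of x] in algebra)
  show "(\<eta>\<^sub>m has_real_derivative \<eta>\<^sub>m' x) (at x)" for x
  proof -
    have "(\<eta>\<^sub>m has_real_derivative inverse (2 * \<kappa>) * (2 * \<kappa> * \<eta>\<^sub>m' x)) (at x)"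
      unfolding \<eta>\<^sub>m_def [abs_def] \<eta>\<^sub>m'_def
      by (rule derivative_eq_intros refl)+ (use STK[of x] in algebra)
    moreover have "inverse (2 * \<kappa>) * (2 * \<kappa> * \<eta>\<^sub>m' x) = \<eta>\<^sub>m' x" using \<kappa>_pos by simp
    ultimately show ?thesis by (simp only:)
  qed
  show "(\<eta>\<^sub>m' has_real_derivative (\<kappa>\<^sup>2 - 2 * \<kappa>\<^sup>2 * (S x * S x)) * \<eta>\<^sub>m x) (at x)" for x
  proof -
    have "(\<kappa>\<^sup>2 - 2 * \<kappa>\<^sup>2 * (S x * S x)) * \<eta>\<^sub>m x =
        (\<kappa> * inverse (2 * \<kappa>)) * ((1 - 2 * (S x * S x)) * (\<kappa> * (\<kappa> * x * S x + T x * K x)))"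
      by (simp add: \<eta>\<^sub>m_def power2_eq_square algebra_simps)
    also have "\<dots> = 1 / 2 * ((1 - 2 * (S x * S x)) * (\<kappa> * (\<kappa> * x * S x + T x * K x)))"
      using i by simp
    finally show ?thesis
      unfolding \<eta>\<^sub>m'_def [abs_def]
      by - (rule DERIV_cong, (rule derivative_eq_intros refl)+, use STK[of x] in algebra)
  qed
  show "\<xi>\<^sub>m x * \<eta>\<^sub>m' x - \<xi>\<^sub>m' x * \<eta>\<^sub>m x = 1" for x
  proof -
    have "\<xi>\<^sub>m' x * \<eta>\<^sub>m x = (\<kappa> * inverse (2 * \<kappa>)) * (- S x * T x * (\<kappa> * x * S x + T x * K x))"
      by (simp add: \<xi>\<^sub>m'_def \<eta>\<^sub>m_def algebra_simps)
    also have "\<dots> = 1 / 2 * (- S x * T x * (\<kappa> * x * S x + T x * K x))"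
      using i by simp
    finally show ?thesis
      unfolding \<xi>\<^sub>m_def \<eta>\<^sub>m'_def using STK[of x] by algebra
  qed
  fix x :: real
  show "2 * \<kappa>\<^sup>2 * (S (- x) * S (- x)) = 2 * \<kappa>\<^sup>2 * (S x * S x)" "\<xi>\<^sub>m (- x) = 1 * \<xi>\<^sub>m x" "\<eta>\<^sub>m (- x) = - 1 * \<eta>\<^sub>m x"
    by (simp_all add: \<xi>\<^sub>m_def \<eta>\<^sub>m_def STK_minus algebra_simps)
  assume x: "x \<ge> 0"
  show "\<bar>\<xi>\<^sub>m x\<bar> \<le> C\<^sub>0 * exp (- \<kappa> * x)"
    by (rule bound_by_C\<^sub>0_decay[where a = 1]) (use S_pos[of x] x in \<open>auto simp: \<xi>\<^sub>m_def intro: C\<^sub>0_ge\<close>)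
  show "\<bar>\<xi>\<^sub>m' x\<bar> \<le> C\<^sub>0 * exp (- \<kappa> * x)"
    by (rule bound_by_C\<^sub>0_decay[where a = \<kappa>])
       (use ST_bound x \<kappa>_pos in \<open>auto simp: \<xi>\<^sub>m'_def abs_mult mult.assoc intro: C\<^sub>0_ge\<close>)
  note g = growth_bounds[OF x]
  show "\<bar>\<eta>\<^sub>m x\<bar> \<le> C\<^sub>0 * exp (\<kappa> * x)"
  proof (rule bound_by_C\<^sub>0_growth)
    have "\<bar>\<kappa> * x * S x + T x * K x\<bar> \<le> 2 * exp (\<kappa> * x)"
      using g(1)[of "S x"] g(2) S_pos[of x] by (simp add: abs_le_iff)
    then have "inverse (2 * \<kappa>) * \<bar>\<kappa> * x * S x + T x * K x\<bar> \<le> inverse (2 * \<kappa>) * (2 * exp (\<kappa> * x))"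
      using \<kappa>_pos by (intro mult_left_mono) auto
    moreover have "\<bar>inverse (2 * \<kappa>)\<bar> = inverse (2 * \<kappa>)" using \<kappa>_pos by simp
    moreover have "inverse (2 * \<kappa>) * (2 * exp (\<kappa> * x)) = 1 / \<kappa> * exp (\<kappa> * x)" by (simp add: field_simps)
    ultimately show "\<bar>\<eta>\<^sub>m x\<bar> \<le> 1 / \<kappa> * exp (\<kappa> * x)"
      unfolding \<eta>\<^sub>m_def abs_mult[of "inverse (2 * \<kappa>)"] by (simp only:)
    show "1 / \<kappa> \<le> C\<^sub>0" by (rule C\<^sub>0_ge) (use \<kappa>_pos in \<open>simp add: divide_right_mono\<close>)
  qed
  show "\<bar>\<eta>\<^sub>m' x\<bar> \<le> C\<^sub>0 * exp (\<kappa> * x)"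
  proof (rule bound_by_C\<^sub>0_growth)
    show "\<bar>\<eta>\<^sub>m' x\<bar> \<le> 2 * exp (\<kappa> * x)"
      using g(1)[OF ST_bound] g(4)[of "S x"] g(3) S_pos[of x]
      by (simp add: \<eta>\<^sub>m'_def abs_le_iff mult.assoc)
  qed (auto intro: C\<^sub>0_ge)
qed (auto intro!: decaying_potential)

section \<open>Solvability integrals\<close>

definition one :: profile where "one = (1, 0)"

definition amplitude :: profile where "amplitude = mk_profile 0 (\<lambda>x. sqrt 2 * \<kappa> * S x)"

lemma one_simps [simp]: "fst one = 1" "decaying_part one x = 0" "profile_fun one x = 1"
  by (simp_all add: one_def decaying_part_def profile_fun_def)

lemma amplitude_simps [simp]:
  "fst amplitude = 0" "decaying_part amplitude x = sqrt 2 * \<kappa> * S x" "profile_fun amplitude x = sqrt 2 * \<kappa> * S x"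
proof -
  show "fst amplitude = 0" by (simp add: amplitude_def)
  show *: "decaying_part amplitude x = sqrt 2 * \<kappa> * S x"
    unfolding amplitude_def decaying_part_mk_profile[OF exp_decaying_cmult[OF decaying_S]]
    by (simp add: abs_if STK_minus)
  show "profile_fun amplitude x = sqrt 2 * \<kappa> * S x"
    using * by (simp add: profile_fun_def amplitude_def)
qed

lemma pairing_eqI:
  assumes "\<And>x. (F has_real_derivative S x * minus.source g x) (at x)" and "F 0 = 0" and "(F \<longlongrightarrow> L) at_top"
  shows "minus.pairing g = L"
  unfolding minus.pairing_def
proof (rule half_line_integral_eqI[OF minus.\<xi>_decaying[OF minus.decaying_source] _ _ assms(2,3)])
  show "(F has_real_derivative \<xi>\<^sub>m x * minus.source g x) (at x)" for x
    using assms(1) by (simp add: \<xi>\<^sub>m_def)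
qed (use \<kappa>_pos in simp)

text \<open>The value is the half-line integral of sech (\<kappa> x), although \<open>source\<close>
  replaces 1 by 2 S^2: the derivative of S T / \<kappa> is 2 S^3 - S, and S T vanishes at both
  ends.\<close>

lemma pairing_one: "minus.pairing one = pi / (2 * \<kappa>)"
proof (rule pairing_eqI)
  note [derivative_intros] = STK_derivatives gd(1)
  have i: "inverse \<kappa> * \<kappa> = 1" using \<kappa>_pos by simp
  show "((\<lambda>x. inverse \<kappa> * (S x * T x) + gd x) has_real_derivative S x * minus.source one x) (at x)" for x
  proof (rule DERIV_cong)
    show "((\<lambda>x. inverse \<kappa> * (S x * T x) + gd x) has_real_derivative
        inverse \<kappa> * (\<kappa> * (S x * S x * S x - S x * T x * T x)) + S x) (at x)"
      by (rule derivative_eq_intros refl)+ (simp add: algebra_simps)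
    have "inverse \<kappa> * (\<kappa> * (S x * S x * S x - S x * T x * T x)) = S x * S x * S x - S x * T x * T x"
      using \<kappa>_pos by simp
    moreover have "minus.source one x = 2 * (S x * S x)"
      using \<kappa>_pos by (simp add: minus.source_def)
    moreover have "S x * S x * S x - S x * T x * T x + S x = S x * (2 * (S x * S x))"
      using STK(1)[of x] by algebra
    ultimately show "inverse \<kappa> * (\<kappa> * (S x * S x * S x - S x * T x * T x)) + S x = S x * minus.source one x"
      by (simp only:)
  qed
  have "((\<lambda>x. inverse \<kappa> * (S x * T x) + gd x) \<longlongrightarrow> inverse \<kappa> * (0 * 1) + pi / (2 * \<kappa>)) at_top"
    by (intro tendsto_intros S_tendsto_0 T_tendsto_1 gd)
  then show "((\<lambda>x. inverse \<kappa> * (S x * T x) + gd x) \<longlongrightarrow> pi / (2 * \<kappa>)) at_top" by simp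
qed (simp add: STK_0 gd)

text \<open>Together with \<open>pairing_one\<close> this turns orthogonality of \<phi> - f p to the
  kernel into f p pi = 2 sqrt 2 \<kappa>.\<close>

lemma pairing_amplitude: "minus.pairing amplitude = sqrt 2"
proof (rule pairing_eqI)
  show "((\<lambda>x. sqrt 2 * T x) has_real_derivative S x * minus.source amplitude x) (at x)" for x
  proof (rule DERIV_cong[OF DERIV_cmult[OF STK_derivatives(2)]])
    show "sqrt 2 * (\<kappa> * S x * S x) = S x * minus.source amplitude x"
      by (simp add: minus.source_def)
  qed
  show "((\<lambda>x. sqrt 2 * T x) \<longlongrightarrow> sqrt 2) at_top"
    using tendsto_mult_left[OF T_tendsto_1, of "sqrt 2"] by simp
qed (simp add: STK_0)

text \<open>Green's identity for \<open>y\<close> with \<open>L\<^sub>+ y = 1\<close> and \<open>L\<^sub>+ \<phi> = - 2 \<phi>\<^sup>3\<close> gives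
  \<open>2 \<integral> \<phi>\<^sup>3 y = - \<integral> \<phi>\<close>, so no explicit formula for \<open>y\<close> is needed.\<close>

lemma pairing_solve_one:
  "minus.pairing (amplitude \<odot> (amplitude \<odot> plus.solve one)) = - pi / (4 * \<kappa>)"
proof (rule pairing_eqI)
  define y where "y = profile_fun (plus.solve one)"
  define y' where "y' = plus.solve' one"
  have y: "(y has_real_derivative y' x) (at x)" for x
    using DERIV_add[OF DERIV_const[of "fst (plus.solve one)"] plus.solve_has_derivative(1)[of one x]]
    by (simp add: y_def y'_def profile_fun_def [abs_def])
  have y': "(y' has_real_derivative (\<kappa>\<^sup>2 - 6 * \<kappa>\<^sup>2 * (S x * S x)) * y x - 1) (at x)" for x
    using plus.solve_has_derivative(2)[of one x] by (simp add: y_def y'_def)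
  \<comment> \<open>The Wronskian of \<open>S\<close> and y. Its derivative contains both
    integrands, \<open>S\<close> and S^3 y; it vanishes at 0 because both functions are even, and at
    infinity because \<open>S\<close> decays while y and y' stay bounded.\<close>
  define W where "W x = S x * y' x + \<kappa> * (S x * T x) * y x" for x
  note [derivative_intros] = STK_derivatives gd(1) y y'
  have W: "(W has_real_derivative - S x - 4 * \<kappa>\<^sup>2 * (S x * S x * S x) * y x) (at x)" for x
    unfolding W_def [abs_def]
    by (rule derivative_eq_intros refl)+ (use STK(1)[of x] in algebra)
  show "((\<lambda>x. - (1 / 2) * (W x + gd x)) has_real_derivative
      S x * minus.source (amplitude \<odot> (amplitude \<odot> plus.solve one)) x) (at x)" for x
  proof (rule DERIV_cong)
    show "((\<lambda>x. - (1 / 2) * (W x + gd x)) has_real_derivative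
        2 * \<kappa>\<^sup>2 * (S x * S x * S x) * y x) (at x)"
      by (rule derivative_eq_intros W refl)+ (simp add: algebra_simps)
    have "minus.source (amplitude \<odot> (amplitude \<odot> plus.solve one)) x =
        profile_fun (amplitude \<odot> (amplitude \<odot> plus.solve one)) x"
      by (simp add: minus.source_def profile_fun_def del: profile_fun_mult)
    also have "\<dots> = 2 * \<kappa>\<^sup>2 * (S x * S x) * y x"
      by (simp add: y_def power2_eq_square algebra_simps)
    finally show "2 * \<kappa>\<^sup>2 * (S x * S x * S x) * y x =
        S x * minus.source (amplitude \<odot> (amplitude \<odot> plus.solve one)) x" by simp
  qed
  have "y' 0 = 0" using plus.solve'_minus[of one 0] by (simp add: y'_def)
  then show "- (1 / 2) * (W 0 + gd 0) = 0" by (simp add: W_def STK_0 gd)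
  have "(W \<longlongrightarrow> 0) at_top"
  proof -
    obtain B where B: "B \<ge> 0" "\<And>x. \<bar>decaying_part (plus.solve one) x\<bar> \<le> B * norm one * weight x"
      "\<And>x. \<bar>y' x\<bar> \<le> B * norm one * weight x"
      using plus.solve_decay unfolding y'_def by blast
    have le: "B * norm one * weight x \<le> B * norm one" for x
      using B(1) weight_le_1[of x] by (intro mult_left_le) auto
    define A where "A = B * norm one + \<kappa> * (\<bar>fst (plus.solve one)\<bar> + B * norm one)"
    have "\<bar>W x\<bar> \<le> S x * A" for x
    proof -
      have y_le: "\<bar>y x\<bar> \<le> \<bar>fst (plus.solve one)\<bar> + B * norm one"
        unfolding y_def profile_fun_def using B(2)[of x] le[of x] by linarith
      have y'_le: "\<bar>y' x\<bar> \<le> B * norm one" using B(3)[of x] le[of x] by linarith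
      have "\<bar>S x * y' x\<bar> \<le> S x * (B * norm one)"
        using S_pos[of x] y'_le by (simp add: abs_mult mult_left_mono)
      moreover have "\<bar>\<kappa> * (S x * T x) * y x\<bar> \<le> (\<kappa> * S x) * (\<bar>fst (plus.solve one)\<bar> + B * norm one)"
        unfolding abs_mult[of "\<kappa> * (S x * T x)"] using ST_bound[of x] \<kappa>_pos S_pos[of x]
        by (intro mult_mono y_le) (auto simp: abs_mult)
      ultimately show ?thesis
        unfolding W_def A_def by (simp add: algebra_simps abs_le_iff)
    qed
    moreover have "((\<lambda>x. S x * A) \<longlongrightarrow> 0) at_top"
      using tendsto_mult_right[OF S_tendsto_0, of A] by simp
    ultimately show ?thesis
      by (intro Lim_null_comparison[of W "\<lambda>x. S x * A"]) auto
  qed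
  then have "((\<lambda>x. - (1 / 2) * (W x + gd x)) \<longlongrightarrow> - (1 / 2) * (0 + pi / (2 * \<kappa>))) at_top"
    by (intro tendsto_intros gd)
  then show "((\<lambda>x. - (1 / 2) * (W x + gd x)) \<longlongrightarrow> - pi / (4 * \<kappa>)) at_top"
    by (simp add: mult.commute)
qed

end

section \<open>The bifurcation equations\<close>

lemma bounded_bilinear_zero: "bounded_bilinear (\<lambda>x y. 0)"
  by unfold_locales (auto intro: exI[of _ 0])

context decay_rate
begin

text \<open>Inverses of \<open>L\<^sub>+\<close> and \<open>L\<^sub>-\<close>, the latter after subtracting the multiple of 1 that makes the source
  orthogonal to the kernel.\<close>

definition Lp :: "profile \<Rightarrow> profile" where
  "Lp = plus.solve"

definition orth :: "profile \<Rightarrow> profile" where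
  "orth g = g - (minus.pairing g / minus.pairing one) *\<^sub>R one"

definition Lm :: "profile \<Rightarrow> profile" where
  "Lm g = minus.solve (orth g)"

interpretation pairing: bounded_linear minus.pairing by (rule minus.bounded_linear_pairing)

lemma pairing_one_pos: "minus.pairing one > 0"
  using \<kappa>_pos by (simp add: pairing_one)

lemma pairing_orth [simp]: "minus.pairing (orth g) = 0"
  using pairing_one_pos by (simp add: orth_def pairing.diff pairing.scaleR)

lemma orth_id: "minus.pairing g = 0 \<Longrightarrow> orth g = g"
  by (simp add: orth_def)

lemma bounded_linear_Lp: "bounded_linear Lp"
  unfolding Lp_def by (rule plus.bounded_linear_solve)

lemma bounded_linear_orth: "bounded_linear orth"
  unfolding orth_def [abs_def]
  by (intro bounded_linear_sub bounded_linear_ident bounded_linear_scaleR_left[THEN bounded_linear_compose]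
      bounded_linear_divide[THEN bounded_linear_compose] minus.bounded_linear_pairing)

lemma bounded_linear_Lm: "bounded_linear Lm"
  unfolding Lm_def [abs_def]
  by (rule bounded_linear_compose[OF minus.bounded_linear_solve bounded_linear_orth])

end

type_synonym branch_state =
  "real \<times> profile \<times> profile \<times> real \<times> profile \<times> profile \<times> profile \<times> real"

text \<open>The components of a state are \<open>\<epsilon>\<close>, the sources of \<open>\<epsilon> \<alpha>\<close> and of the part of \<open>\<epsilon> \<beta>\<close> without kernel component, the kernel coefficient of
  \<open>\<epsilon> \<beta>\<close>, \<open>\<mu> = \<epsilon> (\<alpha>\<^sup>2 + \<beta>\<^sup>2)\<close>, and the deviations of the sources of \<open>\<alpha>\<close>, \<open>\<beta>\<close> and of the kernel coefficient
  from their values at \<open>\<epsilon> = 0\<close>. In these unknowns the problem is quadratic.\<close>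

locale bifurcation = decay_rate +
  fixes f p q :: real
  assumes p: "f * p * pi = 2 * sqrt 2 * \<kappa>" and q: "f * q \<noteq> 0"
begin

definition h\<^sub>1 :: "branch_state \<Rightarrow> profile" where "h\<^sub>1 Z = fst (snd Z)"
definition h\<^sub>2 :: "branch_state \<Rightarrow> profile" where "h\<^sub>2 Z = fst (snd (snd Z))"
definition \<sigma> :: "branch_state \<Rightarrow> real" where "\<sigma> Z = fst (snd (snd (snd Z)))"
definition \<mu> :: "branch_state \<Rightarrow> profile" where "\<mu> Z = fst (snd (snd (snd (snd Z))))"
definition w\<^sub>1 :: "branch_state \<Rightarrow> profile" where "w\<^sub>1 Z = fst (snd (snd (snd (snd (snd Z)))))"
definition w\<^sub>2 :: "branch_state \<Rightarrow> profile" where "w\<^sub>2 Z = fst (snd (snd (snd (snd (snd (snd Z))))))"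
definition s :: "branch_state \<Rightarrow> real" where "s Z = snd (snd (snd (snd (snd (snd (snd Z))))))"

definition "g\<^sub>1 Z = Lp (h\<^sub>1 Z)"
definition "g\<^sub>2 Z = Lm (h\<^sub>2 Z) + \<sigma> Z *\<^sub>R amplitude"
definition "a Z = Lp (w\<^sub>1 Z)"
definition "b Z = Lm (w\<^sub>2 Z) + s Z *\<^sub>R amplitude"

text \<open>Data at \<epsilon> = 0: the sources of \<alpha> and \<beta> and the solutions belonging
  to them. \<open>D\<close> is the factor of the kernel coefficient in the next-order condition that
  2 \<phi> \<alpha> \<beta> + \<alpha> pairs to 0, and \<open>t\<^sub>0\<close> is the root of that
  affine condition.\<close>

definition "\<omega>\<^sub>1 = (f * q) *\<^sub>R one"
definition "\<omega>\<^sub>2 = amplitude - (f * p) *\<^sub>R one"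
definition "\<alpha>\<^sub>0 = Lp \<omega>\<^sub>1"
definition "D = 2 * minus.pairing (amplitude \<odot> (\<alpha>\<^sub>0 \<odot> amplitude))"
definition "t\<^sub>0 = - inverse D * minus.pairing (2 *\<^sub>R (amplitude \<odot> (\<alpha>\<^sub>0 \<odot> Lm \<omega>\<^sub>2)) + \<alpha>\<^sub>0)"
definition "\<beta>\<^sub>0 = Lm \<omega>\<^sub>2 + t\<^sub>0 *\<^sub>R amplitude"

text \<open>Products with one factor frozen at its value for \<epsilon> = 0 go here, products of two
  unknowns into \<open>B\<close>. The last slot is the solvability condition solved for
  \<open>s\<close>, hence the division by \<open>D\<close>.\<close>

definition N :: "branch_state \<Rightarrow> branch_state" where
  "N Z = (0, fst Z *\<^sub>R \<omega>\<^sub>1, fst Z *\<^sub>R \<omega>\<^sub>2, fst Z *\<^sub>R t\<^sub>0,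
     g\<^sub>1 Z \<odot> \<alpha>\<^sub>0 + g\<^sub>2 Z \<odot> \<beta>\<^sub>0,
     3 *\<^sub>R (amplitude \<odot> (g\<^sub>1 Z \<odot> \<alpha>\<^sub>0)) + amplitude \<odot> (g\<^sub>2 Z \<odot> \<beta>\<^sub>0) - g\<^sub>2 Z,
     2 *\<^sub>R (amplitude \<odot> (g\<^sub>1 Z \<odot> \<beta>\<^sub>0)) + g\<^sub>1 Z,
     (- inverse D) *\<^sub>R minus.pairing (2 *\<^sub>R (amplitude \<odot> (\<alpha>\<^sub>0 \<odot> Lm (w\<^sub>2 Z)))
       + 2 *\<^sub>R (amplitude \<odot> (a Z \<odot> \<beta>\<^sub>0)) + \<mu> Z \<odot> \<beta>\<^sub>0 + a Z))"

definition B :: "branch_state \<Rightarrow> branch_state \<Rightarrow> branch_state" where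
  "B Y Z = (0, fst Y *\<^sub>R w\<^sub>1 Z, fst Y *\<^sub>R w\<^sub>2 Z, fst Y *\<^sub>R s Z,
     g\<^sub>1 Y \<odot> a Z + g\<^sub>2 Y \<odot> b Z,
     3 *\<^sub>R (amplitude \<odot> (g\<^sub>1 Y \<odot> a Z)) + amplitude \<odot> (g\<^sub>2 Y \<odot> b Z) + \<mu> Y \<odot> g\<^sub>1 Z,
     2 *\<^sub>R (amplitude \<odot> (g\<^sub>1 Y \<odot> b Z)) + \<mu> Y \<odot> g\<^sub>2 Z,
     (- inverse D) *\<^sub>R minus.pairing (2 *\<^sub>R (amplitude \<odot> (a Y \<odot> b Z)) + \<mu> Y \<odot> b Z))"

interpretation pairing: bounded_linear minus.pairing by (rule minus.bounded_linear_pairing)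
interpretation Lp: bounded_linear Lp by (rule bounded_linear_Lp)
interpretation Lm: bounded_linear Lm by (rule bounded_linear_Lm)
interpretation mult: bounded_bilinear "(\<odot>)" by (rule bounded_bilinear_profile_mult)

lemma bounded_linear_components:
  "bounded_linear h\<^sub>1" "bounded_linear h\<^sub>2" "bounded_linear \<sigma>" "bounded_linear \<mu>"
  "bounded_linear w\<^sub>1" "bounded_linear w\<^sub>2" "bounded_linear s"
  unfolding h\<^sub>1_def [abs_def] h\<^sub>2_def [abs_def] \<sigma>_def [abs_def] \<mu>_def [abs_def] w\<^sub>1_def [abs_def]
    w\<^sub>2_def [abs_def] s_def [abs_def]
  by (intro bounded_linear_fst_comp bounded_linear_snd_comp bounded_linear_ident)+

lemma bounded_linear_derived:
  "bounded_linear g\<^sub>1" "bounded_linear g\<^sub>2" "bounded_linear a" "bounded_linear b"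
  unfolding g\<^sub>1_def [abs_def] g\<^sub>2_def [abs_def] a_def [abs_def] b_def [abs_def]
  by (intro bounded_linear_add bounded_linear_compose[OF bounded_linear_Lp]
      bounded_linear_compose[OF bounded_linear_Lm] bounded_linear_compose[OF bounded_linear_scaleR_left]
      bounded_linear_components)+

lemma bounded_linear_N: "bounded_linear N"
  unfolding N_def [abs_def]
  by (intro bounded_linear_Pair bounded_linear_zero bounded_linear_add bounded_linear_sub
      bounded_linear_compose[OF bounded_linear_scaleR_left] bounded_linear_compose[OF bounded_linear_scaleR_right]
      bounded_linear_compose[OF mult.bounded_linear_left] bounded_linear_compose[OF mult.bounded_linear_right]
      bounded_linear_compose[OF minus.bounded_linear_pairing] bounded_linear_compose[OF bounded_linear_Lm]
      bounded_linear_components bounded_linear_derived bounded_linear_fst)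

lemma bounded_bilinear_B: "bounded_bilinear B"
  unfolding B_def [abs_def]
  by (intro bounded_bilinear_Pair bounded_bilinear_zero bounded_bilinear_add
      bounded_bilinear.comp[OF bounded_bilinear_scaleR] bounded_bilinear.comp[OF bounded_bilinear_profile_mult]
      bounded_linear_bilinear_compose[OF bounded_linear_scaleR_right]
      bounded_linear_bilinear_compose[OF mult.bounded_linear_right]
      bounded_linear_bilinear_compose[OF minus.bounded_linear_pairing]
      bounded_linear_components bounded_linear_derived bounded_linear_fst)

text \<open>Group the slots as \<epsilon>; then \<open>h\<^sub>1\<close>, \<open>h\<^sub>2\<close>,
  \<open>\<sigma>\<close>; then \<open>\<mu>\<close>, \<open>w\<^sub>1\<close>,
  \<open>w\<^sub>2\<close>; then \<open>s\<close>. Each slot of \<open>N Z\<close> depends on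
  earlier groups only, so every application annihilates one more group.\<close>

lemma N_nilpotent: "N (N (N (N Z))) = 0"
proof -
  have 1: "fst (N Y) = 0" for Y by (simp add: N_def)
  have 2: "h\<^sub>1 (N Y) = 0" "h\<^sub>2 (N Y) = 0" "\<sigma> (N Y) = 0" if "fst Y = 0" for Y
    using that by (simp_all add: N_def h\<^sub>1_def h\<^sub>2_def \<sigma>_def)
  have 3: "\<mu> (N Y) = 0" "w\<^sub>1 (N Y) = 0" "w\<^sub>2 (N Y) = 0" if "h\<^sub>1 Y = 0" "h\<^sub>2 Y = 0" "\<sigma> Y = 0" for Y
    using that by (simp_all add: N_def \<mu>_def w\<^sub>1_def w\<^sub>2_def g\<^sub>1_def g\<^sub>2_def Lp.zero Lm.zero mult.zero_left mult.zero_right)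
  have 4: "N Y = 0" if "fst Y = 0" "h\<^sub>1 Y = 0" "h\<^sub>2 Y = 0" "\<sigma> Y = 0" "\<mu> Y = 0" "w\<^sub>1 Y = 0" "w\<^sub>2 Y = 0" for Y
    using that by (simp add: N_def g\<^sub>1_def g\<^sub>2_def a_def Lp.zero Lm.zero mult.zero_left mult.zero_right
        pairing.zero) (simp add: zero_prod_def)
  show ?thesis by (intro 1 2 3 4)
qed

lemma profile_mult_commute: "g \<odot> h = h \<odot> g"
  unfolding profile_mult_def
  by (rule arg_cong2[where f = mk_profile]) (auto simp: mult.commute add.commute add.left_commute)

section \<open>Nondegeneracy and the equations of the branch\<close>

lemma D_nonzero: "D \<noteq> 0"
proof -
  have "D = 2 * (f * q) * minus.pairing (amplitude \<odot> (amplitude \<odot> plus.solve one))"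
    by (simp add: D_def \<alpha>\<^sub>0_def \<omega>\<^sub>1_def Lp.scaleR mult.scaleR_left mult.scaleR_right pairing.scaleR
        profile_mult_commute[of "Lp one"]) (simp add: Lp_def)
  then show ?thesis using q \<kappa>_pos by (simp add: pairing_solve_one)
qed

lemma pairing_\<omega>\<^sub>2: "minus.pairing \<omega>\<^sub>2 = 0"
proof -
  have "f * p * (pi / (2 * \<kappa>)) = sqrt 2"
    using p \<kappa>_pos by (simp add: field_simps)
  then show ?thesis
    by (simp add: \<omega>\<^sub>2_def pairing.diff pairing.scaleR pairing_one pairing_amplitude)
qed

lemma branch_equations:
  assumes Z: "Z = t *\<^sub>R (1, 0) + N Z + B Z Z"
  defines "A \<equiv> \<lambda>x. profile_fun (Lp (h\<^sub>1 Z)) x"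
    and "C \<equiv> \<lambda>x. profile_fun (Lm (h\<^sub>2 Z)) x + \<sigma> Z * profile_fun amplitude x"
  shows "minus.pairing (h\<^sub>2 Z) = 0"
    and "profile_fun (h\<^sub>1 Z) x = t * (f * q) + 3 * profile_fun amplitude x * (A x)\<^sup>2
      + profile_fun amplitude x * (C x)\<^sup>2 + ((A x)\<^sup>2 + (C x)\<^sup>2) * A x - t * C x"
    and "profile_fun (h\<^sub>2 Z) x = t * (profile_fun amplitude x - f * p) + 2 * profile_fun amplitude x * A x * C x
      + ((A x)\<^sup>2 + (C x)\<^sup>2) * C x + t * A x"
proof -
  define \<alpha> where "\<alpha> = \<alpha>\<^sub>0 + a Z"
  define \<beta> where "\<beta> = \<beta>\<^sub>0 + b Z"
  have comp: "fst Z = fst (t *\<^sub>R (1, 0) + N Z + B Z Z)" "h\<^sub>1 Z = h\<^sub>1 (t *\<^sub>R (1, 0) + N Z + B Z Z)"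
    "h\<^sub>2 Z = h\<^sub>2 (t *\<^sub>R (1, 0) + N Z + B Z Z)" "\<sigma> Z = \<sigma> (t *\<^sub>R (1, 0) + N Z + B Z Z)"
    "\<mu> Z = \<mu> (t *\<^sub>R (1, 0) + N Z + B Z Z)" "w\<^sub>1 Z = w\<^sub>1 (t *\<^sub>R (1, 0) + N Z + B Z Z)"
    "w\<^sub>2 Z = w\<^sub>2 (t *\<^sub>R (1, 0) + N Z + B Z Z)" "s Z = s (t *\<^sub>R (1, 0) + N Z + B Z Z)"
    using arg_cong[OF Z, of fst] arg_cong[OF Z, of h\<^sub>1] arg_cong[OF Z, of h\<^sub>2] arg_cong[OF Z, of \<sigma>]
      arg_cong[OF Z, of \<mu>] arg_cong[OF Z, of w\<^sub>1] arg_cong[OF Z, of w\<^sub>2] arg_cong[OF Z, of s] .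
  have e: "fst Z = t"
    using comp(1) by (simp add: N_def B_def)
  have h1: "h\<^sub>1 Z = t *\<^sub>R (\<omega>\<^sub>1 + w\<^sub>1 Z)"
    using comp(2) unfolding N_def B_def e by (simp add: h\<^sub>1_def scaleR_add_right)
  have h2: "h\<^sub>2 Z = t *\<^sub>R (\<omega>\<^sub>2 + w\<^sub>2 Z)"
    using comp(3) unfolding N_def B_def e by (simp add: h\<^sub>2_def scaleR_add_right)
  have sg: "\<sigma> Z = t * (t\<^sub>0 + s Z)"
    using comp(4) unfolding N_def B_def e by (simp add: \<sigma>_def distrib_left)
  have mu: "\<mu> Z = g\<^sub>1 Z \<odot> \<alpha> + g\<^sub>2 Z \<odot> \<beta>"
    using comp(5) unfolding N_def B_def
    by (simp add: \<mu>_def \<alpha>_def \<beta>_def mult.add_right)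
  have w1: "w\<^sub>1 Z = 3 *\<^sub>R (amplitude \<odot> (g\<^sub>1 Z \<odot> \<alpha>)) + amplitude \<odot> (g\<^sub>2 Z \<odot> \<beta>) + \<mu> Z \<odot> g\<^sub>1 Z - g\<^sub>2 Z"
    using comp(6) unfolding N_def B_def
    by (simp add: w\<^sub>1_def \<alpha>_def \<beta>_def mult.add_right scaleR_add_right)
  have w2: "w\<^sub>2 Z = 2 *\<^sub>R (amplitude \<odot> (g\<^sub>1 Z \<odot> \<beta>)) + \<mu> Z \<odot> g\<^sub>2 Z + g\<^sub>1 Z"
    using comp(7) unfolding N_def B_def
    by (simp add: w\<^sub>2_def \<beta>_def mult.add_right scaleR_add_right)
  have s: "s Z = - inverse D * minus.pairing (2 *\<^sub>R (amplitude \<odot> (\<alpha>\<^sub>0 \<odot> Lm (w\<^sub>2 Z)))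
       + 2 *\<^sub>R (amplitude \<odot> (a Z \<odot> \<beta>)) + \<mu> Z \<odot> \<beta> + a Z)"
    using comp(8) unfolding N_def B_def
    by (simp add: s_def \<beta>_def mult.add_right scaleR_add_right pairing.add pairing.scaleR distrib_left)
  have g1: "g\<^sub>1 Z = t *\<^sub>R \<alpha>"
    by (simp add: g\<^sub>1_def h1 \<alpha>_def \<alpha>\<^sub>0_def a_def Lp.scaleR Lp.add)
  have g2: "g\<^sub>2 Z = t *\<^sub>R \<beta>"
    by (simp add: g\<^sub>2_def h2 sg \<beta>_def \<beta>\<^sub>0_def b_def Lm.scaleR Lm.add algebra_simps)
  have solv: "minus.pairing (2 *\<^sub>R (amplitude \<odot> (\<alpha> \<odot> \<beta>)) + \<mu> Z \<odot> \<beta> + \<alpha>) = 0"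
  proof -
    have "D * s Z = - minus.pairing (2 *\<^sub>R (amplitude \<odot> (\<alpha>\<^sub>0 \<odot> Lm (w\<^sub>2 Z)))
       + 2 *\<^sub>R (amplitude \<odot> (a Z \<odot> \<beta>)) + \<mu> Z \<odot> \<beta> + a Z)"
      by (subst s) (simp add: D_nonzero)
    moreover have "D * t\<^sub>0 = - minus.pairing (2 *\<^sub>R (amplitude \<odot> (\<alpha>\<^sub>0 \<odot> Lm \<omega>\<^sub>2)) + \<alpha>\<^sub>0)"
      by (simp add: t\<^sub>0_def D_nonzero)
    \<comment> \<open>Three groups: the value at \<epsilon> = 0 apart from the kernel, the
      deviation, and the kernel coefficient \<open>t\<^sub>0 + s Z\<close>, whose pairing carries
      the factor \<open>D\<close>. The equations for \<open>t\<^sub>0\<close> and \<open>s Z\<close>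
      let it cancel the first two.\<close>
    moreover have "2 *\<^sub>R (amplitude \<odot> (\<alpha> \<odot> \<beta>)) + \<mu> Z \<odot> \<beta> + \<alpha> =
        (2 *\<^sub>R (amplitude \<odot> (\<alpha>\<^sub>0 \<odot> Lm \<omega>\<^sub>2)) + \<alpha>\<^sub>0) +
        (2 *\<^sub>R (amplitude \<odot> (\<alpha>\<^sub>0 \<odot> Lm (w\<^sub>2 Z))) + 2 *\<^sub>R (amplitude \<odot> (a Z \<odot> \<beta>)) + \<mu> Z \<odot> \<beta> + a Z) +
        (2 * (t\<^sub>0 + s Z)) *\<^sub>R (amplitude \<odot> (\<alpha>\<^sub>0 \<odot> amplitude))"
    proof -
      have "amplitude \<odot> (\<alpha> \<odot> \<beta>) = amplitude \<odot> (\<alpha>\<^sub>0 \<odot> \<beta>) + amplitude \<odot> (a Z \<odot> \<beta>)"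
        by (simp add: \<alpha>_def mult.add_left mult.add_right)
      moreover have "amplitude \<odot> (\<alpha>\<^sub>0 \<odot> \<beta>) = amplitude \<odot> (\<alpha>\<^sub>0 \<odot> Lm \<omega>\<^sub>2) + amplitude \<odot> (\<alpha>\<^sub>0 \<odot> Lm (w\<^sub>2 Z)) +
          (t\<^sub>0 + s Z) *\<^sub>R (amplitude \<odot> (\<alpha>\<^sub>0 \<odot> amplitude))"
        by (simp add: \<beta>_def \<beta>\<^sub>0_def b_def mult.add_left mult.add_right mult.scaleR_right scaleR_add_left)
      ultimately show ?thesis
        by (simp add: \<alpha>_def scaleR_add_right)
    qed
    moreover have "minus.pairing ((2 * (t\<^sub>0 + s Z)) *\<^sub>R (amplitude \<odot> (\<alpha>\<^sub>0 \<odot> amplitude))) = D * t\<^sub>0 + D * s Z"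
      unfolding pairing.scaleR D_def real_scaleR_def by algebra
    ultimately show ?thesis
      by (simp only: pairing.add[of "_ + _" "(2 * (t\<^sub>0 + s Z)) *\<^sub>R _"] pairing.add[of "2 *\<^sub>R _ + \<alpha>\<^sub>0"])
  qed
  have "w\<^sub>2 Z = t *\<^sub>R (2 *\<^sub>R (amplitude \<odot> (\<alpha> \<odot> \<beta>)) + \<mu> Z \<odot> \<beta> + \<alpha>)"
    unfolding w2 g1 g2 by (simp add: mult.scaleR_left mult.scaleR_right algebra_simps)
  then have "minus.pairing (w\<^sub>2 Z) = 0"
    by (simp add: pairing.scaleR solv)
  then show pairing_h2: "minus.pairing (h\<^sub>2 Z) = 0"
    by (simp add: h2 pairing.scaleR pairing.add pairing_\<omega>\<^sub>2)
  have A: "A x = t * profile_fun \<alpha> x" for x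
    using arg_cong[OF g1, of "\<lambda>g. profile_fun g x"] by (simp add: A_def g\<^sub>1_def)
  have C: "C x = t * profile_fun \<beta> x" for x
    using arg_cong[OF g2, of "\<lambda>g. profile_fun g x"] by (simp add: C_def g\<^sub>2_def)
  show "profile_fun (h\<^sub>1 Z) x = t * (f * q) + 3 * profile_fun amplitude x * (A x)\<^sup>2
      + profile_fun amplitude x * (C x)\<^sup>2 + ((A x)\<^sup>2 + (C x)\<^sup>2) * A x - t * C x"
    unfolding h1 w1 mu g1 g2 A C \<omega>\<^sub>1_def
    by (simp add: power2_eq_square del: amplitude_simps) (simp add: algebra_simps)
  show "profile_fun (h\<^sub>2 Z) x = t * (profile_fun amplitude x - f * p) + 2 * profile_fun amplitude x * A x * C x
      + ((A x)\<^sup>2 + (C x)\<^sup>2) * C x + t * A x"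
    unfolding h2 w2 mu g1 g2 A C \<omega>\<^sub>2_def
    by (simp add: power2_eq_square del: amplitude_simps) (simp add: algebra_simps)
qed

end

section \<open>The solution branch\<close>

text \<open>As the constant coefficient is 0, only n >= 1 contributes, and there |t|^n is at most
  r^n |t| / r. This is the origin of the linear rate in the final estimate.\<close>

lemma norm_power_series_le:
  fixes z :: "nat \<Rightarrow> 'a::banach"
  assumes sum: "summable (\<lambda>n. norm (z n) * r ^ n)" and r: "r > 0" and 0: "z 0 = 0" and t: "\<bar>t\<bar> \<le> r"
  shows "norm (\<Sum>n. t ^ n *\<^sub>R z n) \<le> (\<Sum>n. norm (z n) * r ^ n) / r * \<bar>t\<bar>"
proof -
  have s: "summable (\<lambda>n. norm (t ^ n *\<^sub>R z n))"
    by (rule summable_norm_scaleR_power[OF sum t])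
  have le: "norm (t ^ n *\<^sub>R z n) \<le> norm (z n) * r ^ n * (\<bar>t\<bar> / r)" for n
  proof (cases n)
    case (Suc m)
    have "\<bar>t\<bar> ^ m * \<bar>t\<bar> \<le> r ^ m * \<bar>t\<bar>" using t by (intro mult_right_mono power_mono) auto
    then have "norm (z n) * (\<bar>t\<bar> ^ m * \<bar>t\<bar>) \<le> norm (z n) * (r ^ m * \<bar>t\<bar>)" by (intro mult_left_mono) auto
    then show ?thesis using r by (simp add: Suc power_abs abs_mult mult_ac)
  qed (simp add: 0)
  have "norm (\<Sum>n. t ^ n *\<^sub>R z n) \<le> (\<Sum>n. norm (t ^ n *\<^sub>R z n))"
    by (rule summable_norm[OF s])
  also have "\<dots> \<le> (\<Sum>n. norm (z n) * r ^ n * (\<bar>t\<bar> / r))"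
    by (intro suminf_le le s summable_mult2[OF sum])
  also have "\<dots> = (\<Sum>n. norm (z n) * r ^ n) / r * \<bar>t\<bar>"
    using suminf_mult2[OF sum, of "\<bar>t\<bar> / r"] by simp
  finally show ?thesis .
qed

lemma H2_norm_nonneg: "H2_norm v \<ge> 0"
  unfolding H2_norm_def by (intro real_sqrt_ge_zero sum_nonneg integral_nonneg) simp

text \<open>The recentred series converges in the Banach space, and \<open>V\<close> carries the
  remainders over with the factor \<open>C\<close>. Linearity is demanded at each point x, since the
  values of \<open>V\<close> are plain functions.\<close>

lemma H2_real_analytic_on_linear_image:
  fixes V :: "'a::banach \<Rightarrow> real \<Rightarrow> complex"
  assumes linear: "\<And>x. linear (\<lambda>Z. V Z x)" and H2: "\<And>Z. V Z \<in> H2" "\<And>Z. H2_norm (V Z) \<le> C * norm Z"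
    and sum: "summable (\<lambda>n. norm (z n) * r ^ n)"
  shows "H2_real_analytic_on (\<lambda>t. V (\<Sum>n. t ^ n *\<^sub>R z n)) {-r<..<r}"
  unfolding H2_real_analytic_on_def
proof
  fix s assume "s \<in> {-r<..<r}"
  then have s: "\<bar>s\<bar> < r" by auto
  obtain a where a: "\<And>t. \<bar>t - s\<bar> < r - \<bar>s\<bar> \<Longrightarrow> (\<lambda>n. (t - s) ^ n *\<^sub>R a n) sums (\<Sum>n. t ^ n *\<^sub>R z n)"
    using power_series_recentre[OF sum s] by blast
  have "(\<lambda>N. H2_norm (\<lambda>x. V (\<Sum>n. t ^ n *\<^sub>R z n) x - (\<Sum>n<N. (t - s) ^ n *\<^sub>R V (a n) x))) \<longlonglongrightarrow> 0"
    if t: "\<bar>t - s\<bar> < r - \<bar>s\<bar>" for t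
  proof -
    define Z where "Z = (\<Sum>n. t ^ n *\<^sub>R z n)"
    define P where "P N = (\<Sum>n<N. (t - s) ^ n *\<^sub>R a n)" for N
    have eq: "(\<lambda>x. V Z x - (\<Sum>n<N. (t - s) ^ n *\<^sub>R V (a n) x)) = V (Z - P N)" for N
      unfolding P_def
      by (intro ext) (simp add: linear_diff[OF linear] linear_sum[OF linear] linear_cmul[OF linear])
    have "P \<longlonglongrightarrow> Z" using a[OF t] by (simp add: sums_def P_def [abs_def] Z_def)
    then have "(\<lambda>N. C * norm (Z - P N)) \<longlonglongrightarrow> C * norm (Z - Z)" by (intro tendsto_intros)
    then have lim: "(\<lambda>N. C * norm (Z - P N)) \<longlonglongrightarrow> 0" by simp
    show ?thesis
      unfolding Z_def[symmetric] eq
      by (rule Lim_null_comparison[OF _ lim]) (simp add: H2(2) H2_norm_nonneg)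
  qed
  then show "\<exists>ra>0. \<exists>a. (\<forall>n. a n \<in> H2) \<and> (\<forall>t. \<bar>t - s\<bar> < ra \<longrightarrow> V (\<Sum>n. t ^ n *\<^sub>R z n) \<in> H2 \<and>
      (\<lambda>N. H2_norm (\<lambda>x. V (\<Sum>n. t ^ n *\<^sub>R z n) x - (\<Sum>n<N. (t - s) ^ n *\<^sub>R a n x))) \<longlonglongrightarrow> 0)"
    using s H2(1) by (intro exI[of _ "r - \<bar>s\<bar>"] conjI exI[of _ "\<lambda>n. V (a n)"]) auto
qed

lemma real_analytic_on_linear_image:
  fixes z :: "nat \<Rightarrow> 'a::banach"
  assumes L: "bounded_linear L" and sum: "summable (\<lambda>n. norm (z n) * r ^ n)"
  shows "real_analytic_on (\<lambda>t. L (\<Sum>n. t ^ n *\<^sub>R z n)) {-r<..<r}"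
  unfolding real_analytic_on_def
proof
  interpret L: bounded_linear L by fact
  fix s assume "s \<in> {-r<..<r}"
  then have s: "\<bar>s\<bar> < r" by auto
  obtain a where a: "\<And>t. \<bar>t - s\<bar> < r - \<bar>s\<bar> \<Longrightarrow> (\<lambda>n. (t - s) ^ n *\<^sub>R a n) sums (\<Sum>n. t ^ n *\<^sub>R z n)"
    using power_series_recentre[OF sum s] by blast
  then have "(\<lambda>n. (t - s) ^ n *\<^sub>R L (a n)) sums L (\<Sum>n. t ^ n *\<^sub>R z n)" if "\<bar>t - s\<bar> < r - \<bar>s\<bar>" for t
    using L.sums[OF a[OF that]] by (simp add: L.scaleR)
  then show "\<exists>ra>0. \<exists>a. \<forall>t. \<bar>t - s\<bar> < ra \<longrightarrow> (\<lambda>n. (t - s) ^ n *\<^sub>R a n) sums L (\<Sum>n. t ^ n *\<^sub>R z n)"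
    using s by (intro exI[of _ "r - \<bar>s\<bar>"] conjI exI[of _ "\<lambda>n. L (a n)"]) auto
qed

lemma real_analytic_on_const: "real_analytic_on (\<lambda>_. c) S"
  unfolding real_analytic_on_def
proof
  fix s
  have "(\<lambda>n. (t - s) ^ n *\<^sub>R (if n = 0 then c else 0)) sums c" for t
    using sums_single[of 0 "\<lambda>_. c"] by (rule sums_cong[THEN iffD1, rotated]) auto
  then show "\<exists>r>0. \<exists>a. \<forall>t. \<bar>t - s\<bar> < r \<longrightarrow> (\<lambda>n. (t - s) ^ n *\<^sub>R a n) sums c"
    by (intro exI[of _ 1] conjI exI[of _ "\<lambda>n. if n = 0 then c else 0"]) auto
qed

section \<open>Passage from real profiles to complex functions in H2\<close>

definition rotated :: "complex \<Rightarrow> (real \<Rightarrow> real) \<Rightarrow> (real \<Rightarrow> real) \<Rightarrow> real \<Rightarrow> complex" where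
  "rotated E u v x = E * (complex_of_real (u x) + \<i> * complex_of_real (v x))"

lemma rotated_has_derivative:
  assumes "(u has_real_derivative u') (at x)" and "(v has_real_derivative v') (at x)"
  shows "(rotated E u v has_vector_derivative E * (complex_of_real u' + \<i> * complex_of_real v')) (at x)"
  unfolding rotated_def [abs_def]
  by (intro has_vector_derivative_mult_right has_vector_derivative_add has_vector_derivative_of_real assms)

lemma cmod_rotated_le: "cmod (rotated E u v x) \<le> cmod E * (\<bar>u x\<bar> + \<bar>v x\<bar>)"
  unfolding rotated_def norm_mult
  by (intro mult_left_mono order_trans[OF norm_triangle_ineq]) (auto simp: norm_mult)

lemma continuous_on_rotated:
  "continuous_on A u \<Longrightarrow> continuous_on A v \<Longrightarrow> continuous_on A (rotated E u v)"
  unfolding rotated_def [abs_def] by (intro continuous_intros)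

context decay_rate
begin

text \<open>Existentially quantified derivatives spare sums and multiples from naming them; only the
  size \<open>M\<close> has to be tracked.\<close>

definition C2_decay :: "real \<Rightarrow> (real \<Rightarrow> real) \<Rightarrow> bool" where
  "C2_decay M u \<longleftrightarrow> (\<exists>u' u''. (\<forall>x. (u has_real_derivative u' x) (at x)) \<and>
     (\<forall>x. (u' has_real_derivative u'' x) (at x)) \<and> continuous_on UNIV u'' \<and>
     (\<forall>x. \<bar>u x\<bar> \<le> M * weight x \<and> \<bar>u' x\<bar> \<le> M * weight x \<and> \<bar>u'' x\<bar> \<le> M * weight x))"

lemma C2_decay_add:
  assumes "C2_decay M u" and "C2_decay M' v"
  shows "C2_decay (M + M') (\<lambda>x. u x + v x)"
proof -
  obtain u' u'' where u: "\<And>x. (u has_real_derivative u' x) (at x)" "\<And>x. (u' has_real_derivative u'' x) (at x)"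
    "continuous_on UNIV u''" "\<And>x. \<bar>u x\<bar> \<le> M * weight x" "\<And>x. \<bar>u' x\<bar> \<le> M * weight x" "\<And>x. \<bar>u'' x\<bar> \<le> M * weight x"
    using assms(1) unfolding C2_decay_def by blast
  obtain v' v'' where v: "\<And>x. (v has_real_derivative v' x) (at x)" "\<And>x. (v' has_real_derivative v'' x) (at x)"
    "continuous_on UNIV v''" "\<And>x. \<bar>v x\<bar> \<le> M' * weight x" "\<And>x. \<bar>v' x\<bar> \<le> M' * weight x" "\<And>x. \<bar>v'' x\<bar> \<le> M' * weight x"
    using assms(2) unfolding C2_decay_def by blast
  have le: "\<bar>y + z\<bar> \<le> (M + M') * weight x" if "\<bar>y\<bar> \<le> M * weight x" "\<bar>z\<bar> \<le> M' * weight x" for x y z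
    using order_trans[OF abs_triangle_ineq add_mono[OF that]] by (simp add: distrib_right)
  show ?thesis
    unfolding C2_decay_def
    using u v
    by (intro exI[of _ "\<lambda>x. u' x + v' x"] exI[of _ "\<lambda>x. u'' x + v'' x"] conjI allI le DERIV_add continuous_on_add) auto
qed

lemma C2_decay_cmult:
  assumes "C2_decay M u"
  shows "C2_decay (\<bar>c\<bar> * M) (\<lambda>x. c * u x)"
proof -
  obtain u' u'' where u: "\<And>x. (u has_real_derivative u' x) (at x)" "\<And>x. (u' has_real_derivative u'' x) (at x)"
    "continuous_on UNIV u''" "\<And>x. \<bar>u x\<bar> \<le> M * weight x" "\<And>x. \<bar>u' x\<bar> \<le> M * weight x" "\<And>x. \<bar>u'' x\<bar> \<le> M * weight x"
    using assms(1) unfolding C2_decay_def by blast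
  have le: "\<bar>c * y\<bar> \<le> \<bar>c\<bar> * M * weight x" if "\<bar>y\<bar> \<le> M * weight x" for x y
    using mult_left_mono[OF that, of "\<bar>c\<bar>"] by (simp add: abs_mult mult.assoc)
  show ?thesis
    unfolding C2_decay_def
    using u
    by (intro exI[of _ "\<lambda>x. c * u' x"] exI[of _ "\<lambda>x. c * u'' x"] conjI allI le DERIV_cmult continuous_on_mult_left) auto
qed

lemma continuous_on_profile_fun: "continuous_on A (profile_fun g)"
  unfolding profile_fun_def [abs_def] by (intro continuous_intros continuous_on_decaying_part)

lemma C2_decay_Lp: "\<exists>M\<ge>0. \<forall>g. C2_decay (M * norm g) (decaying_part (Lp g))"
proof -
  obtain M where M: "M \<ge> 0" "\<And>g x. \<bar>decaying_part (plus.solve g) x\<bar> \<le> M * norm g * weight x"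
    "\<And>g x. \<bar>plus.solve' g x\<bar> \<le> M * norm g * weight x"
    "\<And>g x. \<bar>(\<kappa>\<^sup>2 - 6 * \<kappa>\<^sup>2 * (S x * S x)) * profile_fun (plus.solve g) x - profile_fun g x\<bar> \<le> M * norm g * weight x"
    using plus.solve_decay by auto
  have "C2_decay (M * norm g) (decaying_part (Lp g))" for g
    unfolding C2_decay_def Lp_def
    by (rule exI[of _ "plus.solve' g"],
        rule exI[of _ "\<lambda>x. (\<kappa>\<^sup>2 - 6 * \<kappa>\<^sup>2 * (S x * S x)) * profile_fun (plus.solve g) x - profile_fun g x"])
       (use plus.solve_has_derivative M in \<open>auto intro!: continuous_intros continuous_on_profile_fun\<close>)
  with M(1) show ?thesis by blast
qed

lemma C2_decay_Lm: "\<exists>M\<ge>0. \<forall>g. C2_decay (M * norm g) (decaying_part (Lm g))"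
proof -
  obtain M where M: "M \<ge> 0" "\<And>g x. \<bar>decaying_part (Lm g) x\<bar> \<le> M * norm (orth g) * weight x"
    "\<And>g x. \<bar>minus.solve' (orth g) x\<bar> \<le> M * norm (orth g) * weight x"
    "\<And>g x. \<bar>(\<kappa>\<^sup>2 - 2 * \<kappa>\<^sup>2 * (S x * S x)) * profile_fun (Lm g) x - profile_fun (orth g) x\<bar> \<le> M * norm (orth g) * weight x"
  proof -
    obtain M where "M \<ge> 0" and M: "\<forall>g. (1::real) = - 1 \<or> minus.pairing g = 0 \<longrightarrow> (\<forall>x.
        \<bar>decaying_part (minus.solve g) x\<bar> \<le> M * norm g * weight x \<and> \<bar>minus.solve' g x\<bar> \<le> M * norm g * weight x \<and>
        \<bar>(\<kappa>\<^sup>2 - 2 * \<kappa>\<^sup>2 * (S x * S x)) * profile_fun (minus.solve g) x - profile_fun g x\<bar> \<le> M * norm g * weight x)"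
      using minus.solve_decay by blast
    have "\<bar>decaying_part (Lm g) x\<bar> \<le> M * norm (orth g) * weight x \<and>
        \<bar>minus.solve' (orth g) x\<bar> \<le> M * norm (orth g) * weight x \<and>
        \<bar>(\<kappa>\<^sup>2 - 2 * \<kappa>\<^sup>2 * (S x * S x)) * profile_fun (Lm g) x - profile_fun (orth g) x\<bar> \<le> M * norm (orth g) * weight x"
      for g x
      unfolding Lm_def using M[rule_format, OF disjI2[OF pairing_orth[of g]], of x] .
    with \<open>M \<ge> 0\<close> show thesis by (intro that[of M]) blast+
  qed
  obtain K where K: "\<And>g. norm (orth g) \<le> norm g * K" "K > 0"
    using bounded_linear.pos_bounded[OF bounded_linear_orth] by blast
  have le: "M * norm (orth g) * weight x \<le> M * K * norm g * weight x" for g x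
    using mult_left_mono[OF K(1)[of g] M(1)] by (intro mult_right_mono) (auto simp: mult_ac)
  have "C2_decay (M * K * norm g) (decaying_part (Lm g))" for g
    unfolding C2_decay_def
  proof (intro exI conjI allI)
    fix x
    show "(decaying_part (Lm g) has_real_derivative minus.solve' (orth g) x) (at x)"
      unfolding Lm_def by (rule minus.solve_has_derivative) simp
    show "(minus.solve' (orth g) has_real_derivative
        (\<kappa>\<^sup>2 - 2 * \<kappa>\<^sup>2 * (S x * S x)) * profile_fun (Lm g) x - profile_fun (orth g) x) (at x)"
      unfolding Lm_def by (rule minus.solve_has_derivative) simp
    show "continuous_on UNIV (\<lambda>x. (\<kappa>\<^sup>2 - 2 * \<kappa>\<^sup>2 * (S x * S x)) * profile_fun (Lm g) x - profile_fun (orth g) x)"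
      by (intro continuous_intros continuous_on_profile_fun)
  qed (rule order_trans[OF M(2) le] order_trans[OF M(3) le] order_trans[OF M(4) le])+
  moreover have "M * K \<ge> 0" using M K by simp
  ultimately show ?thesis by blast
qed

lemma S_second_derivative: "((\<lambda>x. - \<kappa> * S x * T x) has_real_derivative (\<kappa>\<^sup>2 - 2 * \<kappa>\<^sup>2 * (S x * S x)) * S x) (at x)"
  using minus.\<xi>(2)[of x] by (simp add: \<xi>\<^sub>m_def \<xi>\<^sub>m'_def [abs_def])

lemma C2_decay_S: "\<exists>M\<ge>0. C2_decay M S"
proof -
  define M where "M = 2 * (1 + \<kappa> + 3 * \<kappa>\<^sup>2)"
  have le: "c * S x \<le> M * weight x" if "c \<le> 1 + \<kappa> + 3 * \<kappa>\<^sup>2" for c x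
  proof -
    have "c * S x \<le> (1 + \<kappa> + 3 * \<kappa>\<^sup>2) * (2 * weight x)"
      using that S_pos[of x] \<kappa>_pos by (intro mult_mono S_le_weight) auto
    then show ?thesis unfolding M_def by (simp only: ac_simps)
  qed
  have "C2_decay M S"
    unfolding C2_decay_def
  proof (intro exI conjI allI)
    fix x
    show "(S has_real_derivative - \<kappa> * S x * T x) (at x)" by (rule STK_derivatives)
    show "((\<lambda>x. - \<kappa> * S x * T x) has_real_derivative (\<kappa>\<^sup>2 - 2 * \<kappa>\<^sup>2 * (S x * S x)) * S x) (at x)"
      by (rule S_second_derivative)
    show "continuous_on UNIV (\<lambda>x. (\<kappa>\<^sup>2 - 2 * \<kappa>\<^sup>2 * (S x * S x)) * S x)"
      by (intro continuous_intros)
    show "\<bar>S x\<bar> \<le> M * weight x"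
      using le[of 1 x] S_pos[of x] \<kappa>_pos by simp
    have "\<bar>- \<kappa> * S x * T x\<bar> \<le> \<kappa> * S x"
      using mult_left_mono[OF ST_bound[of x], of \<kappa>] \<kappa>_pos by (simp add: abs_mult mult.assoc)
    then show "\<bar>- \<kappa> * S x * T x\<bar> \<le> M * weight x"
      using le[of \<kappa> x] by simp
    have "S x * S x \<le> 1 * 1" using S_le_1[of x] S_pos[of x] by (intro mult_mono) auto
    then have "2 * \<kappa>\<^sup>2 * (S x * S x) \<le> 2 * \<kappa>\<^sup>2" "0 \<le> 2 * \<kappa>\<^sup>2 * (S x * S x)"
      using mult_left_mono[of "S x * S x" 1 "2 * \<kappa>\<^sup>2"] by auto
    then have "\<bar>\<kappa>\<^sup>2 - 2 * \<kappa>\<^sup>2 * (S x * S x)\<bar> \<le> 3 * \<kappa>\<^sup>2"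
      unfolding abs_le_iff using zero_le_power2[of \<kappa>] by (intro conjI) linarith+
    then have "\<bar>(\<kappa>\<^sup>2 - 2 * \<kappa>\<^sup>2 * (S x * S x)) * S x\<bar> \<le> 3 * \<kappa>\<^sup>2 * S x"
      unfolding abs_mult[of _ "S x"] using S_pos[of x] by (simp add: mult_right_mono)
    then show "\<bar>(\<kappa>\<^sup>2 - 2 * \<kappa>\<^sup>2 * (S x * S x)) * S x\<bar> \<le> M * weight x"
      using le[of "3 * \<kappa>\<^sup>2" x] \<kappa>_pos by simp
  qed
  moreover have "M \<ge> 0" using \<kappa>_pos by (simp add: M_def)
  ultimately show ?thesis by blast
qed

lemma H2_rotated:
  "\<exists>C\<ge>0. \<forall>M M' u v. C2_decay M u \<longrightarrow> C2_decay M' v \<longrightarrow>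
     rotated E u v \<in> H2 \<and> H2_norm (rotated E u v) \<le> C * (M + M')"
proof (rule H2_exponential_decay[of "\<kappa> / 2"])
  fix C assume C: "C \<ge> 0" and
    H2: "\<And>v v\<^sub>1 v\<^sub>2 M. \<lbrakk>\<And>x. (v has_vector_derivative v\<^sub>1 x) (at x); \<And>x. (v\<^sub>1 has_vector_derivative v\<^sub>2 x) (at x);
       continuous_on UNIV v\<^sub>2; \<And>x. cmod (v x) \<le> M * exp (- (\<kappa> / 2) * \<bar>x\<bar>);
       \<And>x. cmod (v\<^sub>1 x) \<le> M * exp (- (\<kappa> / 2) * \<bar>x\<bar>); \<And>x. cmod (v\<^sub>2 x) \<le> M * exp (- (\<kappa> / 2) * \<bar>x\<bar>)\<rbrakk> \<Longrightarrow>
      v \<in> H2 \<and> H2_norm v \<le> C * M"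
  show ?thesis
  proof (intro exI[of _ "C * cmod E"] conjI allI impI)
    fix M M' u v assume "C2_decay M u" "C2_decay M' v"
    then obtain u' u'' v' v'' where
      u: "\<And>x. (u has_real_derivative u' x) (at x)" "\<And>x. (u' has_real_derivative u'' x) (at x)"
      "continuous_on UNIV u''" "\<And>x. \<bar>u x\<bar> \<le> M * weight x" "\<And>x. \<bar>u' x\<bar> \<le> M * weight x" "\<And>x. \<bar>u'' x\<bar> \<le> M * weight x"
      and v: "\<And>x. (v has_real_derivative v' x) (at x)" "\<And>x. (v' has_real_derivative v'' x) (at x)"
      "continuous_on UNIV v''" "\<And>x. \<bar>v x\<bar> \<le> M' * weight x" "\<And>x. \<bar>v' x\<bar> \<le> M' * weight x" "\<And>x. \<bar>v'' x\<bar> \<le> M' * weight x"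
      unfolding C2_decay_def by blast
    have le: "cmod (rotated E y z x) \<le> cmod E * (M + M') * exp (- (\<kappa> / 2) * \<bar>x\<bar>)"
      if "\<bar>y x\<bar> \<le> M * weight x" "\<bar>z x\<bar> \<le> M' * weight x" for y z :: "real \<Rightarrow> real" and x
      using order_trans[OF cmod_rotated_le[of E y z x] mult_left_mono[OF add_mono[OF that] norm_ge_zero[of E]]]
      by (simp add: weight_def algebra_simps)
    have "rotated E u v \<in> H2 \<and> H2_norm (rotated E u v) \<le> C * (cmod E * (M + M'))"
    proof (rule H2)
      show "(rotated E u v has_vector_derivative rotated E u' v' x) (at x)" for x
        using rotated_has_derivative[OF u(1) v(1)] by (simp add: rotated_def)
      show "(rotated E u' v' has_vector_derivative rotated E u'' v'' x) (at x)" for x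
        using rotated_has_derivative[OF u(2) v(2)] by (simp add: rotated_def)
    qed (intro continuous_on_rotated u v le)+
    then show "rotated E u v \<in> H2" "H2_norm (rotated E u v) \<le> C * cmod E * (M + M')"
      by (simp_all add: mult.assoc)
  qed (use C in simp)
qed (use \<kappa>_pos in simp)

lemma weight_tendsto_0: "(weight \<longlongrightarrow> 0) at_top" "(weight \<longlongrightarrow> 0) at_bot"
proof -
  have "filterlim (\<lambda>x. \<kappa> / 2 * x) at_top at_top"
    by (rule filterlim_tendsto_pos_mult_at_top[OF tendsto_const _ filterlim_ident]) (use \<kappa>_pos in simp)
  then have lim: "((\<lambda>x. exp (- (\<kappa> / 2 * x))) \<longlongrightarrow> 0) at_top"
    by (rule filterlim_compose[OF exp_at_bot filterlim_compose[OF filterlim_uminus_at_bot_at_top]])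
  show top: "(weight \<longlongrightarrow> 0) at_top"
  proof (rule Lim_transform_eventually[OF lim])
    show "\<forall>\<^sub>F x in at_top. exp (- (\<kappa> / 2 * x)) = weight x"
      using eventually_ge_at_top[of 0] by eventually_elim (simp add: weight_def)
  qed
  show "(weight \<longlongrightarrow> 0) at_bot"
    using filterlim_compose[OF top filterlim_uminus_at_top_at_bot] by simp
qed

lemma rotated_tendsto_0:
  assumes "C2_decay M u" and "C2_decay M' v"
  shows "(rotated E u v \<longlongrightarrow> 0) at_top" "(rotated E u v \<longlongrightarrow> 0) at_bot"
proof -
  have le: "norm (rotated E u v x) \<le> cmod E * (M + M') * weight x" for x
  proof -
    have "\<bar>u x\<bar> \<le> M * weight x" "\<bar>v x\<bar> \<le> M' * weight x"
      using assms unfolding C2_decay_def by blast+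
    from order_trans[OF cmod_rotated_le[of E u v x] mult_left_mono[OF add_mono[OF this] norm_ge_zero[of E]]]
    show ?thesis by (simp add: algebra_simps)
  qed
  have "((\<lambda>x. cmod E * (M + M') * weight x) \<longlongrightarrow> 0) F" if "(weight \<longlongrightarrow> 0) F" for F
    using that by (rule tendsto_mult_right_zero)
  from this[OF weight_tendsto_0(1)] this[OF weight_tendsto_0(2)]
  show "(rotated E u v \<longlongrightarrow> 0) at_top" "(rotated E u v \<longlongrightarrow> 0) at_bot"
    by (auto intro: Lim_null_comparison[OF always_eventually] le)
qed

end

section \<open>Assembly of the branch\<close>

theorem theorem1:
  fixes \<zeta> f \<theta>\<^sub>0 :: real
  assumes "\<zeta> > 0" and "f > 0"
    and "simple_zero (\<lambda>\<theta>. pi * f * cos \<theta> - 2 * sqrt (2 * \<zeta>)) \<theta>\<^sub>0"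
  shows "\<exists>\<epsilon>\<^sub>1>0. \<exists>(u :: real \<Rightarrow> real \<Rightarrow> complex) (\<theta> :: real \<Rightarrow> real)
            (u\<^sub>i\<^sub>n\<^sub>f :: real \<Rightarrow> complex) (\<phi> :: real \<Rightarrow> real \<Rightarrow> complex).
      (\<forall>\<epsilon>\<in>{-\<epsilon>\<^sub>1<..<\<epsilon>\<^sub>1}.
         u \<epsilon> \<in> const_plus_H2 \<and>
         solves_LLE \<zeta> f \<epsilon> (u \<epsilon>) \<and>
         \<phi> \<epsilon> \<in> H2 \<and>
         u \<epsilon> = (\<lambda>x. soliton \<zeta> (\<theta> \<epsilon>) x + u\<^sub>i\<^sub>n\<^sub>f \<epsilon> + \<phi> \<epsilon> x) \<and>
         (u \<epsilon> \<longlongrightarrow> u\<^sub>i\<^sub>n\<^sub>f \<epsilon>) at_top \<and> (u \<epsilon> \<longlongrightarrow> u\<^sub>i\<^sub>n\<^sub>f \<epsilon>) at_bot) \<and>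
      u 0 = soliton \<zeta> \<theta>\<^sub>0 \<and>
      real_analytic_on \<theta> {-\<epsilon>\<^sub>1<..<\<epsilon>\<^sub>1} \<and>
      real_analytic_on u\<^sub>i\<^sub>n\<^sub>f {-\<epsilon>\<^sub>1<..<\<epsilon>\<^sub>1} \<and>
      H2_real_analytic_on \<phi> {-\<epsilon>\<^sub>1<..<\<epsilon>\<^sub>1} \<and>
      (\<lambda>\<epsilon>. H2_norm (\<phi> \<epsilon>)) \<in> O[at 0](\<lambda>\<epsilon>. \<bar>\<epsilon>\<bar>)"
proof -
  define \<kappa> where "\<kappa> = sqrt \<zeta>"
  have \<kappa>: "\<kappa> > 0" "\<kappa>\<^sup>2 = \<zeta>" "sqrt (2 * \<zeta>) = sqrt 2 * \<kappa>"
    using assms(1) by (auto simp: \<kappa>_def real_sqrt_mult)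
  have zero: "pi * f * cos \<theta>\<^sub>0 = 2 * (sqrt 2 * \<kappa>)"
    using assms(3) by (simp add: simple_zero_def \<kappa>(3))
  have "sin \<theta>\<^sub>0 \<noteq> 0"
  proof
    assume 0: "sin \<theta>\<^sub>0 = 0"
    obtain d where d: "((\<lambda>\<theta>. pi * f * cos \<theta> - 2 * sqrt (2 * \<zeta>)) has_real_derivative d) (at \<theta>\<^sub>0)" "d \<noteq> 0"
      using assms(3) unfolding simple_zero_def by blast
    have "((\<lambda>\<theta>. pi * f * cos \<theta> - 2 * sqrt (2 * \<zeta>)) has_real_derivative pi * f * (- sin \<theta>\<^sub>0)) (at \<theta>\<^sub>0)"
      by (rule derivative_eq_intros refl)+ simp
    then show False using DERIV_unique[OF d(1)] d(2) 0 by force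
  qed
  then interpret bifurcation \<kappa> f "cos \<theta>\<^sub>0" "- sin \<theta>\<^sub>0"
    using \<kappa>(1) zero assms(2) by unfold_locales (auto simp: mult_ac)
  interpret Lp: bounded_linear Lp by (rule bounded_linear_Lp)
  interpret Lm: bounded_linear Lm by (rule bounded_linear_Lm)
  define E where "E = exp (\<i> * complex_of_real \<theta>\<^sub>0)"
  have E: "E = complex_of_real (cos \<theta>\<^sub>0) + \<i> * complex_of_real (sin \<theta>\<^sub>0)" "cmod E = 1"
  proof -
    show "cmod E = 1" by (simp add: E_def)
  qed (simp add: E_def exp_Euler cos_of_real sin_of_real)
  define \<Phi> where "\<Phi> = profile_fun amplitude"
  have \<Phi>: "\<Phi> x = sqrt 2 * \<kappa> * S x" for x by (simp add: \<Phi>_def)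
  have sol: "soliton \<zeta> \<theta>\<^sub>0 x = E * complex_of_real (\<Phi> x)" for x
    by (simp add: soliton_def E_def \<Phi> \<kappa>(3) S_def divide_inverse flip: \<kappa>_def)
  obtain z r where r: "r > 0" and z: "summable (\<lambda>n. norm (z n) * r ^ n)" "z 0 = 0"
    and Z_eq: "\<And>t. \<bar>t\<bar> \<le> r \<Longrightarrow> (let Z = \<Sum>n. t ^ n *\<^sub>R z n in Z = t *\<^sub>R (1, 0) + N Z + B Z Z)"
    using quadratic_equation_power_series[OF bounded_linear_N N_nilpotent bounded_bilinear_B, of "(1, 0)"] by blast
  define Z where "Z t = (\<Sum>n. t ^ n *\<^sub>R z n)" for t
  have Z0: "Z 0 = 0"
  proof -
    have "(0::real) ^ n *\<^sub>R z n = 0" for n by (cases n) (auto simp: z(2))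
    then show ?thesis unfolding Z_def by (simp only: suminf_zero)
  qed
  \<comment> \<open>The kernel part \<open>\<sigma> Y * \<Phi> x\<close> is the infinitesimal
    rotation of the soliton; placing it in the correction keeps the angle fixed and \<open>v\<close>
    linear in the state.\<close>
  define v where "v Y = rotated E (decaying_part (Lp (h\<^sub>1 Y))) (\<lambda>x. decaying_part (Lm (h\<^sub>2 Y)) x + \<sigma> Y * \<Phi> x)" for Y
  define c where "c Y = E * (complex_of_real (fst (Lp (h\<^sub>1 Y))) + \<i> * complex_of_real (fst (Lm (h\<^sub>2 Y))))" for Y
  obtain M\<^sub>p where Mp: "M\<^sub>p \<ge> 0" "\<And>g. C2_decay (M\<^sub>p * norm g) (decaying_part (Lp g))"
    using C2_decay_Lp by blast
  obtain M\<^sub>m where Mm: "M\<^sub>m \<ge> 0" "\<And>g. C2_decay (M\<^sub>m * norm g) (decaying_part (Lm g))"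
    using C2_decay_Lm by blast
  obtain M\<^sub>s where Ms: "M\<^sub>s \<ge> 0" "C2_decay M\<^sub>s S"
    using C2_decay_S by blast
  define M\<^sub>\<Phi> where "M\<^sub>\<Phi> = \<bar>sqrt 2 * \<kappa>\<bar> * M\<^sub>s"
  have M\<Phi>: "M\<^sub>\<Phi> \<ge> 0" "C2_decay M\<^sub>\<Phi> \<Phi>"
    using Ms C2_decay_cmult[OF Ms(2), of "sqrt 2 * \<kappa>"] by (auto simp: M\<^sub>\<Phi>_def \<Phi> [abs_def])
  have re: "C2_decay (M\<^sub>p * norm (h\<^sub>1 Y)) (decaying_part (Lp (h\<^sub>1 Y)))" for Y by (rule Mp)
  have im: "C2_decay (M\<^sub>m * norm (h\<^sub>2 Y) + \<bar>\<sigma> Y\<bar> * M\<^sub>\<Phi>) (\<lambda>x. decaying_part (Lm (h\<^sub>2 Y)) x + \<sigma> Y * \<Phi> x)" for Y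
    by (intro C2_decay_add C2_decay_cmult Mm M\<Phi>)
  have re\<Phi>: "C2_decay (M\<^sub>\<Phi> + M\<^sub>p * norm (h\<^sub>1 Y)) (\<lambda>x. \<Phi> x + decaying_part (Lp (h\<^sub>1 Y)) x)" for Y
    by (intro C2_decay_add re M\<Phi>)
  obtain C where C: "C \<ge> 0" "\<And>M M' u v. C2_decay M u \<Longrightarrow> C2_decay M' v \<Longrightarrow>
       rotated E u v \<in> H2 \<and> H2_norm (rotated E u v) \<le> C * (M + M')"
    using H2_rotated[of E] by blast
  have v_H2: "v Y \<in> H2" for Y
    unfolding v_def using C(2)[OF re im] by blast
  obtain K where K: "\<And>Y. H2_norm (v Y) \<le> K * norm Y" "K \<ge> 0"
  proof -
    obtain K\<^sub>1 K\<^sub>2 K\<^sub>3 where K: "\<And>Y. norm (h\<^sub>1 Y) \<le> norm Y * K\<^sub>1" "\<And>Y. norm (h\<^sub>2 Y) \<le> norm Y * K\<^sub>2"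
      "\<And>Y. norm (\<sigma> Y) \<le> norm Y * K\<^sub>3" and pos: "K\<^sub>1 > 0" "K\<^sub>2 > 0" "K\<^sub>3 > 0"
      using bounded_linear_components(1-3)[THEN bounded_linear.pos_bounded] by blast
    have "H2_norm (v Y) \<le> C * (M\<^sub>p * K\<^sub>1 + (M\<^sub>m * K\<^sub>2 + K\<^sub>3 * M\<^sub>\<Phi>)) * norm Y" for Y
    proof -
      have "H2_norm (v Y) \<le> C * (M\<^sub>p * norm (h\<^sub>1 Y) + (M\<^sub>m * norm (h\<^sub>2 Y) + \<bar>\<sigma> Y\<bar> * M\<^sub>\<Phi>))"
        unfolding v_def using C(2)[OF re im] by blast
      also have "\<dots> \<le> C * (M\<^sub>p * (norm Y * K\<^sub>1) + (M\<^sub>m * (norm Y * K\<^sub>2) + (norm Y * K\<^sub>3) * M\<^sub>\<Phi>))"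
        using K(3)[of Y] by (intro mult_left_mono add_mono mult_right_mono K C Mp Mm M\<Phi>) auto
      finally show ?thesis by (simp add: algebra_simps)
    qed
    moreover have "C * (M\<^sub>p * K\<^sub>1 + (M\<^sub>m * K\<^sub>2 + K\<^sub>3 * M\<^sub>\<Phi>)) \<ge> 0"
      using pos C(1) Mp(1) Mm(1) M\<Phi>(1) by simp
    ultimately show thesis by (rule that)
  qed
  have v_linear: "linear (\<lambda>Y. v Y x)" for x
  proof (rule linearI)
    note add = bounded_linear_components(1-3)[THEN bounded_linear.linear, THEN linear_add]
    note scale = bounded_linear_components(1-3)[THEN bounded_linear.linear, THEN linear_cmul]
    show "v (Y + Y') x = v Y x + v Y' x" for Y Y'
      by (simp add: v_def rotated_def add Lp.add Lm.add algebra_simps)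
    show "v (k *\<^sub>R Y) x = k *\<^sub>R v Y x" for k Y
      by (simp add: v_def rotated_def scale Lp.scaleR Lm.scaleR) (simp add: scaleR_conv_of_real algebra_simps)
  qed
  have c_linear: "bounded_linear c"
    unfolding c_def [abs_def]
    by (intro bounded_linear_const_mult bounded_linear_add bounded_linear_compose[OF bounded_linear_of_real]
        bounded_linear_fst_comp bounded_linear_compose[OF bounded_linear_Lp]
        bounded_linear_compose[OF bounded_linear_Lm] bounded_linear_components)
  define u where "u t x = soliton \<zeta> \<theta>\<^sub>0 x + c (Z t) + v (Z t) x" for t x
  \<comment> \<open>With the soliton moved into the rotated part, u is a constant plus one function
    of controlled decay; this yields membership in \<open>const_plus_H2\<close> and both limits at
    infinity.\<close>
  have u_split: "u t x = c (Z t) + rotated E (\<lambda>x. \<Phi> x + decaying_part (Lp (h\<^sub>1 (Z t))) x)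
      (\<lambda>x. decaying_part (Lm (h\<^sub>2 (Z t))) x + \<sigma> (Z t) * \<Phi> x) x" for t x
    by (simp add: u_def sol v_def rotated_def algebra_simps)
  have solves: "solves_LLE \<zeta> f t (u t)" if t: "\<bar>t\<bar> \<le> r" for t
  proof -
    have eq: "Z t = t *\<^sub>R (1, 0) + N (Z t) + B (Z t) (Z t)"
      using Z_eq[OF t] by (simp only: Z_def Let_def)
    define A where "A x = profile_fun (Lp (h\<^sub>1 (Z t))) x" for x
    define G where "G x = profile_fun (Lm (h\<^sub>2 (Z t))) x + \<sigma> (Z t) * \<Phi> x" for x
    note eqs = branch_equations[OF eq, folded \<Phi>_def, folded A_def G_def]
    define A'' where "A'' x = (\<kappa>\<^sup>2 - (\<Phi> x)\<^sup>2) * \<Phi> x + ((\<kappa>\<^sup>2 - 3 * (\<Phi> x)\<^sup>2) * A x - profile_fun (h\<^sub>1 (Z t)) x)" for x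
    define G'' where "G'' x = (\<kappa>\<^sup>2 - (\<Phi> x)\<^sup>2) * G x - profile_fun (h\<^sub>2 (Z t)) x" for x
    define A' where "A' x = sqrt 2 * \<kappa> * (- \<kappa> * S x * T x) + plus.solve' (h\<^sub>1 (Z t)) x" for x
    define G' where "G' x = minus.solve' (h\<^sub>2 (Z t)) x + \<sigma> (Z t) * (sqrt 2 * \<kappa> * (- \<kappa> * S x * T x))" for x
    have \<Phi>2: "(\<Phi> x)\<^sup>2 = 2 * \<kappa>\<^sup>2 * (S x * S x)" for x
      by (simp add: \<Phi> power2_eq_square)
    have d\<Phi>: "(\<Phi> has_real_derivative sqrt 2 * \<kappa> * (- \<kappa> * S x * T x)) (at x)"
        "((\<lambda>x. sqrt 2 * \<kappa> * (- \<kappa> * S x * T x)) has_real_derivative (\<kappa>\<^sup>2 - (\<Phi> x)\<^sup>2) * \<Phi> x) (at x)" for x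
    proof -
      show "(\<Phi> has_real_derivative sqrt 2 * \<kappa> * (- \<kappa> * S x * T x)) (at x)"
        unfolding \<Phi> [abs_def] by (rule DERIV_cmult[OF STK_derivatives(1)])
      have "sqrt 2 * \<kappa> * ((\<kappa>\<^sup>2 - 2 * \<kappa>\<^sup>2 * (S x * S x)) * S x) = (\<kappa>\<^sup>2 - (\<Phi> x)\<^sup>2) * \<Phi> x"
        unfolding \<Phi>2 unfolding \<Phi> by algebra
      then show "((\<lambda>x. sqrt 2 * \<kappa> * (- \<kappa> * S x * T x)) has_real_derivative (\<kappa>\<^sup>2 - (\<Phi> x)\<^sup>2) * \<Phi> x) (at x)"
        by (rule DERIV_cong[OF DERIV_cmult[OF S_second_derivative]])
    qed
    \<comment> \<open>Here the recovered solvability is used: the projection inside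
      \<open>Lm\<close> acts as the identity, so \<open>Lm\<close> solves the intended equation and
      not a projected one.\<close>
    have orth: "orth (h\<^sub>2 (Z t)) = h\<^sub>2 (Z t)" by (rule orth_id[OF eqs(1)])
    have dA: "((\<lambda>x. \<Phi> x + A x) has_real_derivative A' x) (at x)" "(A' has_real_derivative A'' x) (at x)" for x
    proof -
      have 1: "(A has_real_derivative plus.solve' (h\<^sub>1 (Z t)) x) (at x)"
        using DERIV_add[OF DERIV_const plus.solve_has_derivative(1)]
        by (simp add: A_def [abs_def] profile_fun_def [abs_def] Lp_def)
      show "((\<lambda>x. \<Phi> x + A x) has_real_derivative A' x) (at x)"
        unfolding A'_def by (rule DERIV_add[OF d\<Phi>(1) 1])
      have 2: "(plus.solve' (h\<^sub>1 (Z t)) has_real_derivative (\<kappa>\<^sup>2 - 3 * (\<Phi> x)\<^sup>2) * A x - profile_fun (h\<^sub>1 (Z t)) x) (at x)"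
        using plus.solve_has_derivative(2)[of "h\<^sub>1 (Z t)" x] by (simp add: A_def Lp_def \<Phi>2 mult.assoc)
      show "(A' has_real_derivative A'' x) (at x)"
        unfolding A'_def [abs_def] A''_def by (rule DERIV_add[OF d\<Phi>(2) 2])
    qed
    have dG: "(G has_real_derivative G' x) (at x)" "(G' has_real_derivative G'' x) (at x)" for x
    proof -
      have 1: "(profile_fun (Lm (h\<^sub>2 (Z t))) has_real_derivative minus.solve' (h\<^sub>2 (Z t)) x) (at x)"
        using DERIV_add[OF DERIV_const minus.solve_has_derivative(1)[of "h\<^sub>2 (Z t)"]] eqs(1)
        by (simp add: profile_fun_def [abs_def] Lm_def orth)
      show "(G has_real_derivative G' x) (at x)"
        unfolding G_def [abs_def] G'_def by (rule DERIV_add[OF 1 DERIV_cmult[OF d\<Phi>(1)]])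
      have 2: "(minus.solve' (h\<^sub>2 (Z t)) has_real_derivative
          (\<kappa>\<^sup>2 - (\<Phi> x)\<^sup>2) * profile_fun (Lm (h\<^sub>2 (Z t))) x - profile_fun (h\<^sub>2 (Z t)) x) (at x)"
        using minus.solve_has_derivative(2)[of "h\<^sub>2 (Z t)" x] eqs(1) by (simp add: Lm_def orth \<Phi>2)
      have "(G' has_real_derivative (\<kappa>\<^sup>2 - (\<Phi> x)\<^sup>2) * profile_fun (Lm (h\<^sub>2 (Z t))) x - profile_fun (h\<^sub>2 (Z t)) x
          + \<sigma> (Z t) * ((\<kappa>\<^sup>2 - (\<Phi> x)\<^sup>2) * \<Phi> x)) (at x)"
        unfolding G'_def [abs_def] by (rule DERIV_add[OF 2 DERIV_cmult[OF d\<Phi>(2)]])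
      then show "(G' has_real_derivative G'' x) (at x)"
        by (rule DERIV_cong) (simp add: G''_def G_def algebra_simps)
    qed
    have u_rot: "u t = rotated E (\<lambda>x. \<Phi> x + A x) G"
      by (rule ext) (simp add: u_split c_def rotated_def A_def G_def profile_fun_def algebra_simps)
    have cont: "continuous_on UNIV A''" "continuous_on UNIV G''"
      unfolding A''_def [abs_def] G''_def [abs_def] A_def G_def \<Phi>_def
      by (intro continuous_intros continuous_on_profile_fun)+
    have "has_weak_deriv 2 (u t) (rotated E A'' G'')"
      unfolding u_rot
    proof (rule has_weak_deriv_classical(3))
      show "(rotated E (\<lambda>x. \<Phi> x + A x) G has_vector_derivative rotated E A' G' x) (at x)" for x
        using rotated_has_derivative[OF dA(1) dG(1)] by (simp add: rotated_def)
      show "(rotated E A' G' has_vector_derivative rotated E A'' G'' x) (at x)" for x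
        using rotated_has_derivative[OF dA(2) dG(2)] by (simp add: rotated_def)
    qed (rule continuous_on_rotated[OF cont])
    moreover have "- rotated E A'' G'' x + complex_of_real \<zeta> * u t x - complex_of_real ((cmod (u t x))\<^sup>2) * u t x
          + \<i> * complex_of_real t * (- u t x + complex_of_real f) = 0" for x
    proof -
      define R where "R = \<Phi> x + A x"
      define I where "I = G x"
      have u: "u t x = E * Complex R I"
        by (simp add: u_rot rotated_def R_def I_def Complex_eq)
      have norm: "(cmod (u t x))\<^sup>2 = R\<^sup>2 + I\<^sup>2"
        unfolding u norm_mult E(2) by (simp add: cmod_power2)
      \<comment> \<open>Writing the real forcing as \<open>E\<close> times a complex number lets
        \<open>E\<close>, of modulus 1, be factored out of the whole equation.\<close>
      have fE: "complex_of_real f = E * Complex (f * cos \<theta>\<^sub>0) (f * - sin \<theta>\<^sub>0)"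
      proof -
        have "f = cos \<theta>\<^sub>0 * (f * cos \<theta>\<^sub>0) - sin \<theta>\<^sub>0 * (f * - sin \<theta>\<^sub>0)"
          using sin_cos_squared_add[of \<theta>\<^sub>0] by algebra
        moreover have "cos \<theta>\<^sub>0 * (f * - sin \<theta>\<^sub>0) + sin \<theta>\<^sub>0 * (f * cos \<theta>\<^sub>0) = 0" by simp
        moreover have "E = Complex (cos \<theta>\<^sub>0) (sin \<theta>\<^sub>0)" by (simp add: E(1) Complex_eq)
        ultimately show ?thesis by (simp only: complex_mult complex_of_real_def)
      qed
      have "- rotated E A'' G'' x + complex_of_real \<zeta> * u t x - complex_of_real ((cmod (u t x))\<^sup>2) * u t x
          + \<i> * complex_of_real t * (- u t x + complex_of_real f) =
        E * (- Complex (A'' x) (G'' x) + complex_of_real (\<kappa>\<^sup>2) * Complex R I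
          - complex_of_real (R\<^sup>2 + I\<^sup>2) * Complex R I
          + \<i> * complex_of_real t * (- Complex R I + Complex (f * cos \<theta>\<^sub>0) (f * - sin \<theta>\<^sub>0)))"
        unfolding norm unfolding u fE \<kappa>(2) by (simp add: rotated_def Complex_eq algebra_simps)
      also have "- Complex (A'' x) (G'' x) + complex_of_real (\<kappa>\<^sup>2) * Complex R I
          - complex_of_real (R\<^sup>2 + I\<^sup>2) * Complex R I
          + \<i> * complex_of_real t * (- Complex R I + Complex (f * cos \<theta>\<^sub>0) (f * - sin \<theta>\<^sub>0)) = 0"
      proof (rule complex_eqI)
        \<comment> \<open>The soliton equation cancels the terms without A and G, the operator
          \<open>Lp\<close> those linear in A, and \<open>eqs(2)\<close> the quadratic and cubic
          ones together with damping and forcing.\<close>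
        have "- A'' x + \<kappa>\<^sup>2 * R - (R\<^sup>2 + I\<^sup>2) * R + t * (I + f * sin \<theta>\<^sub>0) = 0"
          unfolding A''_def R_def I_def eqs(2) by algebra
        then show "Re (- Complex (A'' x) (G'' x) + complex_of_real (\<kappa>\<^sup>2) * Complex R I
          - complex_of_real (R\<^sup>2 + I\<^sup>2) * Complex R I
          + \<i> * complex_of_real t * (- Complex R I + Complex (f * cos \<theta>\<^sub>0) (f * - sin \<theta>\<^sub>0))) = Re 0"
          by (simp add: algebra_simps)
        have "- G'' x + \<kappa>\<^sup>2 * I - (R\<^sup>2 + I\<^sup>2) * I + t * (- R + f * cos \<theta>\<^sub>0) = 0"
          unfolding G''_def R_def I_def eqs(3) by algebra
        then show "Im (- Complex (A'' x) (G'' x) + complex_of_real (\<kappa>\<^sup>2) * Complex R I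
          - complex_of_real (R\<^sup>2 + I\<^sup>2) * Complex R I
          + \<i> * complex_of_real t * (- Complex R I + Complex (f * cos \<theta>\<^sub>0) (f * - sin \<theta>\<^sub>0))) = Im 0"
          by (simp add: algebra_simps)
      qed
      finally show ?thesis by simp
    qed
    ultimately show ?thesis unfolding solves_LLE_def by (intro exI[of _ "rotated E A'' G''"]) simp
  qed
  have "u t \<in> const_plus_H2" for t
    unfolding const_plus_H2_def mem_Collect_eq
    using C(2)[OF re\<Phi> im] u_split by (intro exI conjI) (rule ext, rule u_split, blast)
  moreover have "(u t \<longlongrightarrow> c (Z t)) at_top" "(u t \<longlongrightarrow> c (Z t)) at_bot" for t
    unfolding u_split [abs_def]
    using tendsto_add[OF tendsto_const rotated_tendsto_0(1)[OF re\<Phi> im]]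
      tendsto_add[OF tendsto_const rotated_tendsto_0(2)[OF re\<Phi> im]] by simp_all
  moreover have "u 0 = soliton \<zeta> \<theta>\<^sub>0"
    using linear_0[OF v_linear] linear_0[OF bounded_linear.linear[OF c_linear]]
    by (intro ext) (simp add: u_def Z0)
  moreover have "real_analytic_on (\<lambda>t. c (Z t)) {-r<..<r}"
    unfolding Z_def by (rule real_analytic_on_linear_image[OF c_linear z(1)])
  moreover have "H2_real_analytic_on (\<lambda>t. v (Z t)) {-r<..<r}"
    unfolding Z_def by (rule H2_real_analytic_on_linear_image[OF v_linear v_H2 K(1) z(1)])
  moreover have "(\<lambda>t. H2_norm (v (Z t))) \<in> O[at 0](\<lambda>t. \<bar>t\<bar>)"
  proof (rule bigoI)
    have "\<forall>\<^sub>F t in at (0::real). \<bar>t\<bar> < r"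
      using r by (auto simp: eventually_at dist_real_def)
    \<comment> \<open>The constant is the bound \<open>K\<close> of the linear map into
      \<open>H2\<close> times the factor from \<open>norm_power_series_le\<close>.\<close>
    then show "\<forall>\<^sub>F t in at 0. norm (H2_norm (v (Z t))) \<le> K * ((\<Sum>n. norm (z n) * r ^ n) / r) * norm \<bar>t\<bar>"
    proof eventually_elim
      case (elim t)
      have "H2_norm (v (Z t)) \<le> K * norm (Z t)" by (rule K)
      also have "\<dots> \<le> K * ((\<Sum>n. norm (z n) * r ^ n) / r * \<bar>t\<bar>)"
        unfolding Z_def using elim by (intro mult_left_mono norm_power_series_le z r K) auto
      finally show ?case by (simp add: H2_norm_nonneg mult.assoc)
    qed
  qed
  ultimately show ?thesis
    using r solves v_H2 real_analytic_on_const[of \<theta>\<^sub>0]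
    by (intro exI[of _ r] conjI exI[of _ u] exI[of _ "\<lambda>_. \<theta>\<^sub>0"] exI[of _ "\<lambda>t. c (Z t)"] exI[of _ "\<lambda>t. v (Z t)"])
       (auto simp: u_def [abs_def])
qed

end
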